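(* Let $\Gamma=(\mathcal P,\mathcal L)$ be an embeddable non-degenerate polar space of finite rank at least $2$ which admits the absolutely universal embedding. For $X\subseteq\mathcal P$, suppose that $\mathrm{rank}_{\mathrm{nd}}(\langle X\rangle_\Gamma)\geq 2$. Then $X$ contains a subset $Y$ such that $\langle Y\rangle_\Gamma=\langle X\rangle_\Gamma$ and $Y$ is minimal with respect to this property.
   Context: Polar spaces. A point-line geometry is a pair $\Gamma=(\mathcal P,\mathcal L)$ with $\mathcal P$ a non-empty set of points and $\mathcal L$ a family of subsets of $\mathcal P$ called lines. Two points are collinear, $p\perp q$, if they lie on a common line; $p^\perp$ is the set of points collinear with $p$, with $p\in p^\perp$ by convention, and $X^\perp:=\bigcap_{p\in X}p^\perp$ for $X\subseteq\mathcal P$. A subspace of $\Gamma$ is a subset $\mathcal S\subseteq\mathcal P$ such that every line meeting $\mathcal S$ in two distinct points is contained in $\mathcal S$. For $X\subseteq\mathcal P$, $\langle X\rangle_\Gamma$ is the smallest subspace of $\Gamma$ containing $X$ (the subspace generated by $X$). A polar space is (as usual) a point-line geometry satisfying the one-or-all axiom: each point is collinear with either exactly one or all points of any given line. A subspace $\mathcal S$ of a polar space, with the lines contained in it, is a possibly degenerate polar space, with radical $\mathrm{Rad}(\mathcal S)=\mathcal S^\perp\cap\mathcal S$; it is non-degenerate if $\mathrm{Rad}(\mathcal S)=\emptyset$. $\mathcal S$ is singular if $\mathcal S\subseteq\mathcal S^\perp$. The rank of a singular subspace (a projective space) is the size of a minimal spanning set of it; the rank of a polar space is the maximal rank of its singular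 subspaces. The non-degenerate rank of $\mathcal S$ is $\mathrm{rank}_{\mathrm{nd}}(\mathcal S):=\mathrm{rank}(\mathcal S)-\mathrm{rank}(\mathrm{Rad}(\mathcal S))$. Embeddings. A (full projective) embedding of $\Gamma$ is an injective map $\varepsilon:\mathcal P\to\mathrm{PG}(V)$, for a vector space $V$ over a division ring, such that $\varepsilon(\mathcal P)$ spans $\mathrm{PG}(V)$ and $\varepsilon(\ell)=\{\varepsilon(x)\}_{x\in\ell}$ is a (full) projective line for every $\ell\in\mathcal L$; $\Gamma$ is embeddable if it admits an embedding. For embeddings $\varepsilon_1:\Gamma\to\mathrm{PG}(V_1)$, $\varepsilon_2:\Gamma\to\mathrm{PG}(V_2)$ over the same division ring, a morphism (isomorphism) $\varepsilon_1\to\varepsilon_2$ is a (possibly partial) map (respectively, an isomorphism) $\varphi$ from $\mathrm{PG}(V_1)$ to $\mathrm{PG}(V_2)$ induced by a semilinear map $V_1\to V_2$ such that $\varepsilon_2=\varphi\cdot\varepsilon_1$. An embedding $\varepsilon$ is relatively universal if $\varepsilon'\cong\varepsilon$ for every embedding $\varepsilon'$ of $\Gamma$ with $\varepsilon'\to\varepsilon$; it is absolutely universal if moreover $\varepsilon\to\varepsilon'$ for every embedding $\varepsilon'$ of $\Gamma$. *)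

theory Defs
  imports "HOL-Algebra.Module" "HOL-Algebra.QuotRing" "HOL-Library.Extended_Nat"
begin

section \<open>Point-line geometries and polar spaces\<close>

record 'p geometry =
  points :: "'p set"
  lines :: "'p set set"

definition point_line_geometry :: "'p geometry \<Rightarrow> bool" where
  "point_line_geometry \<Gamma> \<longleftrightarrow> points \<Gamma> \<noteq> {} \<and> (\<forall>l\<in>lines \<Gamma>. l \<subseteq> points \<Gamma>)"

text \<open>A point counts as collinear with itself even if it lies on no line.\<close>

definition collinear :: "'p geometry \<Rightarrow> 'p \<Rightarrow> 'p \<Rightarrow> bool" where
  "collinear \<Gamma> p q \<longleftrightarrow> p = q \<or> (\<exists>l\<in>lines \<Gamma>. p \<in> l \<and> q \<in> l)"

definition perp :: "'p geometry \<Rightarrow> 'p set \<Rightarrow> 'p set" where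
  "perp \<Gamma> X = {q \<in> points \<Gamma>. \<forall>p\<in>X. collinear \<Gamma> p q}"

definition geom_subspace :: "'p geometry \<Rightarrow> 'p set \<Rightarrow> bool" where
  "geom_subspace \<Gamma> S \<longleftrightarrow> S \<subseteq> points \<Gamma> \<and>
     (\<forall>l\<in>lines \<Gamma>. (\<exists>x\<in>l \<inter> S. \<exists>y\<in>l \<inter> S. x \<noteq> y) \<longrightarrow> l \<subseteq> S)"

definition gen :: "'p geometry \<Rightarrow> 'p set \<Rightarrow> 'p set" where
  "gen \<Gamma> X = geom_subspace \<Gamma> hull X"

definition polar_space :: "'p geometry \<Rightarrow> bool" where
  "polar_space \<Gamma> \<longleftrightarrow> point_line_geometry \<Gamma> \<and>
     (\<forall>p\<in>points \<Gamma>. \<forall>l\<in>lines \<Gamma>.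
        (\<exists>!q. q \<in> l \<and> collinear \<Gamma> p q) \<or> (\<forall>q\<in>l. collinear \<Gamma> p q))"

definition induced :: "'p geometry \<Rightarrow> 'p set \<Rightarrow> 'p geometry" where
  "induced \<Gamma> S = \<lparr>points = S, lines = {l \<in> lines \<Gamma>. l \<subseteq> S}\<rparr>"

definition Rad :: "'p geometry \<Rightarrow> 'p set \<Rightarrow> 'p set" where
  "Rad \<Gamma> S = perp \<Gamma> S \<inter> S"

definition nondegenerate :: "'p geometry \<Rightarrow> bool" where
  "nondegenerate \<Gamma> \<longleftrightarrow> Rad \<Gamma> (points \<Gamma>) = {}"

definition singular :: "'p geometry \<Rightarrow> 'p set \<Rightarrow> bool" where
  "singular \<Gamma> S \<longleftrightarrow> S \<subseteq> perp \<Gamma> S"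

definition minimal_spanning :: "'p geometry \<Rightarrow> 'p set \<Rightarrow> 'p set \<Rightarrow> bool" where
  "minimal_spanning \<Gamma> S B \<longleftrightarrow> B \<subseteq> S \<and> gen \<Gamma> B = S \<and> (\<forall>C. C \<subset> B \<longrightarrow> gen \<Gamma> C \<noteq> S)"

text \<open>In a projective space all minimal spanning sets have the same size, so that the
  infimum below is this common size (and \<open>\<infinity>\<close> if there is no finite spanning set).\<close>

definition singular_rank :: "'p geometry \<Rightarrow> 'p set \<Rightarrow> enat" where
  "singular_rank \<Gamma> S =
     (INF B \<in> {B. minimal_spanning \<Gamma> S B}. if finite B then enat (card B) else \<infinity>)"

definition polar_rank :: "'p geometry \<Rightarrow> enat" where
  "polar_rank \<Gamma> = (SUP S \<in> {S. geom_subspace \<Gamma> S \<and> singular \<Gamma> S}. singular_rank \<Gamma> S)"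

definition rank_nd :: "'p geometry \<Rightarrow> 'p set \<Rightarrow> enat" where
  "rank_nd \<Gamma> S = polar_rank (induced \<Gamma> S) - singular_rank \<Gamma> (Rad \<Gamma> S)"


section \<open>Vector spaces over division rings\<close>

text \<open>The library's \<open>module\<close> locale requires commutative scalars.\<close>

locale skew_field = ring K for K (structure) +
  assumes one_neq_zero: "\<one> \<noteq> \<zero>"
    and nonzero_Units: "Units K = carrier K - {\<zero>}"

locale left_vector_space = K?: skew_field K + V?: abelian_group V
  for K :: "'k ring" (structure) and V :: "('k, 'v) module" (structure) +
  assumes smult_closed:
      "\<lbrakk>a \<in> carrier K; x \<in> carrier V\<rbrakk> \<Longrightarrow> a \<odot>\<^bsub>V\<^esub> x \<in> carrier V"
    and smult_l_distr:
      "\<lbrakk>a \<in> carrier K; b \<in> carrier K; x \<in> carrier V\<rbrakk> \<Longrightarrow>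
       (a \<oplus>\<^bsub>K\<^esub> b) \<odot>\<^bsub>V\<^esub> x = a \<odot>\<^bsub>V\<^esub> x \<oplus>\<^bsub>V\<^esub> b \<odot>\<^bsub>V\<^esub> x"
    and smult_r_distr:
      "\<lbrakk>a \<in> carrier K; x \<in> carrier V; y \<in> carrier V\<rbrakk> \<Longrightarrow>
       a \<odot>\<^bsub>V\<^esub> (x \<oplus>\<^bsub>V\<^esub> y) = a \<odot>\<^bsub>V\<^esub> x \<oplus>\<^bsub>V\<^esub> a \<odot>\<^bsub>V\<^esub> y"
    and smult_assoc:
      "\<lbrakk>a \<in> carrier K; b \<in> carrier K; x \<in> carrier V\<rbrakk> \<Longrightarrow>
       (a \<otimes>\<^bsub>K\<^esub> b) \<odot>\<^bsub>V\<^esub> x = a \<odot>\<^bsub>V\<^esub> (b \<odot>\<^bsub>V\<^esub> x)"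
    and smult_one: "x \<in> carrier V \<Longrightarrow> \<one>\<^bsub>K\<^esub> \<odot>\<^bsub>V\<^esub> x = x"

definition lin_span :: "'k ring \<Rightarrow> ('k, 'v) module \<Rightarrow> 'v set \<Rightarrow> 'v set" where
  "lin_span K V A = (\<lambda>W. submodule W K V) hull A"

text \<open>Points of \<open>PG(V)\<close> are represented by the 1-dimensional subspaces of \<open>V\<close>,
  lines of \<open>PG(V)\<close> by the sets of points contained in the span of two distinct points.\<close>

definition pg_points :: "'k ring \<Rightarrow> ('k, 'v) module \<Rightarrow> 'v set set" where
  "pg_points K V = {lin_span K V {v} |v. v \<in> carrier V \<and> v \<noteq> \<zero>\<^bsub>V\<^esub>}"

definition pg_lines :: "'k ring \<Rightarrow> ('k, 'v) module \<Rightarrow> 'v set set set" where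
  "pg_lines K V = {{r \<in> pg_points K V. r \<subseteq> lin_span K V (p \<union> q)} |p q.
     p \<in> pg_points K V \<and> q \<in> pg_points K V \<and> p \<noteq> q}"

text \<open>The companion \<open>\<sigma>\<close> is an isomorphism of division rings: having the same division
  ring is understood up to isomorphism.\<close>

definition semilinear ::
  "'k ring \<Rightarrow> ('k, 'v) module \<Rightarrow> 'k2 ring \<Rightarrow> ('k2, 'v2) module \<Rightarrow> ('v \<Rightarrow> 'v2) \<Rightarrow> bool" where
  "semilinear K V K' V' f \<longleftrightarrow>
     f \<in> carrier V \<rightarrow> carrier V' \<and>
     (\<forall>x\<in>carrier V. \<forall>y\<in>carrier V. f (x \<oplus>\<^bsub>V\<^esub> y) = f x \<oplus>\<^bsub>V'\<^esub> f y) \<and>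
     (\<exists>\<sigma>\<in>ring_iso K K'. \<forall>a\<in>carrier K. \<forall>x\<in>carrier V.
        f (a \<odot>\<^bsub>V\<^esub> x) = \<sigma> a \<odot>\<^bsub>V'\<^esub> f x)"


section \<open>Embeddings\<close>

definition embedding ::
  "'p geometry \<Rightarrow> 'k ring \<Rightarrow> ('k, 'v) module \<Rightarrow> ('p \<Rightarrow> 'v set) \<Rightarrow> bool" where
  "embedding \<Gamma> K V \<epsilon> \<longleftrightarrow>
     left_vector_space K V \<and>
     inj_on \<epsilon> (points \<Gamma>) \<and>
     \<epsilon> ` points \<Gamma> \<subseteq> pg_points K V \<and>
     lin_span K V (\<Union> (\<epsilon> ` points \<Gamma>)) = carrier V \<and>
     (\<forall>l\<in>lines \<Gamma>. \<epsilon> ` l \<in> pg_lines K V)"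

text \<open>The partial map \<open>PG(V\<^sub>1) \<rightarrow> PG(V\<^sub>2)\<close> induced by a semilinear map \<open>f\<close> takes a point
  \<open>p\<close> not contained in the kernel of \<open>f\<close> to \<open>f ` p\<close>. Since the \<open>\<epsilon>\<^sub>2 x\<close> are points, the
  equation \<open>f ` \<epsilon>\<^sub>1 x = \<epsilon>\<^sub>2 x\<close> includes that the partial map is defined at \<open>\<epsilon>\<^sub>1 x\<close>.\<close>

definition morphism ::
  "'p geometry \<Rightarrow> 'k ring \<Rightarrow> ('k, 'v) module \<Rightarrow> ('p \<Rightarrow> 'v set) \<Rightarrow>
   'k2 ring \<Rightarrow> ('k2, 'v2) module \<Rightarrow> ('p \<Rightarrow> 'v2 set) \<Rightarrow> bool" where
  "morphism \<Gamma> K\<^sub>1 V\<^sub>1 \<epsilon>\<^sub>1 K\<^sub>2 V\<^sub>2 \<epsilon>\<^sub>2 \<longleftrightarrow>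
     (\<exists>f. semilinear K\<^sub>1 V\<^sub>1 K\<^sub>2 V\<^sub>2 f \<and> (\<forall>x\<in>points \<Gamma>. f ` \<epsilon>\<^sub>1 x = \<epsilon>\<^sub>2 x))"

definition isomorphic ::
  "'p geometry \<Rightarrow> 'k ring \<Rightarrow> ('k, 'v) module \<Rightarrow> ('p \<Rightarrow> 'v set) \<Rightarrow>
   'k2 ring \<Rightarrow> ('k2, 'v2) module \<Rightarrow> ('p \<Rightarrow> 'v2 set) \<Rightarrow> bool" where
  "isomorphic \<Gamma> K\<^sub>1 V\<^sub>1 \<epsilon>\<^sub>1 K\<^sub>2 V\<^sub>2 \<epsilon>\<^sub>2 \<longleftrightarrow>
     (\<exists>f. semilinear K\<^sub>1 V\<^sub>1 K\<^sub>2 V\<^sub>2 f \<and> bij_betw f (carrier V\<^sub>1) (carrier V\<^sub>2) \<and>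
        (\<forall>x\<in>points \<Gamma>. f ` \<epsilon>\<^sub>1 x = \<epsilon>\<^sub>2 x))"

text \<open>Universality quantifies over all embeddings of \<open>\<Gamma>\<close>, over all division rings and vector
  spaces. HOL cannot quantify over types, so division rings with carrier in \<open>'p\<close> and vector
  spaces with carrier in \<open>'p \<Rightarrow> 'p\<close> are used. If \<open>\<Gamma>\<close> has a line \<open>l\<close>, this loses no
  generality: the image of \<open>l\<close> being a full line, the division ring \<open>K\<close> is in bijection
  with \<open>l\<close> minus a point; and the image of the point set being spanning, the vector
  space has a basis indexed by some set \<open>B\<close> of points, so that it is isomorphic to the
  space of finitely supported functions \<open>B \<rightarrow> K\<close>. Hence every embedding of \<open>\<Gamma>\<close> is
  isomorphic to one over these types. The embedding \<open>\<epsilon>\<close> itself may live on any types.\<close>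

definition relatively_universal ::
  "'p geometry \<Rightarrow> 'k ring \<Rightarrow> ('k, 'v) module \<Rightarrow> ('p \<Rightarrow> 'v set) \<Rightarrow> bool" where
  "relatively_universal \<Gamma> K V \<epsilon> \<longleftrightarrow>
     embedding \<Gamma> K V \<epsilon> \<and>
     (\<forall>(K' :: 'p ring) (V' :: ('p, 'p \<Rightarrow> 'p) module) \<epsilon>'.
        embedding \<Gamma> K' V' \<epsilon>' \<and> morphism \<Gamma> K' V' \<epsilon>' K V \<epsilon> \<longrightarrow>
        isomorphic \<Gamma> K' V' \<epsilon>' K V \<epsilon>)"

definition absolutely_universal ::
  "'p geometry \<Rightarrow> 'k ring \<Rightarrow> ('k, 'v) module \<Rightarrow> ('p \<Rightarrow> 'v set) \<Rightarrow> bool" where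
  "absolutely_universal \<Gamma> K V \<epsilon> \<longleftrightarrow>
     relatively_universal \<Gamma> K V \<epsilon> \<and>
     (\<forall>(K' :: 'p ring) (V' :: ('p, 'p \<Rightarrow> 'p) module) \<epsilon>'.
        embedding \<Gamma> K' V' \<epsilon>' \<longrightarrow> morphism \<Gamma> K V \<epsilon> K' V' \<epsilon>')"

end

theory Submission
  imports Defs
begin

text \<open>
  The theorem holds because, in the presence of a quadrangle, generating in \<open>\<Gamma>\<close> is the same as
  spanning in \<open>V\<close>. A quadrangle consists of points \<open>a \<bottom> b \<bottom> c \<bottom> d \<bottom> a\<close> such that neither \<open>a\<close> and \<open>c\<close>
  nor \<open>b\<close> and \<open>d\<close> are collinear; a subspace of non-degenerate rank at least 2 contains one
  (\<open>quadrangle_if_rank_nd\<close>). Every subspace that contains a quadrangle is the full preimage of the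
  projective subspace spanned by its image (\<open>subspace_arises\<close>). Since generation is finitary, some
  finite \<open>F \<subseteq> X\<close> already generates a quadrangle. Choose \<open>Y \<subseteq> X\<close> linearly independent modulo \<open>F\<close> such
  that \<open>F \<union> Y\<close> spans the same as \<open>X\<close>. Then \<open>F \<union> Y\<close> generates \<open>\<langle>X\<rangle>\<close>, and so does \<open>W \<union> Y\<close> for some
  smallest possible \<open>W \<subseteq> F\<close>. In \<open>W \<union> Y\<close> no point of \<open>Y\<close> can be omitted, because even all of \<open>F\<close> would not
  make up for it, and no point of \<open>W\<close>, because \<open>W\<close> is smallest.

  The proof of \<open>subspace_arises\<close> takes place in the cone \<open>C\<close> of all vectors that represent points.

  The points collinear with a point \<open>a\<close> span a hyperplane of \<open>V\<close> that
  contains no other points (\<open>tangent_space_perp\<close>, \<open>tangent_space_hyperplane\<close>), so \<open>a\<close> has a tangent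
  functional, unique up to scalars. The tangent functionals of the points of a line make up a line of
  the dual space (\<open>tangent_in_pencil\<close>, \<open>pencil_is_tangent\<close>). Hence mapping a point to its
  tangent functional is an embedding of \<open>\<Gamma>\<close> over the opposite division ring. By absolute universality
  there is a morphism from \<open>\<epsilon>\<close> to it; this is a sesquilinear form \<open>\<beta>\<close> for which, on \<open>C\<close>, being
  orthogonal means being collinear (\<open>universal_form\<close>). It satisfies \<open>\<beta> w v = (\<beta> v w)\<^sup>*\<close> for
  an involution \<open>t \<mapsto> t\<^sup>*\<close> of the scalars (\<open>adjoint_exists\<close>).

  Universality also bounds the number of points on a hyperbolic line. Call the scalars \<open>t - t\<^sup>*\<close>
  traces. The pairs \<open>(v, s)\<close> with \<open>\<beta> v v = s + s\<^sup>*\<close>, the scalar \<open>s\<close> being taken modulo traces, form a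
  vector space under \<open>(v, s) + (w, t) = (v + w, s + t + \<beta> v w)\<close>, and \<open>v \<mapsto> (v, 0)\<close> embeds \<open>\<Gamma>\<close> in it. The
  morphism from \<open>\<epsilon>\<close> to this embedding is additive, which implies that \<open>k\<close> is a trace whenever \<open>a\<close>, \<open>c\<close> and
  \<open>k a + c\<close> lie in \<open>C\<close> and \<open>\<beta> a c = 1\<close> (\<open>hyperbolic_line_traces\<close>).

  A quadrangle generates all these points, by an explicit construction
  (\<open>trace_point\<close>), and therefore all points in its linear span (\<open>quad_span\<close>). Passing from a
  subspace of \<open>V\<close> to one of one dimension more is elementary (\<open>extend_span\<close>), and
  \<open>csub_spanned\<close> follows by induction.
\<close>

section \<open>Closure operators with exchange\<close>

locale exchange_closure =
  fixes E :: "'a set" and cl :: "'a set \<Rightarrow> 'a set"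
  assumes cl_into: "A \<subseteq> E \<Longrightarrow> cl A \<subseteq> E"
    and cl_extensive: "A \<subseteq> E \<Longrightarrow> A \<subseteq> cl A"
    and cl_mono: "A \<subseteq> B \<Longrightarrow> B \<subseteq> E \<Longrightarrow> cl A \<subseteq> cl B"
    and cl_idem: "A \<subseteq> E \<Longrightarrow> cl (cl A) \<subseteq> cl A"
    and cl_finitary: "A \<subseteq> E \<Longrightarrow> x \<in> cl A \<Longrightarrow> \<exists>F\<subseteq>A. finite F \<and> x \<in> cl F"
    and cl_exchange: "A \<subseteq> E \<Longrightarrow> x \<in> E \<Longrightarrow> y \<in> cl (insert x A) \<Longrightarrow> y \<notin> cl A \<Longrightarrow>
      x \<in> cl (insert y A)"
begin

definition indep :: "'a set \<Rightarrow> bool" where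
  "indep A \<longleftrightarrow> A \<subseteq> E \<and> (\<forall>x\<in>A. x \<notin> cl (A - {x}))"

lemma cl_least: "A \<subseteq> cl B \<Longrightarrow> B \<subseteq> E \<Longrightarrow> cl A \<subseteq> cl B"
  by (meson cl_into cl_idem cl_mono subset_trans)

text \<open>
  The base set \<open>B\<close> stays fixed while a maximal subset of \<open>X\<close> that is independent modulo \<open>B\<close> is chosen by
  Zorn's lemma. Finitariness makes independence pass to unions of chains, and exchange makes a
  maximal independent set spanning.\<close>

lemma exists_relative_basis:
  assumes B: "B \<subseteq> E" and X: "X \<subseteq> E"
  shows "\<exists>Y\<subseteq>X. cl (B \<union> Y) = cl (B \<union> X) \<and> (\<forall>y\<in>Y. y \<notin> cl (B \<union> (Y - {y})))"
proof -
  define \<I> where "\<I> = {Y. Y \<subseteq> X \<and> (\<forall>y\<in>Y. y \<notin> cl (B \<union> (Y - {y})))}"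
  have "\<exists>M\<in>\<I>. \<forall>Y\<in>\<I>. M \<subseteq> Y \<longrightarrow> Y = M"
  proof (rule Zorn_Lemma, rule ballI)
    fix \<C> assume "\<C> \<in> chains \<I>"
    then have sub: "\<C> \<subseteq> \<I>" and chain: "\<And>P Q. P \<in> \<C> \<Longrightarrow> Q \<in> \<C> \<Longrightarrow> P \<subseteq> Q \<or> Q \<subseteq> P"
      by (auto simp: chains_def chain_subset_def)
    have U: "\<Union>\<C> \<subseteq> X" using sub by (auto simp: \<I>_def)
    have "y \<notin> cl (B \<union> (\<Union>\<C> - {y}))" if y: "y \<in> \<Union>\<C>" for y
    proof
      assume "y \<in> cl (B \<union> (\<Union>\<C> - {y}))"
      then obtain F where F: "F \<subseteq> B \<union> (\<Union>\<C> - {y})" "finite F" "y \<in> cl F"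
        using cl_finitary[of "B \<union> (\<Union>\<C> - {y})" y] B X U by blast
      have "\<exists>P\<in>\<C>. G \<subseteq> P" if "finite G" "G \<subseteq> \<Union>\<C>" for G
        using that
      proof (induction G)
        case empty then show ?case using y by blast
      next
        case (insert g G)
        then obtain P Q where PQ: "P \<in> \<C>" "G \<subseteq> P" "Q \<in> \<C>" "g \<in> Q" by auto
        then consider "P \<subseteq> Q" | "Q \<subseteq> P" using chain[of P Q] by blast
        then show ?case using PQ by cases blast+
      qed
      from this[of "insert y (F - B)"] obtain P where P: "P \<in> \<C>" "y \<in> P" "F - B \<subseteq> P"
        using F y by auto
      then have "F \<subseteq> B \<union> (P - {y})" using F(1) by blast
      then have "y \<in> cl (B \<union> (P - {y}))"
        using F(3) cl_mono[of F "B \<union> (P - {y})"] B X U P(1) by blast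
      then show False using P sub by (auto simp: \<I>_def)
    qed
    then show "\<Union>\<C> \<in> \<I>" using U by (simp add: \<I>_def)
  qed
  then obtain M where M: "M \<in> \<I>" and max: "\<And>Y. Y \<in> \<I> \<Longrightarrow> M \<subseteq> Y \<Longrightarrow> Y = M" by blast
  have MX: "M \<subseteq> X" and ind: "\<And>y. y \<in> M \<Longrightarrow> y \<notin> cl (B \<union> (M - {y}))"
    using M by (auto simp: \<I>_def)
  have ME: "B \<union> M \<subseteq> E" using MX X B by blast
  have "x \<in> cl (B \<union> M)" if x: "x \<in> X" for x
  proof (rule ccontr)
    assume nx: "x \<notin> cl (B \<union> M)"
    then have xM: "x \<notin> M" using cl_extensive[OF ME] by blast
    have "y \<notin> cl (B \<union> (insert x M - {y}))" if y: "y \<in> insert x M" for y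
    proof (cases "y = x")
      case True then show ?thesis using nx xM by simp
    next
      case False
      then have yM: "y \<in> M" using y by blast
      show ?thesis
      proof
        assume a: "y \<in> cl (B \<union> (insert x M - {y}))"
        have eq: "B \<union> (insert x M - {y}) = insert x (B \<union> (M - {y}))" using False by blast
        have "x \<in> cl (insert y (B \<union> (M - {y})))"
          using cl_exchange[of "B \<union> (M - {y})" x y] a ind[OF yM] ME x X unfolding eq by blast
        moreover have "insert y (B \<union> (M - {y})) = B \<union> M" using yM by blast
        ultimately show False using nx by simp
      qed
    qed
    then have "insert x M \<in> \<I>" using MX x by (simp add: \<I>_def)
    then show False using max[of "insert x M"] xM by blast
  qed
  then have "cl (B \<union> X) \<subseteq> cl (B \<union> M)" using cl_least[of "B \<union> X" "B \<union> M"] cl_extensive[OF ME] ME by blast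
  moreover have "cl (B \<union> M) \<subseteq> cl (B \<union> X)" using cl_mono[of "B \<union> M" "B \<union> X"] MX B X by blast
  ultimately show ?thesis using MX ind by (intro exI[of _ M]) blast
qed

text \<open>
  The Steinitz argument: as long as \<open>C\<close> has an element outside \<open>D\<close>, this element can be replaced by one of
  \<open>D\<close> without losing independence.\<close>

lemma indep_card_le:
  assumes "indep C" "finite C" "finite D" "D \<subseteq> E" "C \<subseteq> cl D"
  shows "card C \<le> card D"
  using assms
proof (induction "card (C - D)" arbitrary: C rule: less_induct)
  case less
  show ?case
  proof (cases "C \<subseteq> D")
    case True then show ?thesis using less.prems by (simp add: card_mono)
  next
    case False
    then obtain x where x: "x \<in> C" "x \<notin> D" by blast
    have CE: "C \<subseteq> E" and ind: "\<And>y. y \<in> C \<Longrightarrow> y \<notin> cl (C - {y})"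
      using less.prems(1) by (auto simp: indep_def)
    have "\<not> D \<subseteq> cl (C - {x})"
      using cl_least[of D "C - {x}"] ind[OF x(1)] CE less.prems(5) x(1) by blast
    then obtain d where d: "d \<in> D" "d \<notin> cl (C - {x})" by blast
    have CxE: "C - {x} \<subseteq> E" using CE by blast
    have dC: "d \<notin> C" using d x cl_extensive[OF CxE] by blast
    let ?C = "insert d (C - {x})"
    have "indep ?C"
      unfolding indep_def
    proof (intro conjI ballI)
      show "?C \<subseteq> E" using CE d less.prems(4) by blast
      fix y assume y: "y \<in> ?C"
      show "y \<notin> cl (?C - {y})"
      proof (cases "y = d")
        case True then show ?thesis using d dC by simp
      next
        case False
        then have yC: "y \<in> C" "y \<noteq> x" using y by auto
        have eq: "?C - {y} = insert d (C - {x} - {y})" using False by blast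
        have eq2: "insert y (C - {x} - {y}) = C - {x}" using yC by blast
        have "cl (C - {x} - {y}) \<subseteq> cl (C - {y})" using CE by (intro cl_mono) auto
        then have "y \<notin> cl (C - {x} - {y})" using ind[OF yC(1)] by blast
        then show ?thesis
          using cl_exchange[of "C - {x} - {y}" d y] d CE less.prems(4) unfolding eq eq2 by blast
      qed
    qed
    moreover have "card (?C - D) < card (C - D)"
      using x d dC less.prems(2) by (intro psubset_card_mono) auto
    moreover have "?C \<subseteq> cl D" using less.prems(5) d cl_extensive[OF less.prems(4)] by blast
    ultimately have "card ?C \<le> card D" using less.hyps[of ?C] less.prems by simp
    moreover have "card ?C = card C" using x dC less.prems(2)
      by (metis card_insert_disjoint card.remove DiffD1 finite_Diff)
    ultimately show ?thesis by simp
  qed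
qed

text \<open>This bounds the rank of a singular subspace by the size of any finite set that spans a larger one.\<close>

lemma exists_small_basis:
  assumes D: "finite D" "D \<subseteq> E" and M: "M \<subseteq> cl D"
  shows "\<exists>B\<subseteq>M. finite B \<and> card B \<le> card D \<and> indep B \<and> cl B = cl M"
proof -
  have ME: "M \<subseteq> E" using M D cl_into by blast
  from exists_relative_basis[of "{}" M] ME obtain Y where
    Y: "Y \<subseteq> M" "cl Y = cl M" and ind: "\<And>y. y \<in> Y \<Longrightarrow> y \<notin> cl (Y - {y})"
    by auto
  have iY: "indep Y" using Y ME ind by (auto simp: indep_def)
  have bound: "card F \<le> card D" if F: "F \<subseteq> Y" "finite F" for F
  proof -
    have "indep F"
      unfolding indep_def
    proof (intro conjI ballI)
      show "F \<subseteq> E" using F Y ME by blast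
      fix x assume x: "x \<in> F"
      have "cl (F - {x}) \<subseteq> cl (Y - {x})" using F Y ME by (intro cl_mono) auto
      then show "x \<notin> cl (F - {x})" using ind x F by blast
    qed
    then show ?thesis using indep_card_le[of F D] F D M Y by blast
  qed
  have "finite Y"
  proof (rule ccontr)
    assume "infinite Y"
    then obtain F where "F \<subseteq> Y" "finite F" "card F = Suc (card D)"
      using infinite_arbitrarily_large by blast
    then show False using bound[of F] by simp
  qed
  then show ?thesis using Y iY bound[of Y] by blast
qed

end

section \<open>Linear algebra over a division ring\<close>

context left_vector_space
begin

abbreviation vadd (infixl \<open>+\<^sub>v\<close> 65) where "x +\<^sub>v y \<equiv> x \<oplus>\<^bsub>V\<^esub> y"
abbreviation vsm (infixr \<open>\<cdot>\<close> 75) where "a \<cdot> x \<equiv> a \<odot>\<^bsub>V\<^esub> x"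
abbreviation vzero (\<open>0\<^sub>v\<close>) where "0\<^sub>v \<equiv> \<zero>\<^bsub>V\<^esub>"
abbreviation span where "span A \<equiv> lin_span K V A"
abbreviation subsp where "subsp W \<equiv> submodule W K V"

declare smult_closed [simp, intro] smult_one [simp]

lemma nonzero_unit: "a \<in> carrier K \<Longrightarrow> a \<noteq> \<zero> \<Longrightarrow> a \<in> Units K"
  using nonzero_Units by blast

lemma inv_K [simp]:
  assumes "a \<in> carrier K" "a \<noteq> \<zero>"
  shows "inv a \<in> carrier K" "inv a \<noteq> \<zero>" "inv a \<otimes> a = \<one>" "a \<otimes> inv a = \<one>"
proof -
  have u: "a \<in> Units K" using assms nonzero_unit by blast
  then show "inv a \<in> carrier K" "inv a \<otimes> a = \<one>" "a \<otimes> inv a = \<one>" by auto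
  show "inv a \<noteq> \<zero>" using Units_inv_Units[OF u] nonzero_Units by blast
qed

lemma K_cancel_l: "a \<in> carrier K \<Longrightarrow> b \<in> carrier K \<Longrightarrow> b \<noteq> \<zero> \<Longrightarrow> inv b \<otimes> (b \<otimes> a) = a"
  by (metis inv_K(1,3) K.m_assoc K.l_one)

lemma K_cancel_l': "a \<in> carrier K \<Longrightarrow> b \<in> carrier K \<Longrightarrow> b \<noteq> \<zero> \<Longrightarrow> b \<otimes> (inv b \<otimes> a) = a"
  by (metis inv_K(1,4) K.m_assoc K.l_one)

lemma K_integral: "a \<in> carrier K \<Longrightarrow> b \<in> carrier K \<Longrightarrow> a \<otimes> b = \<zero> \<longleftrightarrow> a = \<zero> \<or> b = \<zero>"
  by (metis K.l_null K.r_null inv_K(1,3) K.m_assoc K.l_one)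

lemma smult_zero_l [simp]: "x \<in> carrier V \<Longrightarrow> \<zero> \<cdot> x = 0\<^sub>v"
  by (metis K.zero_closed K.l_zero smult_l_distr smult_closed V.add.r_cancel_one')

lemma smult_zero_r [simp]: "a \<in> carrier K \<Longrightarrow> a \<cdot> 0\<^sub>v = 0\<^sub>v"
  by (metis V.zero_closed V.l_zero smult_r_distr smult_closed V.add.r_cancel_one')

lemma smult_minus_l: "a \<in> carrier K \<Longrightarrow> x \<in> carrier V \<Longrightarrow> (\<ominus> a) \<cdot> x = \<ominus>\<^bsub>V\<^esub> (a \<cdot> x)"
  by (metis K.a_inv_closed K.l_neg smult_l_distr smult_closed smult_zero_l V.minus_equality)

lemma minus_smult: "x \<in> carrier V \<Longrightarrow> \<ominus>\<^bsub>V\<^esub> x = (\<ominus> \<one>) \<cdot> x"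
  by (simp add: smult_minus_l)

lemma smult_eq_zero: "a \<in> carrier K \<Longrightarrow> x \<in> carrier V \<Longrightarrow> a \<cdot> x = 0\<^sub>v \<longleftrightarrow> a = \<zero> \<or> x = 0\<^sub>v"
  by (metis inv_K(1,3) smult_assoc smult_one smult_zero_l smult_zero_r)

lemma smult_inv: "a \<in> carrier K \<Longrightarrow> a \<noteq> \<zero> \<Longrightarrow> x \<in> carrier V \<Longrightarrow> inv a \<cdot> (a \<cdot> x) = x"
  by (metis inv_K(1,3) smult_assoc smult_one)

text \<open>
  Differences are written as sums with a multiple throughout, so that closure under sums and multiples
  is all that is ever needed of a subspace.\<close>

lemma add_smult_cancel:
  assumes "k \<in> carrier K" "x \<in> carrier V" "y \<in> carrier V"
  shows "(x +\<^sub>v k \<cdot> y) +\<^sub>v (\<ominus> k) \<cdot> y = x"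
  using assms by (simp add: V.a_assoc smult_l_distr[symmetric] K.r_neg)

lemma add_minus_cancel:
  assumes "x \<in> carrier V" "y \<in> carrier V"
  shows "(x +\<^sub>v y) +\<^sub>v (\<ominus> \<one>) \<cdot> y = x"
  using add_smult_cancel[of \<one> x y] assms by simp

lemma subsp_iff:
  "subsp W \<longleftrightarrow> W \<subseteq> carrier V \<and> 0\<^sub>v \<in> W \<and> (\<forall>x\<in>W. \<forall>y\<in>W. x +\<^sub>v y \<in> W) \<and>
    (\<forall>a\<in>carrier K. \<forall>x\<in>W. a \<cdot> x \<in> W)"
proof
  assume W: "subsp W"
  then have "subgroup W (add_monoid V)" by (rule submodule.axioms)
  then show "W \<subseteq> carrier V \<and> 0\<^sub>v \<in> W \<and> (\<forall>x\<in>W. \<forall>y\<in>W. x +\<^sub>v y \<in> W) \<and>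
    (\<forall>a\<in>carrier K. \<forall>x\<in>W. a \<cdot> x \<in> W)"
    using submodule.smult_closed[OF W]
    by (auto simp: subgroup_def)
next
  assume W: "W \<subseteq> carrier V \<and> 0\<^sub>v \<in> W \<and> (\<forall>x\<in>W. \<forall>y\<in>W. x +\<^sub>v y \<in> W) \<and>
    (\<forall>a\<in>carrier K. \<forall>x\<in>W. a \<cdot> x \<in> W)"
  have "\<ominus>\<^bsub>V\<^esub> x \<in> W" if "x \<in> W" for x
    using W that minus_smult[of x] by (metis K.a_inv_closed K.one_closed subsetD)
  then show "subsp W" using W
    by (intro submodule.intro subgroup.intro submodule_axioms.intro) (auto simp: a_inv_def)
qed

lemma subspI:
  assumes "W \<subseteq> carrier V" "0\<^sub>v \<in> W" "\<And>x y. x \<in> W \<Longrightarrow> y \<in> W \<Longrightarrow> x +\<^sub>v y \<in> W"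
    "\<And>a x. a \<in> carrier K \<Longrightarrow> x \<in> W \<Longrightarrow> a \<cdot> x \<in> W"
  shows "subsp W"
  using assms by (simp add: subsp_iff)

lemma subspD:
  assumes "subsp W"
  shows "W \<subseteq> carrier V" "0\<^sub>v \<in> W" "\<And>x y. x \<in> W \<Longrightarrow> y \<in> W \<Longrightarrow> x +\<^sub>v y \<in> W"
    "\<And>a x. a \<in> carrier K \<Longrightarrow> x \<in> W \<Longrightarrow> a \<cdot> x \<in> W"
  using assms by (simp_all add: subsp_iff)

lemma subsp_add_cancel:
  assumes "subsp W" "x \<in> carrier V" "y \<in> W" "x +\<^sub>v y \<in> W"
  shows "x \<in> W"
proof -
  have "(x +\<^sub>v y) +\<^sub>v (\<ominus> \<one>) \<cdot> y \<in> W" using assms subspD[OF assms(1)] by simp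
  then show ?thesis using add_minus_cancel[of x y] assms subspD(1)[OF assms(1)] by auto
qed

lemma subsp_smult_cancel:
  assumes "subsp W" "a \<in> carrier K" "a \<noteq> \<zero>" "x \<in> carrier V" "a \<cdot> x \<in> W"
  shows "x \<in> W"
  using assms smult_inv[of a x] subspD(4)[OF assms(1), of "inv a" "a \<cdot> x"] by simp

lemma subsp_carrier: "subsp (carrier V)"
  by (rule subspI) auto

lemma subsp_span: "A \<subseteq> carrier V \<Longrightarrow> subsp (span A)"
  unfolding lin_span_def hull_def
  by (rule subspI) (use subsp_carrier in \<open>auto simp: subspD\<close>)

lemma span_superset: "A \<subseteq> span A"
  by (simp add: lin_span_def hull_subset)

lemma span_base: "x \<in> A \<Longrightarrow> x \<in> span A"
  using span_superset by blast

lemma span_least: "A \<subseteq> W \<Longrightarrow> subsp W \<Longrightarrow> span A \<subseteq> W"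
  by (simp add: lin_span_def hull_minimal)

lemma span_mono: "A \<subseteq> B \<Longrightarrow> span A \<subseteq> span B"
  by (simp add: lin_span_def hull_mono)

lemma span_carrier: "A \<subseteq> carrier V \<Longrightarrow> span A \<subseteq> carrier V"
  using subspD(1)[OF subsp_span] .

lemma span_span_least: "A \<subseteq> span B \<Longrightarrow> B \<subseteq> carrier V \<Longrightarrow> span A \<subseteq> span B"
  by (simp add: span_least subsp_span)

lemma span_empty: "span {} = {0\<^sub>v}"
proof
  show "span {} \<subseteq> {0\<^sub>v}" by (rule span_least) (auto intro!: subspI)
  show "{0\<^sub>v} \<subseteq> span {}" using subspD(2)[OF subsp_span[of "{}"]] by simp
qed

lemma span_insert:
  assumes x: "x \<in> carrier V" and A: "A \<subseteq> carrier V"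
  shows "span (insert x A) = {k \<cdot> x +\<^sub>v u |k u. k \<in> carrier K \<and> u \<in> span A}" (is "_ = ?S")
proof
  note sA = subspD[OF subsp_span[OF A]]
  have "subsp ?S"
  proof (rule subspI)
    show "?S \<subseteq> carrier V" using x sA(1) by auto
    have "0\<^sub>v = \<zero> \<cdot> x +\<^sub>v 0\<^sub>v" using x by simp
    then show "0\<^sub>v \<in> ?S" using sA(2) by blast
  next
    fix y z assume "y \<in> ?S" "z \<in> ?S"
    then obtain k u l w where *: "y = k \<cdot> x +\<^sub>v u" "z = l \<cdot> x +\<^sub>v w" "k \<in> carrier K" "l \<in> carrier K"
      "u \<in> span A" "w \<in> span A" by blast
    then have "y +\<^sub>v z = (k \<oplus> l) \<cdot> x +\<^sub>v (u +\<^sub>v w)"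
      using x subsetD[OF sA(1)] by (simp add: smult_l_distr V.a_ac)
    then show "y +\<^sub>v z \<in> ?S" using * sA(3) by blast
  next
    fix a y assume a: "a \<in> carrier K" and "y \<in> ?S"
    then obtain k u where *: "y = k \<cdot> x +\<^sub>v u" "k \<in> carrier K" "u \<in> span A" by blast
    then have "a \<cdot> y = (a \<otimes> k) \<cdot> x +\<^sub>v a \<cdot> u"
      using a x subsetD[OF sA(1)] by (simp add: smult_r_distr smult_assoc)
    then show "a \<cdot> y \<in> ?S" using * a sA(4) by blast
  qed
  moreover have "insert x A \<subseteq> ?S"
  proof -
    have "x = \<one> \<cdot> x +\<^sub>v 0\<^sub>v" using x by simp
    then have "x \<in> ?S" using sA(2) by blast
    moreover have "y \<in> ?S" if "y \<in> A" for y
    proof -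
      have "y = \<zero> \<cdot> x +\<^sub>v y" using x A that by auto
      then show ?thesis using span_base[OF that] by blast
    qed
    ultimately show ?thesis by blast
  qed
  ultimately show "span (insert x A) \<subseteq> ?S" by (simp add: span_least)
next
  have "insert x A \<subseteq> carrier V" using x A by simp
  note sA = subspD[OF subsp_span[OF this]]
  show "?S \<subseteq> span (insert x A)"
    using sA(3,4) span_base[of x "insert x A"] span_mono[of A "insert x A"] by blast
qed

lemma span_insertE:
  assumes "y \<in> span (insert x A)" "x \<in> carrier V" "A \<subseteq> carrier V"
  obtains k u where "k \<in> carrier K" "u \<in> span A" "y = k \<cdot> x +\<^sub>v u"
  using assms span_insert by auto

lemma span_singleton: "x \<in> carrier V \<Longrightarrow> span {x} = {k \<cdot> x |k. k \<in> carrier K}"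
  by (subst span_insert) (auto simp: span_empty, metis V.r_zero smult_closed)

lemma span_pair:
  assumes "x \<in> carrier V" "y \<in> carrier V"
  shows "span {x, y} = {k \<cdot> x +\<^sub>v l \<cdot> y |k l. k \<in> carrier K \<and> l \<in> carrier K}"
  using assms by (subst span_insert) (auto simp: span_singleton)

lemma span_singleton_smult:
  assumes "a \<in> carrier K" "a \<noteq> \<zero>" "x \<in> carrier V"
  shows "span {a \<cdot> x} = span {x}"
proof
  show "span {a \<cdot> x} \<subseteq> span {x}"
    using assms by (intro span_span_least) (auto simp: span_singleton)
  have "x = inv a \<cdot> (a \<cdot> x)" using assms by (simp add: smult_inv)
  then have "x \<in> span {a \<cdot> x}" using assms by (auto simp: span_singleton)
  then show "span {x} \<subseteq> span {a \<cdot> x}"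
    using assms by (intro span_span_least) auto
qed

lemma span_singleton_eqD:
  assumes "span {x} = span {y}" "x \<in> carrier V" "y \<in> carrier V" "y \<noteq> 0\<^sub>v"
  shows "\<exists>a\<in>carrier K. a \<noteq> \<zero> \<and> y = a \<cdot> x"
proof -
  have "y \<in> span {x}" using assms span_base[of y "{y}"] by simp
  then obtain k where "k \<in> carrier K" "y = k \<cdot> x" using assms(2) by (auto simp: span_singleton)
  then show ?thesis using assms by (intro bexI[of _ k]) auto
qed

lemma span_singleton_absorb:
  assumes "v \<in> span {x}" "v \<noteq> 0\<^sub>v" "x \<in> carrier V"
  shows "span {v} = span {x}"
proof -
  obtain k where k: "k \<in> carrier K" "v = k \<cdot> x" using assms by (auto simp: span_singleton)
  then have "k \<noteq> \<zero>" using assms by auto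
  then show ?thesis using k assms span_singleton_smult[of k x] by auto
qed

lemma span_finitary:
  assumes v: "v \<in> span A" and A: "A \<subseteq> carrier V"
  shows "\<exists>F\<subseteq>A. finite F \<and> v \<in> span F"
proof -
  let ?S = "{v. \<exists>F\<subseteq>A. finite F \<and> v \<in> span F}"
  have "subsp ?S"
  proof (rule subspI)
    show "?S \<subseteq> carrier V" using span_carrier A by blast
    show "0\<^sub>v \<in> ?S" using span_empty by (auto intro!: exI[of _ "{}"])
  next
    fix x y assume "x \<in> ?S" "y \<in> ?S"
    then obtain F G where FG: "F \<subseteq> A" "finite F" "x \<in> span F" "G \<subseteq> A" "finite G" "y \<in> span G" by blast
    then have "x \<in> span (F \<union> G)" "y \<in> span (F \<union> G)" using span_mono by blast+
    then have "x +\<^sub>v y \<in> span (F \<union> G)" using subspD(3)[OF subsp_span] FG A by (metis Un_least subset_trans)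
    then show "x +\<^sub>v y \<in> ?S" using FG by (auto intro!: exI[of _ "F \<union> G"])
  next
    fix a x assume "a \<in> carrier K" "x \<in> ?S"
    then obtain F where "F \<subseteq> A" "finite F" "x \<in> span F" by blast
    then show "a \<cdot> x \<in> ?S"
      using subspD(4)[OF subsp_span, of F a x] A \<open>a \<in> carrier K\<close> by blast
  qed
  moreover have "A \<subseteq> ?S"
  proof
    fix x assume "x \<in> A"
    then have "{x} \<subseteq> A" "finite {x}" "x \<in> span {x}" using span_base by auto
    then show "x \<in> ?S" by blast
  qed
  ultimately show ?thesis using span_least v by blast
qed

lemma span_exchange:
  assumes A: "A \<subseteq> carrier V" and x: "x \<in> carrier V"
    and y: "y \<in> span (insert x A)" "y \<notin> span A"
  shows "x \<in> span (insert y A)"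
proof -
  obtain k u where ku: "k \<in> carrier K" "u \<in> span A" "y = k \<cdot> x +\<^sub>v u" using span_insertE[OF y(1) x A] .
  have yV: "y \<in> carrier V" using y(1) span_carrier[of "insert x A"] x A by blast
  have uV: "u \<in> carrier V" using ku span_carrier[OF A] by blast
  have "k \<noteq> \<zero>" using ku y(2) x uV by auto
  have s: "subsp (span (insert y A))" using subsp_span yV A by simp
  have "y \<in> span (insert y A)" "u \<in> span (insert y A)"
    using span_base ku span_mono[of A "insert y A"] by auto
  then have "k \<cdot> x \<in> span (insert y A)" using subsp_add_cancel[OF s] ku x by auto
  then show ?thesis using subsp_smult_cancel[OF s] ku x \<open>k \<noteq> \<zero>\<close> by blast
qed

lemma pair_coeffs:
  assumes "x \<in> carrier V" "x \<noteq> 0\<^sub>v" "y \<in> carrier V" "y \<notin> span {x}"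
    and "a \<in> carrier K" "b \<in> carrier K" "c \<in> carrier K" "d \<in> carrier K"
    and eq: "a \<cdot> x +\<^sub>v b \<cdot> y = c \<cdot> x +\<^sub>v d \<cdot> y"
  shows "a = c" "b = d"
proof -
  have s: "subsp (span {x})" using subsp_span assms by simp
  have "(b \<ominus> d) \<cdot> y +\<^sub>v a \<cdot> x = (\<ominus> d) \<cdot> y +\<^sub>v (a \<cdot> x +\<^sub>v b \<cdot> y)"
    using assms(1-8) by (simp add: K.minus_eq smult_l_distr V.a_ac)
  also have "\<dots> = (\<ominus> d) \<cdot> y +\<^sub>v (c \<cdot> x +\<^sub>v d \<cdot> y)" using eq by simp
  also have "\<dots> = c \<cdot> x +\<^sub>v ((\<ominus> d) \<cdot> y +\<^sub>v d \<cdot> y)" using assms(1-8) by (simp add: V.a_ac)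
  also have "\<dots> = c \<cdot> x" using assms(1-8) by (simp add: smult_l_distr[symmetric] K.l_neg)
  finally have "(b \<ominus> d) \<cdot> y \<in> span {x}"
    using subsp_add_cancel[OF s, of "(b \<ominus> d) \<cdot> y" "a \<cdot> x"] subspD(4)[OF s] assms(1-8)
    by (simp add: span_base)
  then have "b \<ominus> d = \<zero>" using subsp_smult_cancel[OF s, of "b \<ominus> d" y] assms(1-8) by auto
  then show bd: "b = d" using K.minus_equality[of b "\<ominus> d"] assms(1-8) by (simp add: K.minus_eq)
  have "a \<cdot> x = c \<cdot> x"
    using eq bd assms(1-8) add_smult_cancel[of b "a \<cdot> x" y] add_smult_cancel[of b "c \<cdot> x" y] by simp
  then have "(a \<ominus> c) \<cdot> x = c \<cdot> x +\<^sub>v (\<ominus> c) \<cdot> x"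
    using assms(1-8) by (simp add: K.minus_eq smult_l_distr)
  then have "(a \<ominus> c) \<cdot> x = 0\<^sub>v" using assms(1-8) by (simp add: smult_l_distr[symmetric] K.r_neg)
  then have "a \<ominus> c = \<zero>" using smult_eq_zero assms(1-8) by simp
  then show "a = c" using K.minus_equality[of a "\<ominus> c"] assms(1-8) by (simp add: K.minus_eq)
qed

lemma comb_nonzero:
  assumes "x \<in> carrier V" "x \<noteq> 0\<^sub>v" "y \<in> carrier V" "y \<notin> span {x}" "k \<in> carrier K"
  shows "x +\<^sub>v k \<cdot> y \<noteq> 0\<^sub>v"
proof
  assume "x +\<^sub>v k \<cdot> y = 0\<^sub>v"
  then have "\<one> \<cdot> x +\<^sub>v k \<cdot> y = \<zero> \<cdot> x +\<^sub>v \<zero> \<cdot> y" using assms by simp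
  then show False using pair_coeffs(1)[OF assms(1-4), of \<one> k \<zero> \<zero>] assms(5) one_neq_zero by simp
qed

text \<open>
  The vector \<open>v\<close> can be exchanged for \<open>x\<close> unless it is a multiple of \<open>y\<close>, and in that case for \<open>y\<close>
  unless \<open>x\<close> and \<open>y\<close> are dependent. Then \<open>w\<close> is exchanged for the remaining vector.\<close>

lemma span_pair_eq:
  assumes "x \<in> carrier V" "y \<in> carrier V" "v \<in> span {x, y}" "w \<in> span {x, y}"
    "v \<noteq> 0\<^sub>v" "w \<notin> span {v}"
  shows "span {v, w} = span {x, y}"
proof
  have xy: "{x, y} \<subseteq> carrier V" using assms by simp
  have vw: "v \<in> carrier V" "w \<in> carrier V" using assms span_carrier[OF xy] by auto
  show "span {v, w} \<subseteq> span {x, y}" using assms xy by (intro span_span_least) auto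
  have swap: ?thesis if xx: "x' \<in> carrier V" "y' \<in> carrier V" "{x', y'} = {x, y}"
    "v \<notin> span {y'}" for x' y'
  proof -
    have "v \<in> span (insert x' {y'})" using xx assms by auto
    then have x': "x' \<in> span {v, y'}" using span_exchange[of "{y'}" x' v] xx assms by auto
    then have "{x', y'} \<subseteq> span {y', v}" using span_base by (auto simp: insert_commute)
    then have "span {x, y} \<subseteq> span {y', v}"
      using span_span_least[of "{x', y'}" "{y', v}"] xx vw by auto
    then have "w \<in> span (insert y' {v})" using assms by blast
    then have "y' \<in> span {w, v}" using span_exchange[of "{v}" y' w] xx assms vw by auto
    then have y': "y' \<in> span {v, w}" by (simp add: insert_commute)
    have "x' \<in> span {v, w}"
      using x' span_span_least[of "{v, y'}" "{v, w}"] y' span_base[of v "{v, w}"] vw by auto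
    then have "span {x, y} \<subseteq> span {v, w}" 
      using span_span_least[of "{x, y}" "{v, w}"] y' vw xx(3)
      by (metis empty_subsetI insert_subset)
    then show ?thesis using \<open>span {v, w} \<subseteq> span {x, y}\<close> by blast
  qed
  show "span {x, y} \<subseteq> span {v, w}"
  proof (cases "v \<in> span {y}")
    case False then show ?thesis using swap[of x y] assms by auto
  next
    case True
    have "v \<notin> span {x} \<or> span {x} = span {y}"
      using span_singleton_absorb[of v x] span_singleton_absorb[of v y] True assms by auto
    then show ?thesis
    proof
      assume "v \<notin> span {x}" then show ?thesis using swap[of y x] assms by auto
    next
      assume e: "span {x} = span {y}"
      then have "{x, y} \<subseteq> span {y}" using span_base by blast
      then have "span {x, y} \<subseteq> span {y}" using assms by (intro span_span_least) auto
      moreover have "span {v} = span {y}" using span_singleton_absorb True assms by blast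
      ultimately show ?thesis using assms by blast
    qed
  qed
qed

end

section \<open>Cones of polar spaces\<close>

text \<open>
  The vectors representing the points of an embedded polar space, together with the zero vector. Two such
  vectors are orthogonal if one is zero or the points are collinear; orthogonality is a relation on \<open>C\<close>,
  so that \<open>v \<bottom> w\<close> includes \<open>v \<in> C\<close> and \<open>w \<in> C\<close>. With zero in \<open>C\<close> the axioms become
  homogeneous. In particular the one-or-all axiom needs no distinction between a line and a single
  point: if \<open>v\<close> is a multiple of \<open>w\<close>, then the vector orthogonal to \<open>u\<close> is zero.\<close>

locale polar_cone = left_vector_space K V
  for K :: "'k ring" (structure) and V :: "('k, 'v) module" (structure) +
  fixes C :: "'v set" and perp :: "'v \<Rightarrow> 'v \<Rightarrow> bool" (infix \<open>\<bottom>\<close> 50)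
  assumes C_carrier: "C \<subseteq> carrier V"
    and zero_C: "0\<^sub>v \<in> C"
    and perp_C: "v \<bottom> w \<Longrightarrow> v \<in> C"
    and perp_refl: "v \<in> C \<Longrightarrow> v \<bottom> v"
    and perp_sym: "v \<bottom> w \<Longrightarrow> w \<bottom> v"
    and perp_smult: "u \<bottom> v \<Longrightarrow> a \<in> carrier K \<Longrightarrow> u \<bottom> a \<cdot> v"
    and perp_add: "u \<bottom> v \<Longrightarrow> u \<bottom> w \<Longrightarrow> v \<bottom> w \<Longrightarrow> u \<bottom> v +\<^sub>v w"
    and one_or_all: "u \<in> C \<Longrightarrow> v \<bottom> w \<Longrightarrow> \<not> u \<bottom> w \<Longrightarrow> \<exists>k\<in>carrier K. u \<bottom> v +\<^sub>v k \<cdot> w"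
    and C_span: "lin_span K V C = carrier V"
    and nondegenerate_C: "v \<in> C \<Longrightarrow> v \<noteq> 0\<^sub>v \<Longrightarrow> \<exists>w\<in>C. \<not> w \<bottom> v"
begin

lemma C_in [simp, intro]: "v \<in> C \<Longrightarrow> v \<in> carrier V"
  using C_carrier by blast

lemma perp_commute: "v \<bottom> w \<longleftrightarrow> w \<bottom> v"
  using perp_sym by blast

lemma perp_D: "v \<bottom> w \<Longrightarrow> v \<in> C" "v \<bottom> w \<Longrightarrow> w \<in> C"
  "v \<bottom> w \<Longrightarrow> v \<in> carrier V" "v \<bottom> w \<Longrightarrow> w \<in> carrier V"
  using perp_C perp_sym by blast+

lemma smult_C: "a \<in> carrier K \<Longrightarrow> v \<in> C \<Longrightarrow> a \<cdot> v \<in> C"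
  using perp_D(2)[OF perp_smult[OF perp_refl]] .

lemma perp_comb: "u \<bottom> v \<Longrightarrow> u \<bottom> w \<Longrightarrow> v \<bottom> w \<Longrightarrow> k \<in> carrier K \<Longrightarrow> u \<bottom> v +\<^sub>v k \<cdot> w"
  by (simp add: perp_add perp_smult)

lemma perp_comb_self: "v \<bottom> w \<Longrightarrow> k \<in> carrier K \<Longrightarrow> w \<bottom> v +\<^sub>v k \<cdot> w"
  using perp_comb[of w v w k] perp_refl perp_D perp_sym by simp

lemma comb_C: "v \<bottom> w \<Longrightarrow> k \<in> carrier K \<Longrightarrow> v +\<^sub>v k \<cdot> w \<in> C"
  using perp_D(2) perp_comb_self .

lemma add_C: "v \<bottom> w \<Longrightarrow> v +\<^sub>v w \<in> C"
  using comb_C[of v w \<one>] perp_D by simp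

lemma perp_zero [simp]: "v \<bottom> 0\<^sub>v \<longleftrightarrow> v \<in> C" "0\<^sub>v \<bottom> v \<longleftrightarrow> v \<in> C"
proof -
  show "v \<bottom> 0\<^sub>v \<longleftrightarrow> v \<in> C"
    using perp_smult[OF perp_refl, of v \<zero>] perp_D by auto
  then show "0\<^sub>v \<bottom> v \<longleftrightarrow> v \<in> C" by (simp add: perp_commute)
qed

lemma perp_smult_l: "u \<bottom> v \<Longrightarrow> a \<in> carrier K \<Longrightarrow> a \<cdot> u \<bottom> v"
  using perp_smult perp_sym by blast

lemma perp_smult_cancel:
  assumes "u \<bottom> a \<cdot> v" "a \<in> carrier K" "a \<noteq> \<zero>" "v \<in> carrier V"
  shows "u \<bottom> v"
  using perp_smult[OF assms(1), of "inv a"] assms by (simp add: smult_inv)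

lemma perp_cancel:
  assumes p: "u \<bottom> v +\<^sub>v k \<cdot> w" "u \<bottom> w" "v \<bottom> w" and k: "k \<in> carrier K"
  shows "u \<bottom> v"
proof -
  have "v +\<^sub>v k \<cdot> w \<bottom> w" using perp_comb_self[OF p(3) k] perp_sym by blast
  then have "u \<bottom> (v +\<^sub>v k \<cdot> w) +\<^sub>v (\<ominus> k) \<cdot> w"
    using perp_comb[of u "v +\<^sub>v k \<cdot> w" w "\<ominus> k"] k p by simp
  then show ?thesis using add_smult_cancel[of k v w] k perp_D[OF p(3)] by simp
qed

lemma perp_cancel2:
  assumes p: "u \<bottom> v +\<^sub>v k \<cdot> w" "u \<bottom> v" "v \<bottom> w" and k: "k \<in> carrier K" "k \<noteq> \<zero>"
  shows "u \<bottom> w"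
proof -
  have C: "v \<in> carrier V" "w \<in> carrier V" using perp_D p by blast+
  have "u \<bottom> k \<cdot> w +\<^sub>v \<one> \<cdot> v" using p C k by (simp add: V.a_comm)
  moreover have "k \<cdot> w \<bottom> v" using perp_smult_l perp_sym[OF p(3)] k by blast
  ultimately have "u \<bottom> k \<cdot> w" using perp_cancel[of u "k \<cdot> w" \<one> v] p by simp
  then show ?thesis using perp_smult_cancel C k by blast
qed

lemma C_cancel:
  assumes "x \<in> carrier V" "y \<in> C" "k \<in> carrier K" "y \<bottom> x +\<^sub>v k \<cdot> y"
  shows "x \<in> C" "x \<bottom> y"
proof -
  have p: "x +\<^sub>v k \<cdot> y \<bottom> y" using assms perp_sym by blast
  have e: "(x +\<^sub>v k \<cdot> y) +\<^sub>v (\<ominus> k) \<cdot> y = x" using add_smult_cancel assms by simp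
  show "x \<in> C" using comb_C[OF p, of "\<ominus> k"] e assms by simp
  show "x \<bottom> y" using perp_sym[OF perp_comb_self[OF p, of "\<ominus> k"]] e assms by simp
qed

text \<open>
  Suppose that everything collinear with \<open>x\<close> is collinear with \<open>y\<close>, in particular \<open>x\<close> itself. A point \<open>c\<close> not
  collinear with \<open>y\<close> is then not collinear with \<open>x\<close> either, but with another point \<open>z\<close> of the line \<open>xy\<close>. Let \<open>e\<close> be
  a point not collinear with \<open>z\<close>. Some \<open>c'\<close> on the line \<open>cz\<close> is collinear with \<open>e\<close>, and the line \<open>ec'\<close> contains a
  point \<open>v\<close> collinear with \<open>x\<close>. By assumption \<open>v\<close> is collinear with \<open>y\<close>, and so with \<open>z\<close>. As \<open>c'\<close> is also collinear
  with \<open>z\<close>, so is \<open>e\<close>, a contradiction.\<close>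

lemma separate:
  assumes x: "x \<in> C" and y: "y \<in> C" "y \<notin> span {x}"
  shows "\<exists>v\<in>C. v \<bottom> x \<and> \<not> v \<bottom> y"
proof (rule ccontr)
  assume "\<not> ?thesis"
  then have H: "\<And>v. v \<bottom> x \<Longrightarrow> v \<bottom> y" using perp_D(1) by blast
  have y0: "y \<noteq> 0\<^sub>v" using y(2) subspD(2)[OF subsp_span[of "{x}"]] x by auto
  have xy: "x \<bottom> y" using H x perp_refl by blast
  obtain c where c: "c \<in> C" "\<not> c \<bottom> y" using nondegenerate_C y y0 by meson
  then have cx: "\<not> c \<bottom> x" using H by blast
  obtain k where k: "k \<in> carrier K" "c \<bottom> x +\<^sub>v k \<cdot> y" using one_or_all[of c x y] c xy by blast
  define z where "z = x +\<^sub>v k \<cdot> y"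
  have z: "z \<in> C" "c \<bottom> z" "x \<bottom> z"
    using k xy comb_C perp_comb[OF perp_refl[OF x] xy xy] by (auto simp: z_def)
  have "z \<noteq> 0\<^sub>v"
  proof (cases "x = 0\<^sub>v")
    case True
    then show ?thesis using c(1) cx by auto
  next
    case False
    then show ?thesis unfolding z_def using comb_nonzero x y k by blast
  qed
  then obtain e where e: "e \<in> C" "\<not> e \<bottom> z" using nondegenerate_C z by meson
  obtain l where l: "l \<in> carrier K" "e \<bottom> c +\<^sub>v l \<cdot> z" using one_or_all[of e c z] e z by blast
  define c' where "c' = c +\<^sub>v l \<cdot> z"
  have c': "c' \<in> C" "e \<bottom> c'" "z \<bottom> c'"
    using l z comb_C perp_comb_self by (auto simp: c'_def)
  have "\<not> x \<bottom> c'"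
    using perp_cancel[of x c l z] z l cx perp_sym by (auto simp: c'_def)
  then obtain n where n: "n \<in> carrier K" "x \<bottom> e +\<^sub>v n \<cdot> c'"
    using one_or_all[of x e c'] x c' by blast
  let ?v = "e +\<^sub>v n \<cdot> c'"
  have v: "?v \<bottom> x" using n perp_sym by blast
  have "?v \<bottom> z" using perp_comb[OF v H[OF v] xy k(1)] by (simp add: z_def)
  then have "z \<bottom> e" using perp_cancel[of z e n c'] c' n perp_sym by blast
  then show False using e perp_sym by blast
qed

section \<open>Quadrangles\<close>

text \<open>The set of vectors representing the points of a subspace of the polar space, with zero.\<close>

definition csub :: "'v set \<Rightarrow> bool" where
  "csub S \<longleftrightarrow> S \<subseteq> C \<and> 0\<^sub>v \<in> S \<and> (\<forall>a\<in>carrier K. \<forall>v\<in>S. a \<cdot> v \<in> S) \<and>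
    (\<forall>v\<in>S. \<forall>w\<in>S. v \<bottom> w \<longrightarrow> v +\<^sub>v w \<in> S)"

definition quad :: "'v \<Rightarrow> 'v \<Rightarrow> 'v \<Rightarrow> 'v \<Rightarrow> bool" where
  "quad a b c d \<longleftrightarrow> {a, b, c, d} \<subseteq> C \<and> a \<bottom> b \<and> b \<bottom> c \<and> c \<bottom> d \<and> d \<bottom> a \<and> \<not> a \<bottom> c \<and> \<not> b \<bottom> d"

lemma csubD:
  assumes "csub S"
  shows "S \<subseteq> C" "0\<^sub>v \<in> S" "\<And>a v. a \<in> carrier K \<Longrightarrow> v \<in> S \<Longrightarrow> a \<cdot> v \<in> S"
    "\<And>v w. v \<in> S \<Longrightarrow> w \<in> S \<Longrightarrow> v \<bottom> w \<Longrightarrow> v +\<^sub>v w \<in> S"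
  using assms by (auto simp: csub_def)

lemma csub_comb:
  "csub S \<Longrightarrow> v \<in> S \<Longrightarrow> w \<in> S \<Longrightarrow> v \<bottom> w \<Longrightarrow> k \<in> carrier K \<Longrightarrow> v +\<^sub>v k \<cdot> w \<in> S"
  by (simp add: csubD perp_smult)

lemma csub_cancel:
  assumes S: "csub S" and "x +\<^sub>v k \<cdot> y \<in> S" "y \<in> S" "x \<bottom> y" "k \<in> carrier K"
  shows "x \<in> S"
proof -
  have "x +\<^sub>v k \<cdot> y \<bottom> y" using perp_comb_self[of x y k] assms perp_sym by blast
  then have "(x +\<^sub>v k \<cdot> y) +\<^sub>v (\<ominus> k) \<cdot> y \<in> S" using csub_comb[OF S, of "x +\<^sub>v k \<cdot> y" y "\<ominus> k"] assms by simp
  then show ?thesis using add_smult_cancel[of k x y] assms perp_D by simp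
qed

lemma csub_smult_cancel:
  "csub S \<Longrightarrow> k \<cdot> v \<in> S \<Longrightarrow> k \<in> carrier K \<Longrightarrow> k \<noteq> \<zero> \<Longrightarrow> v \<in> carrier V \<Longrightarrow> v \<in> S"
  using csubD(3)[of S "inv k" "k \<cdot> v"] smult_inv[of k v] by simp

lemma csub_C: "csub C"
  by (simp add: csub_def zero_C smult_C add_C)

lemma csub_subsp: "subsp U \<Longrightarrow> csub (C \<inter> U)"
  by (auto simp: csub_def zero_C smult_C add_C subspD)

lemma quad_rotate: "quad a b c d \<Longrightarrow> quad b c d a"
  unfolding quad_def by (auto simp: perp_commute)

lemma quad_reflect: "quad a b c d \<Longrightarrow> quad b a d c"
  unfolding quad_def by (auto simp: perp_commute)

text \<open>
  If \<open>s\<close> is not collinear with the vertex \<open>a\<close>, it is collinear with a point different from \<open>a\<close> on each of the two sides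
  through \<open>a\<close>. Were these two points collinear, the neighbours \<open>b\<close> and \<open>d\<close> of \<open>a\<close> would be collinear, too. The
  same argument applies to \<open>c\<close>; and if \<open>s\<close> is collinear with \<open>a\<close> and \<open>c\<close>, these serve.\<close>

lemma quad_noncollinear_perp_pair:
  assumes T: "csub T" and q: "quad a b c d" "{a, b, c, d} \<subseteq> T" and s: "s \<in> C"
  shows "\<exists>t\<in>T. \<exists>t'\<in>T. t \<bottom> s \<and> t' \<bottom> s \<and> \<not> t \<bottom> t'"
proof -
  have adjacent: "\<exists>t\<in>T. \<exists>t'\<in>T. t \<bottom> s \<and> t' \<bottom> s \<and> \<not> t \<bottom> t'"
    if q: "quad a b c d" "{a, b, c, d} \<subseteq> T" and sa: "\<not> s \<bottom> a" for a b c d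
  proof -
    have p: "d \<bottom> a" "\<not> b \<bottom> d" "b \<bottom> a"
      using q perp_sym by (auto simp: quad_def)
    obtain k where k: "k \<in> carrier K" "s \<bottom> d +\<^sub>v k \<cdot> a" using one_or_all[of s d a] p s sa by blast
    obtain n where n: "n \<in> carrier K" "s \<bottom> b +\<^sub>v n \<cdot> a" using one_or_all[of s b a] p s sa by blast
    have "\<not> b +\<^sub>v n \<cdot> a \<bottom> d +\<^sub>v k \<cdot> a"
    proof
      assume "b +\<^sub>v n \<cdot> a \<bottom> d +\<^sub>v k \<cdot> a"
      moreover have "b +\<^sub>v n \<cdot> a \<bottom> a" using perp_sym[OF perp_comb_self] p n by blast
      ultimately have "b +\<^sub>v n \<cdot> a \<bottom> d" using perp_cancel p k by blast
      then have "d \<bottom> b" using perp_cancel[of d b n a] p n perp_sym by blast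
      then show False using p perp_sym by blast
    qed
    moreover have "d +\<^sub>v k \<cdot> a \<in> T" "b +\<^sub>v n \<cdot> a \<in> T" using csub_comb[OF T] q p k n by auto
    ultimately show ?thesis using k n perp_sym by blast
  qed
  show ?thesis
  proof (cases "s \<bottom> a \<and> s \<bottom> c")
    case True
    then have "a \<bottom> s" "c \<bottom> s" using perp_sym by auto
    then show ?thesis using q unfolding quad_def by auto
  next
    case False
    then show ?thesis
      using adjacent[OF q] adjacent[of c d a b] quad_rotate[OF quad_rotate[OF q(1)]] q(2) by auto
  qed
qed

section \<open>Tangent hyperplanes\<close>

definition tangent_space :: "'v \<Rightarrow> 'v set" where
  "tangent_space a = span {v \<in> C. v \<bottom> a}"

lemma perp_set_carrier: "{v \<in> C. v \<bottom> a} \<subseteq> carrier V"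
  by auto

lemma subsp_tangent_space: "subsp (tangent_space a)"
  unfolding tangent_space_def by (rule subsp_span[OF perp_set_carrier])

lemma tangent_space_base: "v \<bottom> a \<Longrightarrow> v \<in> tangent_space a"
  unfolding tangent_space_def using perp_D(1) by (simp add: span_base)

text \<open>
  The generators of the span are added one at a time, starting with \<open>a\<close>. Suppose that a point \<open>c\<close> not collinear
  with \<open>a\<close> appears when \<open>m\<close> is added. As \<open>a\<close> is among the generators, \<open>m\<close> may be changed by a multiple of \<open>a\<close> so as
  to be orthogonal to \<open>c\<close>. Subtracting the right multiple of \<open>m\<close> from \<open>c\<close> then yields a vector of \<open>C\<close> that was present
  before, so it is orthogonal to \<open>a\<close>; and hence \<open>c\<close> is.\<close>

lemma tangent_space_perp:
  assumes a: "a \<in> C" and v: "v \<in> C" "v \<in> tangent_space a"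
  shows "v \<bottom> a"
proof -
  have "span (insert a F) \<inter> C \<subseteq> {v. v \<bottom> a}" if "finite F" "F \<subseteq> {v \<in> C. v \<bottom> a}" for F
    using that
  proof (induction F)
    case empty
    then show ?case using a perp_refl perp_smult_l by (auto simp: span_singleton)
  next
    case (insert m F)
    let ?U = "span (insert a F)"
    have m: "m \<in> C" "m \<bottom> a" and F: "F \<subseteq> {v \<in> C. v \<bottom> a}" using insert by auto
    have aF: "insert a F \<subseteq> carrier V" using a F by auto
    have U: "subsp ?U" using subsp_span aF by blast
    have IH: "\<And>u. u \<in> ?U \<Longrightarrow> u \<in> C \<Longrightarrow> u \<bottom> a" using insert.IH F by blast
    show ?case
    proof safe
      fix c assume c: "c \<in> span (insert a (insert m F))" "c \<in> C"
      show "c \<bottom> a"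
      proof (rule ccontr)
        assume nc: "\<not> c \<bottom> a"
        obtain l where l: "l \<in> carrier K" "c \<bottom> m +\<^sub>v l \<cdot> a" using one_or_all[of c m a] c m nc by blast
        let ?m = "m +\<^sub>v l \<cdot> a"
        have m': "?m \<bottom> a" using perp_sym[OF perp_comb_self] m l by blast
        have "c \<in> span (insert m (insert a F))" using c by (simp add: insert_commute)
        then obtain k u where ku: "k \<in> carrier K" "u \<in> ?U" "c = k \<cdot> m +\<^sub>v u"
          by (rule span_insertE) (use m aF in auto)
        have uV: "u \<in> carrier V" using ku U subspD(1) by blast
        have cp: "c +\<^sub>v (\<ominus> k) \<cdot> ?m \<in> C" using comb_C[of c ?m "\<ominus> k"] l ku by blast
        let ?w = "((\<ominus> k) \<otimes> l) \<cdot> a"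
        have V: "m \<in> carrier V" "u \<in> carrier V" "?w \<in> carrier V" using m a uV ku l by auto
        have "c +\<^sub>v (\<ominus> k) \<cdot> ?m = (k \<cdot> m +\<^sub>v u) +\<^sub>v ((\<ominus> k) \<cdot> m +\<^sub>v ?w)"
          using ku m a l by (simp add: smult_r_distr smult_assoc)
        also have "\<dots> = (k \<cdot> m +\<^sub>v (\<ominus> k) \<cdot> m) +\<^sub>v (u +\<^sub>v ?w)" using V ku(1) by (simp add: V.a_ac)
        also have "\<dots> = u +\<^sub>v ?w" using V ku(1) by (simp add: smult_l_distr[symmetric] K.r_neg)
        finally have "c +\<^sub>v (\<ominus> k) \<cdot> ?m = u +\<^sub>v ?w" .
        moreover have "u +\<^sub>v ((\<ominus> k) \<otimes> l) \<cdot> a \<in> ?U"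
          using ku l subspD(3,4)[OF U] span_base[of a "insert a F"] by auto
        ultimately have "c +\<^sub>v (\<ominus> k) \<cdot> ?m \<bottom> a" using IH cp by simp
        then have "a \<bottom> c"
          using perp_cancel[of a c "\<ominus> k" ?m] m' l ku perp_sym by blast
        then show False using nc perp_sym by blast
      qed
    qed
  qed
  moreover obtain F where "F \<subseteq> {v \<in> C. v \<bottom> a}" "finite F" "v \<in> span F"
    using span_finitary[OF _ perp_set_carrier] v(2) unfolding tangent_space_def by meson
  ultimately show ?thesis using v(1) span_mono[of F "insert a F"] by blast
qed

end

locale polar_cone_with_quadrangle = polar_cone +
  assumes quad_exists: "\<exists>a b c d. quad a b c d"
begin

lemma hyperbolic_perp_pair:
  assumes a: "a \<in> C" and c: "c \<in> C" and ac: "\<not> c \<bottom> a"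
  obtains m n where "m \<bottom> a" "m \<bottom> c" "n \<bottom> a" "n \<bottom> c" "\<not> m \<bottom> n"
proof -
  obtain t t' where t: "t \<bottom> a" "t' \<bottom> a" "\<not> t \<bottom> t'"
    using quad_exists quad_noncollinear_perp_pair[OF csub_C _ _ a] unfolding quad_def by meson
  obtain k where k: "k \<in> carrier K" "c \<bottom> t +\<^sub>v k \<cdot> a" using one_or_all[of c t a] t c ac by blast
  obtain l where l: "l \<in> carrier K" "c \<bottom> t' +\<^sub>v l \<cdot> a" using one_or_all[of c t' a] t c ac by blast
  let ?m = "t +\<^sub>v k \<cdot> a" and ?n = "t' +\<^sub>v l \<cdot> a"
  have pa: "?m \<bottom> a" "?n \<bottom> a" using perp_sym[OF perp_comb_self] t k l by auto
  have "\<not> ?m \<bottom> ?n"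
  proof
    assume "?m \<bottom> ?n"
    then have "?n \<bottom> t" using perp_cancel[of ?n t k a] t k pa perp_sym by blast
    then have "t \<bottom> t'" using perp_cancel[of t t' l a] t l perp_sym by blast
    then show False using t by blast
  qed
  then show ?thesis using that pa perp_sym[OF k(2)] perp_sym[OF l(2)] by blast
qed

text \<open>
  Let \<open>D\<close> be spanned by \<open>c\<close> and the vectors orthogonal to \<open>a\<close>. If \<open>y \<in> D\<close> is not orthogonal to \<open>a\<close>, then all
  \<open>x \<in> C\<close> orthogonal to \<open>y\<close> lie in \<open>D\<close>. So it suffices to connect \<open>x\<close> to \<open>c\<close> by a chain of collinear points none of
  which is collinear with \<open>a\<close>. A point \<open>m\<close> collinear with \<open>a\<close> and \<open>c\<close> but not with \<open>x\<close> provides such a chain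
  along the line \<open>cm\<close>. There are non-collinear candidates \<open>m\<close> and \<open>n\<close>; if both are collinear with \<open>x\<close>, then \<open>c\<close> is first
  replaced by \<open>c + m\<close> and \<open>n\<close> is changed by a multiple of \<open>a\<close> accordingly.\<close>

lemma tangent_space_hyperplane:
  assumes a: "a \<in> C" and c: "c \<in> C" and ac: "\<not> c \<bottom> a" and v: "v \<in> carrier V"
  shows "\<exists>k\<in>carrier K. \<exists>u\<in>tangent_space a. v = k \<cdot> c +\<^sub>v u"
proof -
  define D where "D = span (insert c {v \<in> C. v \<bottom> a})"
  have D: "subsp D" unfolding D_def by (rule subsp_span) (use c in auto)
  have base: "c \<in> D" "\<And>v. v \<bottom> a \<Longrightarrow> v \<in> D" unfolding D_def using perp_D(1) by (auto intro: span_base)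
  have comb: "\<And>x y k. x \<in> D \<Longrightarrow> y \<in> D \<Longrightarrow> k \<in> carrier K \<Longrightarrow> x +\<^sub>v k \<cdot> y \<in> D"
    using subspD(3,4)[OF D] by blast
  have step: "x \<in> D" if y: "y \<in> D" "\<not> y \<bottom> a" and x: "x \<bottom> y" for x y
  proof -
    obtain l where l: "l \<in> carrier K" "a \<bottom> x +\<^sub>v l \<cdot> y"
      using one_or_all[of a x y] a x y perp_sym by blast
    then have "x +\<^sub>v l \<cdot> y \<in> D" using base perp_sym by blast
    then show ?thesis using subsp_add_cancel[OF D, of x "l \<cdot> y"] subspD(4)[OF D] l perp_D[OF x] y by auto
  qed
  have step2: "x \<in> D" if y: "y \<in> D" "\<not> y \<bottom> a" and m: "m \<bottom> a" "m \<bottom> y"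
    and x: "x \<in> C" "\<not> x \<bottom> m" for x y m
  proof -
    have ym: "y \<bottom> m" using m perp_sym by blast
    obtain l where l: "l \<in> carrier K" "x \<bottom> y +\<^sub>v l \<cdot> m" using one_or_all[of x y m] x ym by blast
    have "\<not> y +\<^sub>v l \<cdot> m \<bottom> a"
      using perp_cancel[of a y l m] y m l ym perp_sym by blast
    then show ?thesis using step[of "y +\<^sub>v l \<cdot> m" x] l comb base y m by blast
  qed
  obtain m n where mn: "m \<bottom> a" "m \<bottom> c" "n \<bottom> a" "n \<bottom> c" "\<not> m \<bottom> n"
    using hyperbolic_perp_pair[OF a c ac] .
  have "x \<in> D" if x: "x \<in> C" for x
  proof (cases "x \<bottom> a \<or> x \<bottom> c \<or> \<not> x \<bottom> m \<or> \<not> x \<bottom> n")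
    case True
    then show ?thesis
      using base x step[of c x] step2[of c m x] step2[of c n x] ac mn by blast
  next
    case False
    then have xs: "\<not> x \<bottom> a" "x \<bottom> m" "x \<bottom> n" by auto
    let ?y = "c +\<^sub>v \<one> \<cdot> m"
    have cm: "c \<bottom> m" using mn perp_sym by blast
    have y: "?y \<in> D" using comb base mn by auto
    have ya: "\<not> ?y \<bottom> a" using perp_cancel[of a c \<one> m] mn cm ac perp_sym by blast
    have ny: "\<not> ?y \<bottom> n"
      using perp_cancel2[of n c \<one> m] mn cm one_neq_zero perp_sym by blast
    obtain l where l: "l \<in> carrier K" "?y \<bottom> n +\<^sub>v l \<cdot> a"
      using one_or_all[of ?y n a] comb_C[OF cm] ya mn by blast
    have l0: "l \<noteq> \<zero>" using l ny perp_D[OF mn(3)] by auto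
    let ?m = "n +\<^sub>v l \<cdot> a"
    have m': "?m \<bottom> a" "?m \<bottom> ?y" using perp_sym[OF perp_comb_self] mn l perp_sym by blast+
    have "\<not> x \<bottom> ?m" using perp_cancel2[of x n l a] mn l l0 xs by blast
    then show ?thesis using step2[of ?y ?m x] y ya m' x by blast
  qed
  then have "carrier V \<subseteq> D" using span_least[of C D] D C_span by blast
  then have "v \<in> span (insert c {v \<in> C. v \<bottom> a})" using v unfolding D_def by blast
  then show ?thesis
    using span_insert[of c "{v \<in> C. v \<bottom> a}"] c unfolding tangent_space_def by auto
qed

end

section \<open>Linear functionals\<close>

context left_vector_space
begin

text \<open>
  Functionals are extensional, so that they are determined by their values on \<open>V\<close> and can be the elements of
  a module.\<close>

definition functional :: "('v \<Rightarrow> 'k) \<Rightarrow> bool" where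
  "functional \<psi> \<longleftrightarrow> \<psi> \<in> carrier V \<rightarrow>\<^sub>E carrier K \<and>
    (\<forall>x\<in>carrier V. \<forall>y\<in>carrier V. \<psi> (x +\<^sub>v y) = \<psi> x \<oplus> \<psi> y) \<and>
    (\<forall>a\<in>carrier K. \<forall>x\<in>carrier V. \<psi> (a \<cdot> x) = a \<otimes> \<psi> x)"

lemma functionalD:
  assumes "functional \<psi>"
  shows "x \<in> carrier V \<Longrightarrow> \<psi> x \<in> carrier K"
    "x \<in> carrier V \<Longrightarrow> y \<in> carrier V \<Longrightarrow> \<psi> (x +\<^sub>v y) = \<psi> x \<oplus> \<psi> y"
    "a \<in> carrier K \<Longrightarrow> x \<in> carrier V \<Longrightarrow> \<psi> (a \<cdot> x) = a \<otimes> \<psi> x"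
    "\<psi> \<in> extensional (carrier V)"
  using assms by (auto simp: functional_def PiE_def)

lemma functional_zero: "functional \<psi> \<Longrightarrow> \<psi> 0\<^sub>v = \<zero>"
  using functionalD(3)[of \<psi> \<zero> "0\<^sub>v"] functionalD(1)[of \<psi> "0\<^sub>v"] by simp

lemma functional_comb:
  assumes "functional \<phi>" "functional \<chi>" "m \<in> carrier K" "n \<in> carrier K"
  shows "functional (\<lambda>v\<in>carrier V. \<phi> v \<otimes> m \<oplus> \<chi> v \<otimes> n)"
  unfolding functional_def
  using assms functionalD[OF assms(1)] functionalD[OF assms(2)]
  by (auto simp: K.l_distr K.r_distr K.m_assoc K.a_ac)

lemma subsp_kernel:
  assumes "functional \<psi>"
  shows "subsp {v \<in> carrier V. \<psi> v = \<zero>}"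
  using functionalD[OF assms] functional_zero[OF assms] by (intro subspI) auto

end

context polar_cone_with_quadrangle
begin

lemma tangent_functional_exists:
  assumes a: "a \<in> C" "a \<noteq> 0\<^sub>v"
  shows "\<exists>\<phi>. functional \<phi> \<and> (\<forall>v\<in>carrier V. \<phi> v = \<zero> \<longleftrightarrow> v \<in> tangent_space a)"
proof -
  obtain c where c: "c \<in> C" "\<not> c \<bottom> a" using nondegenerate_C a by meson
  let ?H = "tangent_space a"
  have H: "subsp ?H" by (rule subsp_tangent_space)
  have HV: "u \<in> ?H \<Longrightarrow> u \<in> carrier V" for u using subspD(1)[OF H] by blast
  have cH: "c \<notin> ?H" using tangent_space_perp a c by blast
  define f where "f v = (THE k. k \<in> carrier K \<and> (\<exists>u\<in>?H. v = k \<cdot> c +\<^sub>v u))" for v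
  have uniq: "k = l"
    if "k \<in> carrier K" "l \<in> carrier K" "u \<in> ?H" "w \<in> ?H" "k \<cdot> c +\<^sub>v u = l \<cdot> c +\<^sub>v w" for k l u w
  proof -
    have "(k \<ominus> l) \<cdot> c +\<^sub>v u = (\<ominus> l) \<cdot> c +\<^sub>v (k \<cdot> c +\<^sub>v u)"
      using that(1-4) c HV by (simp add: K.minus_eq smult_l_distr V.a_ac)
    also have "\<dots> = (\<ominus> l) \<cdot> c +\<^sub>v (l \<cdot> c +\<^sub>v w)" using that by simp
    also have "\<dots> = ((\<ominus> l) \<cdot> c +\<^sub>v l \<cdot> c) +\<^sub>v w" using that c HV by (simp add: V.a_assoc)
    also have "\<dots> = w" using that c HV by (simp add: smult_l_distr[symmetric] K.l_neg)
    finally have "(k \<ominus> l) \<cdot> c \<in> ?H"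
      using subsp_add_cancel[OF H, of "(k \<ominus> l) \<cdot> c" u] that c by simp
    then have "k \<ominus> l = \<zero>" using subsp_smult_cancel[OF H, of "k \<ominus> l" c] cH that c by auto
    then show ?thesis using K.minus_equality[of k "\<ominus> l"] that(1,2) by (simp add: K.minus_eq)
  qed
  have f_eq: "f (k \<cdot> c +\<^sub>v u) = k" if "k \<in> carrier K" "u \<in> ?H" for k u
    unfolding f_def by (rule the_equality) (use that uniq in blast)+
  have dec: "\<exists>k\<in>carrier K. \<exists>u\<in>?H. v = k \<cdot> c +\<^sub>v u" if "v \<in> carrier V" for v
    using tangent_space_hyperplane[OF a(1) c that] .
  let ?f = "restrict f (carrier V)"
  have "functional ?f"
    unfolding functional_def
  proof (intro conjI ballI)
    show "?f \<in> carrier V \<rightarrow>\<^sub>E carrier K" using dec f_eq by fastforce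
  next
    fix x y assume xy: "x \<in> carrier V" "y \<in> carrier V"
    obtain k u where x: "k \<in> carrier K" "u \<in> ?H" "x = k \<cdot> c +\<^sub>v u" using dec xy by blast
    obtain l w where y: "l \<in> carrier K" "w \<in> ?H" "y = l \<cdot> c +\<^sub>v w" using dec xy by blast
    have "x +\<^sub>v y = (k \<oplus> l) \<cdot> c +\<^sub>v (u +\<^sub>v w)" using x y c HV by (simp add: smult_l_distr V.a_ac)
    then have "f (x +\<^sub>v y) = k \<oplus> l" using f_eq x y subspD(3)[OF H] by simp
    then show "?f (x +\<^sub>v y) = ?f x \<oplus> ?f y" using xy f_eq[OF x(1,2)] f_eq[OF y(1,2)] x(3) y(3) by simp
  next
    fix b x assume bx: "b \<in> carrier K" "x \<in> carrier V"
    obtain k u where x: "k \<in> carrier K" "u \<in> ?H" "x = k \<cdot> c +\<^sub>v u" using dec bx by blast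
    have "b \<cdot> x = (b \<otimes> k) \<cdot> c +\<^sub>v b \<cdot> u" using x bx c HV by (simp add: smult_r_distr smult_assoc)
    then have "f (b \<cdot> x) = b \<otimes> k" using f_eq x bx subspD(4)[OF H] by simp
    then show "?f (b \<cdot> x) = b \<otimes> ?f x" using bx f_eq[OF x(1,2)] x(3) by simp
  qed
  moreover have "?f v = \<zero> \<longleftrightarrow> v \<in> ?H" if v: "v \<in> carrier V" for v
  proof
    obtain k u where x: "k \<in> carrier K" "u \<in> ?H" "v = k \<cdot> c +\<^sub>v u" using dec v by blast
    assume "?f v = \<zero>"
    then have "k = \<zero>" using f_eq[OF x(1,2)] x(3) v by simp
    then show "v \<in> ?H" using x c HV by simp
  next
    assume vH: "v \<in> ?H"
    then have "v = \<zero> \<cdot> c +\<^sub>v v" using c v by simp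
    then show "?f v = \<zero>" using f_eq[of \<zero> v] vH v by simp
  qed
  ultimately show ?thesis by blast
qed

definition tangent where
  "tangent a = (SOME \<phi>. functional \<phi> \<and> (\<forall>v\<in>carrier V. \<phi> v = \<zero> \<longleftrightarrow> v \<in> tangent_space a))"

lemma tangent:
  assumes "a \<in> C" "a \<noteq> 0\<^sub>v"
  shows functional_tangent: "functional (tangent a)"
    and tangent_eq_zero: "v \<in> carrier V \<Longrightarrow> tangent a v = \<zero> \<longleftrightarrow> v \<in> tangent_space a"
  using someI_ex[OF tangent_functional_exists[OF assms]] unfolding tangent_def by auto

lemma tangent_eq_zero_iff_perp:
  assumes "a \<in> C" "a \<noteq> 0\<^sub>v" "v \<in> C"
  shows "tangent a v = \<zero> \<longleftrightarrow> v \<bottom> a"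
  using tangent_eq_zero[OF assms(1,2)] assms tangent_space_perp tangent_space_base by blast

lemma functional_multiple:
  assumes a: "a \<in> C" "a \<noteq> 0\<^sub>v" and psi: "functional \<psi>" and van: "\<And>v. v \<bottom> a \<Longrightarrow> \<psi> v = \<zero>"
  shows "\<exists>k\<in>carrier K. \<forall>v\<in>carrier V. \<psi> v = tangent a v \<otimes> k"
proof -
  obtain c where c: "c \<in> C" "\<not> c \<bottom> a" using nondegenerate_C a by meson
  note t = functionalD[OF functional_tangent[OF a]] and p = functionalD[OF psi]
  let ?t = "tangent a c"
  have t0: "?t \<noteq> \<zero>" "?t \<in> carrier K" using tangent_eq_zero_iff_perp a c t(1) by auto
  have "\<psi> v = tangent a v \<otimes> (inv ?t \<otimes> \<psi> c)" if v: "v \<in> carrier V" for v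
  proof -
    obtain k u where ku: "k \<in> carrier K" "u \<in> tangent_space a" "v = k \<cdot> c +\<^sub>v u"
      using tangent_space_hyperplane[OF a(1) c v] by blast
    have u: "u \<in> carrier V" using ku subspD(1)[OF subsp_tangent_space] by blast
    have "tangent_space a \<subseteq> {v \<in> carrier V. \<psi> v = \<zero>}"
      unfolding tangent_space_def using van by (intro span_least subsp_kernel psi) auto
    then have "\<psi> u = \<zero>" using ku by blast
    moreover have "tangent a u = \<zero>" using tangent_eq_zero a u ku by blast
    ultimately have "\<psi> v = k \<otimes> \<psi> c" "tangent a v = k \<otimes> ?t" using ku c u t p by simp_all
    then show ?thesis using ku t0 p(1)[of c] c
      by (simp add: K.m_assoc K_cancel_l')
  qed
  moreover have "inv ?t \<otimes> \<psi> c \<in> carrier K" using t0 p(1)[of c] c by simp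
  ultimately show ?thesis by blast
qed

section \<open>Pencils of tangent functionals\<close>

text \<open>
  A point in the kernel of \<open>\<psi>\<close> that is collinear with \<open>x\<close> is collinear with \<open>y\<close> as well, and so with \<open>z\<close>. If a point
  \<open>v\<close> of the kernel were not collinear with \<open>z\<close>, it would be collinear with a point \<open>c'\<close> on the line \<open>cz\<close>, and the line
  \<open>vc'\<close> would contain a point \<open>w\<close> collinear with \<open>x\<close>. But \<open>w\<close> lies in the kernel, so \<open>w\<close> would be collinear with \<open>z\<close>,
  as is \<open>c'\<close>, and hence \<open>v\<close>. Thus all points of the kernel are collinear with \<open>z\<close>. Conversely, if \<open>v\<close> is collinear with
  \<open>z\<close> but not in the kernel, then \<open>v\<close> differs from \<open>z\<close>, and every line through \<open>v\<close> meets the kernel. So everything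
  collinear with \<open>v\<close> is collinear with \<open>z\<close>, contrary to \<open>separate\<close>. As \<open>\<psi>\<close> vanishes on the points collinear
  with \<open>z\<close>, it is proportional to the tangent functional at \<open>z\<close>.\<close>

lemma pencil:
  assumes x: "x \<in> C" "x \<noteq> 0\<^sub>v" and y: "y \<in> C" "y \<notin> span {x}" and xy: "x \<bottom> y"
    and mn: "m \<in> carrier K" "n \<in> carrier K" "n \<noteq> \<zero>"
    and psi: "functional \<psi>" "\<And>v. v \<in> carrier V \<Longrightarrow> \<psi> v = tangent x v \<otimes> m \<oplus> tangent y v \<otimes> n"
    and c: "c \<in> C" "\<psi> c = \<zero>" "\<not> c \<bottom> x"
    and ab: "a \<in> carrier K" "b \<in> carrier K" and z: "z = a \<cdot> x +\<^sub>v b \<cdot> y" "z \<noteq> 0\<^sub>v" "c \<bottom> z"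
  shows "\<exists>k\<in>carrier K. k \<noteq> \<zero> \<and> (\<forall>v\<in>carrier V. \<psi> v = tangent z v \<otimes> k)"
proof -
  have y0: "y \<noteq> 0\<^sub>v" using y(2) subspD(2)[OF subsp_span[of "{x}"]] x by auto
  note tx = functionalD[OF functional_tangent[OF x]] and ty = functionalD[OF functional_tangent[OF y(1) y0]]
    and p = functionalD[OF psi(1)]
  have zC: "z \<in> C" using z perp_D by blast
  have perp_z: "v \<bottom> z" if "v \<bottom> x" "v \<bottom> y" for v
    unfolding z using that ab xy perp_smult_l perp_comb perp_smult by simp
  have xz: "x \<bottom> z" and yz: "y \<bottom> z" using perp_z perp_refl x y xy perp_sym by auto
  have psi_x: "v \<bottom> y" if "v \<bottom> x" "\<psi> v = \<zero>" for v
  proof -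
    have v: "v \<in> C" using that perp_D by blast
    then have "tangent x v = \<zero>" using tangent_eq_zero_iff_perp[OF x] that by blast
    then have "tangent y v \<otimes> n = \<zero>" using psi(2)[of v] that v mn ty(1)[of v] by simp
    then have "tangent y v = \<zero>" using K_integral mn ty(1)[of v] v by auto
    then show ?thesis using tangent_eq_zero_iff_perp[OF y(1) y0 v] by blast
  qed
  have pz: "\<psi> z = \<zero>"
  proof -
    have "tangent x z = \<zero>" "tangent y z = \<zero>"
      using tangent_eq_zero_iff_perp[OF x zC] tangent_eq_zero_iff_perp[OF y(1) y0 zC] xz yz perp_sym by auto
    then show ?thesis using psi(2)[of z] zC mn by simp
  qed
  have ker: "v \<bottom> z" if v: "v \<in> C" "\<psi> v = \<zero>" for v
  proof (rule ccontr)
    assume nz: "\<not> v \<bottom> z"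
    obtain l where l: "l \<in> carrier K" "v \<bottom> c +\<^sub>v l \<cdot> z" using one_or_all[of v c z] v z nz by blast
    let ?c = "c +\<^sub>v l \<cdot> z"
    have cz: "?c \<bottom> z" using perp_sym[OF perp_comb_self] z l by blast
    have pc: "\<psi> ?c = \<zero>" using p c l pz zC by simp
    have cx: "\<not> x \<bottom> ?c" using perp_cancel[of x c l z] z xz l c perp_sym by blast
    then obtain k where k: "k \<in> carrier K" "x \<bottom> v +\<^sub>v k \<cdot> ?c" using one_or_all[of x v ?c] x l by blast
    let ?w = "v +\<^sub>v k \<cdot> ?c"
    have "\<psi> ?w = \<zero>" using p v k pc perp_D[OF cz] by simp
    then have "?w \<bottom> z" using perp_z psi_x k perp_sym by blast
    then have "z \<bottom> v" using perp_cancel[of z v k ?c] cz l k perp_sym by blast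
    then show False using nz perp_sym by blast
  qed
  have "\<psi> v = \<zero>" if v: "v \<bottom> z" for v
  proof (rule ccontr)
    assume nv: "\<psi> v \<noteq> \<zero>"
    have vC: "v \<in> C" using v perp_D by blast
    have "z \<notin> span {v}"
    proof
      assume "z \<in> span {v}"
      then obtain k where k: "k \<in> carrier K" "z = k \<cdot> v" using vC by (auto simp: span_singleton)
      then have "k = \<zero>" using pz p vC nv K_integral by auto
      then show False using k z vC by simp
    qed
    then obtain w where w: "w \<bottom> v" "\<not> w \<bottom> z" using separate[OF vC zC] by blast
    have wC: "w \<in> C" using w perp_D by blast
    let ?l = "\<ominus> (\<psi> w \<otimes> inv (\<psi> v))"
    have pK: "\<psi> w \<in> carrier K" "\<psi> v \<in> carrier K" using p vC wC by auto
    have l: "?l \<in> carrier K" using pK nv by simp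
    have "\<psi> (w +\<^sub>v ?l \<cdot> v) = \<psi> w \<oplus> ?l \<otimes> \<psi> v" using p wC vC l by simp
    also have "\<dots> = \<zero>" using pK nv by (simp add: K.l_minus K.m_assoc K.r_neg)
    finally have "w +\<^sub>v ?l \<cdot> v \<bottom> z" using ker comb_C w l by blast
    then have "z \<bottom> w" using perp_cancel[of z w ?l v] v w l perp_sym by blast
    then show False using w perp_sym by blast
  qed
  then obtain k where k: "k \<in> carrier K" "\<forall>v\<in>carrier V. \<psi> v = tangent z v \<otimes> k"
    using functional_multiple[OF zC z(2) psi(1)] by blast
  have "k \<noteq> \<zero>"
  proof
    assume k0: "k = \<zero>"
    obtain v where v: "v \<bottom> x" "\<not> v \<bottom> y" using separate[OF x(1) y] by blast
    have "v \<in> carrier V" using v perp_D by blast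
    then have "\<psi> v = \<zero>"
      using k k0 functionalD(1)[OF functional_tangent[OF zC z(2)]] by simp
    then show False using psi_x v by blast
  qed
  then show ?thesis using k by blast
qed

lemma pencil_multiple:
  assumes x: "x \<in> C" "x \<noteq> 0\<^sub>v" and k: "k \<in> carrier K" "k \<noteq> \<zero>"
  shows "\<exists>l\<in>carrier K. \<forall>v\<in>carrier V. tangent (k \<cdot> x) v = tangent x v \<otimes> l"
proof -
  have kx: "k \<cdot> x \<in> C" "k \<cdot> x \<noteq> 0\<^sub>v" using x k by (auto simp: smult_C smult_eq_zero)
  have "tangent (k \<cdot> x) v = \<zero>" if "v \<bottom> x" for v
    using tangent_eq_zero_iff_perp[OF kx] that perp_smult k perp_D by blast
  then show ?thesis using functional_multiple[OF x functional_tangent[OF kx]] by blast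
qed

text \<open>
  Applied to the combination that vanishes at some point \<open>c\<close> collinear with \<open>z\<close> but not with \<open>x\<close>, the previous
  lemma shows that the tangent functionals along a line lie on a line of the dual space. The next
  lemma shows that they fill it.\<close>

lemma tangent_in_pencil:
  assumes x: "x \<in> C" "x \<noteq> 0\<^sub>v" and y: "y \<in> C" "y \<notin> span {x}" and xy: "x \<bottom> y"
    and ab: "a \<in> carrier K" "b \<in> carrier K" and z: "z = a \<cdot> x +\<^sub>v b \<cdot> y" "z \<noteq> 0\<^sub>v"
  shows "\<exists>m\<in>carrier K. \<exists>n\<in>carrier K. \<forall>v\<in>carrier V. tangent z v = tangent x v \<otimes> m \<oplus> tangent y v \<otimes> n"
proof -
  have y0: "y \<noteq> 0\<^sub>v" using y(2) subspD(2)[OF subsp_span[of "{x}"]] x by auto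
  note tx = functionalD[OF functional_tangent[OF x]] and ty = functionalD[OF functional_tangent[OF y(1) y0]]
  show ?thesis
  proof (cases "a = \<zero> \<or> b = \<zero>")
    case True
    then show ?thesis
    proof
      assume "a = \<zero>"
      then have "z = b \<cdot> y" "b \<noteq> \<zero>" using x y ab z by auto
      then obtain l where "l \<in> carrier K" "\<forall>v\<in>carrier V. tangent z v = tangent y v \<otimes> l"
        using pencil_multiple y y0 ab by blast
      then show ?thesis using tx(1) ty(1) by (intro bexI[of _ \<zero>] bexI[of _ l]) auto
    next
      assume "b = \<zero>"
      then have "z = a \<cdot> x" "a \<noteq> \<zero>" using x y ab z by auto
      then obtain l where "l \<in> carrier K" "\<forall>v\<in>carrier V. tangent z v = tangent x v \<otimes> l"
        using pencil_multiple x ab by blast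
      then show ?thesis using tx(1) ty(1) by (intro bexI[of _ \<zero>] bexI[of _ l]) auto
    qed
  next
    case False
    have zx: "z \<in> C" unfolding z using add_C perp_smult_l perp_smult xy ab by blast
    have "x \<notin> span {z}"
    proof
      assume "x \<in> span {z}"
      then have e: "span {x} = span {z}" using span_singleton_absorb x zx by blast
      have s: "subsp (span {x})" using subsp_span x by simp
      have "a \<cdot> x \<in> span {x}" using subspD(4)[OF s] ab span_base by blast
      moreover have "b \<cdot> y +\<^sub>v a \<cdot> x \<in> span {x}" using e span_base[of z "{z}"] z x y ab by (simp add: V.a_comm)
      ultimately have "b \<cdot> y \<in> span {x}" using subsp_add_cancel[OF s, of "b \<cdot> y"] ab y by simp
      then show False using subsp_smult_cancel[OF s, of b y] y ab False by auto
    qed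
    then obtain c where c: "c \<bottom> z" "\<not> c \<bottom> x" using separate zx x by blast
    have cC: "c \<in> C" using c perp_D by blast
    have cy: "\<not> c \<bottom> y"
    proof
      assume "c \<bottom> y"
      moreover have "a \<cdot> x \<bottom> y" using perp_smult_l xy ab by blast
      ultimately have "c \<bottom> a \<cdot> x" using perp_cancel[of c "a \<cdot> x" b y] c ab unfolding z by blast
      then show False using perp_smult_cancel c ab x False by blast
    qed
    let ?s = "tangent x c" and ?t = "tangent y c"
    have st: "?s \<in> carrier K" "?s \<noteq> \<zero>" "?t \<in> carrier K" "?t \<noteq> \<zero>"
      using tx(1) ty(1) cC c cy tangent_eq_zero_iff_perp[OF x cC] tangent_eq_zero_iff_perp[OF y(1) y0 cC] by auto
    let ?m = "inv ?s" and ?n = "\<ominus> (inv ?t)"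
    let ?psi = "\<lambda>v\<in>carrier V. tangent x v \<otimes> ?m \<oplus> tangent y v \<otimes> ?n"
    have n0: "?n \<noteq> \<zero>" using st by (metis K.minus_minus K.minus_zero inv_K(1,2))
    have f: "functional ?psi" using functional_comb[OF functional_tangent[OF x] functional_tangent[OF y(1) y0]] st by simp
    have pc: "?psi c = \<zero>" using st cC by (simp add: K.r_minus K.r_neg)
    obtain k where k: "k \<in> carrier K" "k \<noteq> \<zero>" "\<forall>v\<in>carrier V. ?psi v = tangent z v \<otimes> k"
      using pencil[OF x y xy _ _ n0 f _ cC pc c(2) ab z c(1), of ?m] st by auto
    note tz = functionalD[OF functional_tangent[OF zx z(2)]]
    have "tangent z v = tangent x v \<otimes> (?m \<otimes> inv k) \<oplus> tangent y v \<otimes> (?n \<otimes> inv k)" if v: "v \<in> carrier V" for v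
    proof -
      have "tangent z v = (tangent z v \<otimes> k) \<otimes> inv k" using k v tz(1) by (simp add: K.m_assoc)
      also have "\<dots> = (tangent x v \<otimes> ?m \<oplus> tangent y v \<otimes> ?n) \<otimes> inv k" using k(3) v by simp
      also have "\<dots> = tangent x v \<otimes> (?m \<otimes> inv k) \<oplus> tangent y v \<otimes> (?n \<otimes> inv k)"
        using k(1,2) st v tx(1) ty(1) by (simp add: K.l_distr K.m_assoc)
      finally show ?thesis .
    qed
    moreover have "?m \<otimes> inv k \<in> carrier K" "?n \<otimes> inv k \<in> carrier K" using k st by simp_all
    ultimately show ?thesis by blast
  qed
qed

text \<open>
  The point \<open>c\<close> required by \<open>pencil\<close> is found on a line \<open>ed\<close> opposite to the line \<open>xy\<close>: at \<open>e\<close> only the first, at \<open>d\<close> only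
  the second summand is different from zero.\<close>

lemma pencil_is_tangent:
  assumes x: "x \<in> C" "x \<noteq> 0\<^sub>v" and y: "y \<in> C" "y \<notin> span {x}" and xy: "x \<bottom> y"
    and mn: "m \<in> carrier K" "n \<in> carrier K" "m \<noteq> \<zero> \<or> n \<noteq> \<zero>"
  shows "\<exists>z\<in>span {x, y}. z \<noteq> 0\<^sub>v \<and> (\<exists>k\<in>carrier K. k \<noteq> \<zero> \<and>
    (\<forall>v\<in>carrier V. tangent x v \<otimes> m \<oplus> tangent y v \<otimes> n = tangent z v \<otimes> k))"
proof -
  have y0: "y \<noteq> 0\<^sub>v" using y(2) subspD(2)[OF subsp_span[of "{x}"]] x by auto
  note tx = functionalD[OF functional_tangent[OF x]] and ty = functionalD[OF functional_tangent[OF y(1) y0]]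
  consider "m = \<zero>" | "n = \<zero>" | "m \<noteq> \<zero>" "n \<noteq> \<zero>" by blast
  then show ?thesis
  proof cases
    case 1
    then show ?thesis using mn tx(1) ty(1) y0 by (intro bexI[of _ y] conjI bexI[of _ n]) (auto intro: span_base)
  next
    case 2
    then show ?thesis using mn tx(1) ty(1) x by (intro bexI[of _ x] conjI bexI[of _ m]) (auto intro: span_base)
  next
    case 3
    have "x \<notin> span {y}"
      using span_singleton_absorb[of x y] x y span_base[of y "{y}"] by auto
    then obtain e where e: "e \<bottom> y" "\<not> e \<bottom> x" using separate[OF y(1) x(1)] by blast
    obtain d0 where d0: "d0 \<bottom> x" "\<not> d0 \<bottom> y" using separate[OF x(1) y] by blast
    have C: "e \<in> C" using e perp_D by blast
    obtain k where k: "k \<in> carrier K" "e \<bottom> d0 +\<^sub>v k \<cdot> x" using one_or_all[OF C d0(1) e(2)] by blast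
    define d where "d = d0 +\<^sub>v k \<cdot> x"
    have ed: "e \<bottom> d" using k d_def by simp
    have dC: "d \<in> C" using ed perp_D by blast
    have dx: "d \<bottom> x" unfolding d_def using perp_sym[OF perp_comb_self] d0 k by blast
    have dy: "\<not> d \<bottom> y"
      using perp_cancel[of y d0 k x] d0 k xy perp_sym unfolding d_def by blast
    let ?s = "tangent x e" and ?t = "tangent y d"
    have st: "?s \<in> carrier K" "?s \<noteq> \<zero>" "?t \<in> carrier K" "?t \<noteq> \<zero>"
      using tx(1) ty(1) C dC e dy tangent_eq_zero_iff_perp[OF x C] tangent_eq_zero_iff_perp[OF y(1) y0 dC] by auto
    have st0: "tangent x d = \<zero>" "tangent y e = \<zero>"
      using C dC e dx tangent_eq_zero_iff_perp[OF x dC] tangent_eq_zero_iff_perp[OF y(1) y0 C] by auto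
    let ?psi = "\<lambda>v\<in>carrier V. tangent x v \<otimes> m \<oplus> tangent y v \<otimes> n"
    have f: "functional ?psi" using functional_comb[OF functional_tangent[OF x] functional_tangent[OF y(1) y0]] mn by simp
    have tn: "?t \<otimes> n \<in> carrier K" "?t \<otimes> n \<noteq> \<zero>" using st mn 3 K_integral by auto
    define h where "h = \<ominus> (?s \<otimes> m \<otimes> inv (?t \<otimes> n))"
    have h: "h \<in> carrier K" unfolding h_def using st mn tn by simp
    let ?c = "e +\<^sub>v h \<cdot> d"
    have cC: "?c \<in> C" using comb_C ed h by blast
    have "?psi ?c = ?s \<otimes> m \<oplus> h \<otimes> (?t \<otimes> n)"
      using C dC h st st0 mn tx ty by (simp add: K.m_assoc)
    also have "\<dots> = \<zero>" unfolding h_def using st mn tn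
      by (simp add: K.l_minus K.m_assoc[of "?s \<otimes> m" "inv (?t \<otimes> n)" "?t \<otimes> n"] K.r_neg)
    finally have pc: "?psi ?c = \<zero>" .
    have cx: "\<not> ?c \<bottom> x" using perp_cancel[of x e h d] ed h dx e perp_sym by blast
    have cy: "\<not> ?c \<bottom> y"
    proof
      assume "?c \<bottom> y"
      then have "tangent y ?c = \<zero>" using tangent_eq_zero_iff_perp[OF y(1) y0 cC] by blast
      then have "tangent x ?c \<otimes> m = \<zero>" using pc cC mn tx(1)[of ?c] by simp
      then have "tangent x ?c = \<zero>" using K_integral mn 3 tx(1)[of ?c] cC by auto
      then show False using cx tangent_eq_zero_iff_perp[OF x cC] by blast
    qed
    obtain l where l: "l \<in> carrier K" "?c \<bottom> x +\<^sub>v l \<cdot> y" using one_or_all[OF cC xy cy] by blast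
    let ?z = "x +\<^sub>v l \<cdot> y"
    have z0: "?z \<noteq> 0\<^sub>v" using comb_nonzero x y l by blast
    have ze: "?z = \<one> \<cdot> x +\<^sub>v l \<cdot> y" using x by simp
    obtain r where r: "r \<in> carrier K" "r \<noteq> \<zero>" "\<forall>v\<in>carrier V. ?psi v = tangent ?z v \<otimes> r"
      using pencil[OF x y xy mn(1,2) 3(2) f _ cC pc cx K.one_closed l(1) ze z0 l(2)] by auto
    have "?z \<in> span {x, y}"
      unfolding span_pair[OF C_in[OF x(1)] C_in[OF y(1)]]
      by (rule CollectI, rule exI[of _ \<one>], rule exI[of _ l]) (use x l in simp)
    moreover have "\<forall>v\<in>carrier V. tangent x v \<otimes> m \<oplus> tangent y v \<otimes> n = tangent ?z v \<otimes> r"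
      using r(3) by simp
    ultimately show ?thesis using r(1,2) z0 by blast
  qed
qed

end

section \<open>Universality over arbitrary types\<close>

lemma skew_fieldI:
  fixes K (structure)
  assumes "ring K" "\<one> \<noteq> \<zero>"
    and "\<And>a. a \<in> carrier K \<Longrightarrow> a \<noteq> \<zero> \<Longrightarrow> \<exists>b\<in>carrier K. b \<otimes> a = \<one> \<and> a \<otimes> b = \<one>"
  shows "skew_field K"
proof -
  interpret ring K by fact
  have "\<zero> \<notin> Units K" using assms(2) by (auto simp: Units_def)
  then have "Units K = carrier K - {\<zero>}" using assms(3) by (auto simp: Units_def)
  then show ?thesis using assms(2) by unfold_locales auto
qed

lemma semilinearD:
  assumes "semilinear K V K' V' f"
  shows "f \<in> carrier V \<rightarrow> carrier V'"
    "\<And>x y. x \<in> carrier V \<Longrightarrow> y \<in> carrier V \<Longrightarrow> f (x \<oplus>\<^bsub>V\<^esub> y) = f x \<oplus>\<^bsub>V'\<^esub> f y"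
  using assms by (auto simp: semilinear_def)

lemma semilinear_zero:
  assumes "left_vector_space K V" "left_vector_space K' V'" "semilinear K V K' V' f"
  shows "f \<zero>\<^bsub>V\<^esub> = \<zero>\<^bsub>V'\<^esub>"
proof -
  interpret A: left_vector_space K V by fact
  interpret B: left_vector_space K' V' by fact
  note f = semilinearD[OF assms(3)]
  have "f \<zero>\<^bsub>V\<^esub> \<oplus>\<^bsub>V'\<^esub> f \<zero>\<^bsub>V\<^esub> = f \<zero>\<^bsub>V\<^esub>"
    using f(2)[OF A.V.zero_closed A.V.zero_closed] by simp
  then show ?thesis using f(1) by (metis A.V.zero_closed B.V.add.r_cancel_one Pi_mem)
qed

text \<open>Since the companion of a semilinear map is surjective, images of subspaces are subspaces.\<close>

lemma semilinear_span:
  assumes "left_vector_space K V" "left_vector_space K' V'" and f: "semilinear K V K' V' f"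
    and A: "A \<subseteq> carrier V"
  shows "lin_span K' V' (f ` A) = f ` lin_span K V A"
proof
  interpret A: left_vector_space K V by fact
  interpret B: left_vector_space K' V' by fact
  obtain \<sigma> where s: "\<sigma> \<in> ring_iso K K'"
    and fs: "\<And>a x. a \<in> carrier K \<Longrightarrow> x \<in> carrier V \<Longrightarrow> f (a \<odot>\<^bsub>V\<^esub> x) = \<sigma> a \<odot>\<^bsub>V'\<^esub> f x"
    using f by (auto simp: semilinear_def)
  note f' = semilinearD[OF f] and f0 = semilinear_zero[OF assms(1-3)]
  have surj: "\<sigma> ` carrier K = carrier K'" using ring_iso_memE(5)[OF s] by (simp add: bij_betw_def)
  have fA: "f ` A \<subseteq> carrier V'" using A f'(1) by blast
  note W = A.subspD[OF A.subsp_span[OF A]]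
  have "B.subsp (f ` A.span A)"
  proof (rule B.subspI)
    show "f ` A.span A \<subseteq> carrier V'" using W(1) f'(1) by blast
    show "\<zero>\<^bsub>V'\<^esub> \<in> f ` A.span A" using W(2) f0 by (metis imageI)
  next
    fix x y assume "x \<in> f ` A.span A" "y \<in> f ` A.span A"
    then obtain x' y' where xy: "x' \<in> A.span A" "x = f x'" "y' \<in> A.span A" "y = f y'" by blast
    then have "x \<oplus>\<^bsub>V'\<^esub> y = f (x' \<oplus>\<^bsub>V\<^esub> y')" using f'(2)[of x' y'] subsetD[OF W(1)] by simp
    then show "x \<oplus>\<^bsub>V'\<^esub> y \<in> f ` A.span A" using W(3) xy by blast
  next
    fix a x assume "a \<in> carrier K'" "x \<in> f ` A.span A"
    then obtain a' x' where ax: "a' \<in> carrier K" "a = \<sigma> a'" "x' \<in> A.span A" "x = f x'" using surj by blast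
    then have "a \<odot>\<^bsub>V'\<^esub> x = f (a' \<odot>\<^bsub>V\<^esub> x')" using fs[of a' x'] subsetD[OF W(1)] by simp
    then show "a \<odot>\<^bsub>V'\<^esub> x \<in> f ` A.span A" using W(4) ax by blast
  qed
  then show "B.span (f ` A) \<subseteq> f ` A.span A"
    using A.span_superset by (intro B.span_least image_mono)
  note U = B.subspD[OF B.subsp_span[OF fA]]
  let ?P = "{v \<in> carrier V. f v \<in> B.span (f ` A)}"
  have "A.subsp ?P"
  proof (rule A.subspI)
    show "\<zero>\<^bsub>V\<^esub> \<in> ?P" using f0 U(2) by simp
  next
    fix a x assume "a \<in> carrier K" "x \<in> ?P"
    then show "a \<odot>\<^bsub>V\<^esub> x \<in> ?P" using fs U(4) ring_iso_memE(1)[OF s] by simp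
  qed (use f'(2) U(3) in auto)
  moreover have "A \<subseteq> ?P" using A B.span_base by auto
  ultimately show "f ` A.span A \<subseteq> B.span (f ` A)" using A.span_least by blast
qed

lemma pg_points_eq: "pg_points K V = (\<lambda>v. lin_span K V {v}) ` (carrier V - {\<zero>\<^bsub>V\<^esub>})"
  by (auto simp: pg_points_def)

text \<open>Together with the copies below this moves an embedding to any types that are large enough.\<close>

lemma embedding_transport:
  assumes emb: "embedding \<Gamma> K V \<epsilon>" and V': "left_vector_space K' V'"
    and f: "semilinear K V K' V' f" and bij: "bij_betw f (carrier V) (carrier V')"
    and lin: "\<forall>l\<in>lines \<Gamma>. l \<subseteq> points \<Gamma>"
  shows "embedding \<Gamma> K' V' (\<lambda>p. f ` \<epsilon> p)"
proof -
  have V: "left_vector_space K V" using emb by (simp add: embedding_def)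
  interpret A: left_vector_space K V by fact
  interpret B: left_vector_space K' V' by fact
  have inj: "inj_on f (carrier V)" and im: "f ` carrier V = carrier V'" using bij by (auto simp: bij_betw_def)
  have f0: "f \<zero>\<^bsub>V\<^esub> = \<zero>\<^bsub>V'\<^esub>" using semilinear_zero[OF V V' f] .
  have span: "B.span (f ` A) = f ` A.span A" if "A \<subseteq> carrier V" for A
    using semilinear_span[OF V V' f that] .
  have ptV: "P \<in> pg_points K V \<Longrightarrow> P \<subseteq> carrier V" for P
    using A.span_carrier by (auto simp: pg_points_def)
  have epsV: "\<epsilon> p \<in> pg_points K V" if "p \<in> points \<Gamma>" for p using emb that by (auto simp: embedding_def)
  have pts: "pg_points K' V' = (`) f ` pg_points K V"
  proof -
    have "carrier V' - {\<zero>\<^bsub>V'\<^esub>} = f ` (carrier V - {\<zero>\<^bsub>V\<^esub>})"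
      using im f0 inj by (auto simp: inj_on_def)
    then have "pg_points K' V' = (\<lambda>v. B.span (f ` {v})) ` (carrier V - {\<zero>\<^bsub>V\<^esub>})"
      by (simp add: pg_points_eq image_image)
    also have "\<dots> = (\<lambda>v. f ` A.span {v}) ` (carrier V - {\<zero>\<^bsub>V\<^esub>})"
      by (intro image_cong refl span) auto
    finally show ?thesis by (simp add: pg_points_eq image_image)
  qed
  have sub_iff: "f ` P \<subseteq> f ` Q \<longleftrightarrow> P \<subseteq> Q" if "P \<subseteq> carrier V" "Q \<subseteq> carrier V" for P Q
  proof
    assume s: "f ` P \<subseteq> f ` Q"
    show "P \<subseteq> Q"
    proof
      fix x assume x: "x \<in> P"
      then have "f x \<in> f ` Q" using s by blast
      then show "x \<in> Q" using inj_on_image_mem_iff[OF inj _ that(2), of x] that(1) x by blast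
    qed
  qed (rule image_mono)
  have eq_iff: "f ` P = f ` Q \<longleftrightarrow> P = Q" if "P \<subseteq> carrier V" "Q \<subseteq> carrier V" for P Q
    using inj_on_image_eq_iff[OF inj that] .
  have lns: "(`) f ` L \<in> pg_lines K' V'" if L: "L \<in> pg_lines K V" for L
  proof -
    obtain P Q where PQ: "P \<in> pg_points K V" "Q \<in> pg_points K V" "P \<noteq> Q"
      and Leq: "L = {R \<in> pg_points K V. R \<subseteq> A.span (P \<union> Q)}"
      using L by (auto simp: pg_lines_def)
    have PQV: "P \<union> Q \<subseteq> carrier V" using PQ ptV by blast
    have "(`) f ` L = {R \<in> pg_points K' V'. R \<subseteq> B.span (f ` P \<union> f ` Q)}"
    proof -
      have e: "B.span (f ` P \<union> f ` Q) = f ` A.span (P \<union> Q)" using span[OF PQV] by (simp add: image_Un)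
      have "f ` R \<subseteq> f ` A.span (P \<union> Q) \<longleftrightarrow> R \<subseteq> A.span (P \<union> Q)" if "R \<in> pg_points K V" for R
        using sub_iff[OF ptV[OF that] A.span_carrier[OF PQV]] .
      then show ?thesis unfolding Leq pts e by auto
    qed
    moreover have "f ` P \<in> pg_points K' V'" "f ` Q \<in> pg_points K' V'" "f ` P \<noteq> f ` Q"
      using PQ pts eq_iff ptV by auto
    ultimately show ?thesis unfolding pg_lines_def by blast
  qed
  show ?thesis
    unfolding embedding_def
  proof (intro conjI ballI)
    show "left_vector_space K' V'" by fact
    show "inj_on (\<lambda>p. f ` \<epsilon> p) (points \<Gamma>)"
    proof (rule inj_onI)
      fix p q assume pq: "p \<in> points \<Gamma>" "q \<in> points \<Gamma>" "f ` \<epsilon> p = f ` \<epsilon> q"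
      then have "\<epsilon> p = \<epsilon> q" using eq_iff ptV epsV by blast
      then show "p = q" using emb pq by (auto simp: embedding_def inj_on_def)
    qed
    show "(\<lambda>p. f ` \<epsilon> p) ` points \<Gamma> \<subseteq> pg_points K' V'" using epsV pts by blast
    have "\<Union> (\<epsilon> ` points \<Gamma>) \<subseteq> carrier V" using epsV ptV by blast
    from span[OF this] have "B.span (f ` \<Union> (\<epsilon> ` points \<Gamma>)) = carrier V'"
      using emb im by (simp add: embedding_def)
    then show "B.span (\<Union> ((\<lambda>p. f ` \<epsilon> p) ` points \<Gamma>)) = carrier V'"
      by (simp add: image_UN)
  next
    fix l assume "l \<in> lines \<Gamma>"
    then have "(`) f ` (\<epsilon> ` l) \<in> pg_lines K' V'" using lns emb by (simp add: embedding_def)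
    then show "(\<lambda>p. f ` \<epsilon> p) ` l \<in> pg_lines K' V'" by (simp add: image_image)
  qed
qed

text \<open>
  Universality is stated for embeddings whose scalars are points and whose vectors are functions from
  points to points. An arbitrary embedding is brought into this form by injections of its scalars and its
  vectors into these types; the operations on the copies are obtained by decoding with the inverses.\<close>

definition copy_ring :: "('k \<Rightarrow> 'l) \<Rightarrow> 'k ring \<Rightarrow> 'l ring" where
  "copy_ring h K = \<lparr>carrier = h ` carrier K,
     mult = \<lambda>a b. h (inv_into (carrier K) h a \<otimes>\<^bsub>K\<^esub> inv_into (carrier K) h b), one = h \<one>\<^bsub>K\<^esub>,
     zero = h \<zero>\<^bsub>K\<^esub>, add = \<lambda>a b. h (inv_into (carrier K) h a \<oplus>\<^bsub>K\<^esub> inv_into (carrier K) h b)\<rparr>"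

definition copy_module ::
  "('k \<Rightarrow> 'l) \<Rightarrow> ('v \<Rightarrow> 'w) \<Rightarrow> 'k ring \<Rightarrow> ('k, 'v) module \<Rightarrow> ('l, 'w) module" where
  "copy_module h j K V = \<lparr>carrier = j ` carrier V, mult = undefined, one = undefined, zero = j \<zero>\<^bsub>V\<^esub>,
     add = \<lambda>x y. j (inv_into (carrier V) j x \<oplus>\<^bsub>V\<^esub> inv_into (carrier V) j y),
     smult = \<lambda>a x. j (inv_into (carrier K) h a \<odot>\<^bsub>V\<^esub> inv_into (carrier V) j x)\<rparr>"

lemma copy:
  assumes V: "left_vector_space K V" and h: "inj_on h (carrier K)" and j: "inj_on j (carrier V)"
  shows copy_left_vector_space: "left_vector_space (copy_ring h K) (copy_module h j K V)"
    and copy_semilinear: "semilinear K V (copy_ring h K) (copy_module h j K V) j"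
    and copy_bij: "bij_betw j (carrier V) (carrier (copy_module h j K V))"
proof -
  interpret left_vector_space K V by fact
  let ?K = "copy_ring h K" and ?V = "copy_module h j K V"
  have abK: "abelian_group ?K"
  proof (rule abelian_groupI)
    fix x assume "x \<in> carrier ?K"
    then obtain a where a: "a \<in> carrier K" "x = h a" by (auto simp: copy_ring_def)
    then show "\<exists>y\<in>carrier ?K. y \<oplus>\<^bsub>?K\<^esub> x = \<zero>\<^bsub>?K\<^esub>"
      by (intro bexI[of _ "h (\<ominus>\<^bsub>K\<^esub> a)"]) (auto simp: copy_ring_def h K.l_neg)
  qed (auto simp: copy_ring_def h K.a_ac)
  have monK: "monoid ?K" by (rule monoidI) (auto simp: copy_ring_def h K.m_assoc)
  have "ring ?K"
    by (rule ringI[OF abK monK]) (auto simp: copy_ring_def h K.l_distr K.r_distr)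
  then have skew: "skew_field ?K"
  proof (rule skew_fieldI)
    show "\<one>\<^bsub>?K\<^esub> \<noteq> \<zero>\<^bsub>?K\<^esub>" using one_neq_zero h by (auto simp: copy_ring_def inj_on_def)
    fix x assume "x \<in> carrier ?K" "x \<noteq> \<zero>\<^bsub>?K\<^esub>"
    then obtain a where a: "a \<in> carrier K" "x = h a" "a \<noteq> \<zero>\<^bsub>K\<^esub>" by (auto simp: copy_ring_def)
    then show "\<exists>b\<in>carrier ?K. b \<otimes>\<^bsub>?K\<^esub> x = \<one>\<^bsub>?K\<^esub> \<and> x \<otimes>\<^bsub>?K\<^esub> b = \<one>\<^bsub>?K\<^esub>"
      by (intro bexI[of _ "h (inv\<^bsub>K\<^esub> a)"]) (auto simp: copy_ring_def h)
  qed
  have abV: "abelian_group ?V"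
  proof (rule abelian_groupI)
    fix x assume "x \<in> carrier ?V"
    then obtain a where a: "a \<in> carrier V" "x = j a" by (auto simp: copy_module_def)
    then show "\<exists>y\<in>carrier ?V. y \<oplus>\<^bsub>?V\<^esub> x = \<zero>\<^bsub>?V\<^esub>"
      by (intro bexI[of _ "j (\<ominus>\<^bsub>V\<^esub> a)"]) (auto simp: copy_module_def j V.l_neg)
  qed (auto simp: copy_module_def j V.a_ac)
  show "left_vector_space ?K ?V"
    by (intro left_vector_space.intro left_vector_space_axioms.intro skew abV)
       (auto simp: copy_module_def copy_ring_def h j smult_l_distr smult_r_distr smult_assoc)
  have iso: "h \<in> ring_iso K ?K"
    by (rule ring_iso_memI) (auto simp: copy_ring_def h bij_betw_def)
  show "semilinear K V ?K ?V j"
    unfolding semilinear_def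
  proof (intro conjI ballI bexI[OF _ iso])
  qed (auto simp: copy_module_def h j)
  show "bij_betw j (carrier V) (carrier ?V)" using j by (simp add: bij_betw_def copy_module_def)
qed

lemma ring_iso_inv_into: "h \<in> ring_iso K L \<Longrightarrow> ring K \<Longrightarrow> inv_into (carrier K) h \<in> ring_iso L K"
  using ring_iso_set_sym by blast

lemma semilinear_inv_into:
  assumes V: "left_vector_space K V" and f: "semilinear K V K' V' f"
    and bij: "bij_betw f (carrier V) (carrier V')"
  shows "semilinear K' V' K V (inv_into (carrier V) f)"
proof -
  interpret left_vector_space K V by fact
  obtain \<sigma> where s: "\<sigma> \<in> ring_iso K K'"
    and fs: "\<And>a x. a \<in> carrier K \<Longrightarrow> x \<in> carrier V \<Longrightarrow> f (a \<odot>\<^bsub>V\<^esub> x) = \<sigma> a \<odot>\<^bsub>V'\<^esub> f x"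
    using f by (auto simp: semilinear_def)
  note f' = semilinearD[OF f]
  let ?g = "inv_into (carrier V) f" and ?t = "inv_into (carrier K) \<sigma>"
  have inj: "inj_on f (carrier V)" and im: "f ` carrier V = carrier V'" using bij by (auto simp: bij_betw_def)
  have injs: "inj_on \<sigma> (carrier K)" and ims: "\<sigma> ` carrier K = carrier K'"
    using ring_iso_memE(5)[OF s] by (auto simp: bij_betw_def)
  have gf: "?g (f x) = x" if "x \<in> carrier V" for x using inj that by simp
  have ts: "?t (\<sigma> a) = a" if "a \<in> carrier K" for a using injs that by simp
  have t: "?t \<in> ring_iso K' K" using ring_iso_inv_into[OF s] K.ring_axioms by blast
  show ?thesis
    unfolding semilinear_def
  proof (intro conjI ballI bexI[OF _ t])
    show "?g \<in> carrier V' \<rightarrow> carrier V" using im by (auto intro: inv_into_into)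
  next
    fix x y assume "x \<in> carrier V'" "y \<in> carrier V'"
    then obtain x' y' where *: "x' \<in> carrier V" "x = f x'" "y' \<in> carrier V" "y = f y'" using im by blast
    then have "x \<oplus>\<^bsub>V'\<^esub> y = f (x' \<oplus>\<^bsub>V\<^esub> y')" using f'(2) by simp
    then show "?g (x \<oplus>\<^bsub>V'\<^esub> y) = ?g x \<oplus>\<^bsub>V\<^esub> ?g y" using * gf by simp
  next
    fix a x assume "a \<in> carrier K'" "x \<in> carrier V'"
    then obtain a' x' where *: "a' \<in> carrier K" "a = \<sigma> a'" "x' \<in> carrier V" "x = f x'" using im ims by blast
    then have "a \<odot>\<^bsub>V'\<^esub> x = f (a' \<odot>\<^bsub>V\<^esub> x')" using fs by simp
    then show "?g (a \<odot>\<^bsub>V'\<^esub> x) = ?t a \<odot>\<^bsub>V\<^esub> ?g x" using * gf ts by simp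
  qed
qed

lemma semilinear_comp:
  assumes f: "semilinear K V K' V' f" and g: "semilinear K' V' K'' V'' g"
  shows "semilinear K V K'' V'' (g \<circ> f)"
proof -
  obtain \<sigma> where s: "\<sigma> \<in> ring_iso K K'"
    and fs: "\<And>a x. a \<in> carrier K \<Longrightarrow> x \<in> carrier V \<Longrightarrow> f (a \<odot>\<^bsub>V\<^esub> x) = \<sigma> a \<odot>\<^bsub>V'\<^esub> f x"
    using f by (auto simp: semilinear_def)
  obtain \<tau> where t: "\<tau> \<in> ring_iso K' K''"
    and gs: "\<And>a x. a \<in> carrier K' \<Longrightarrow> x \<in> carrier V' \<Longrightarrow> g (a \<odot>\<^bsub>V'\<^esub> x) = \<tau> a \<odot>\<^bsub>V''\<^esub> g x"
    using g by (auto simp: semilinear_def)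
  note f' = semilinearD[OF f] and g' = semilinearD[OF g]
  have "\<tau> \<circ> \<sigma> \<in> ring_iso K K''" using ring_iso_set_trans[OF s t] .
  then show ?thesis
    unfolding semilinear_def using f' g' fs gs ring_iso_memE(1)[OF s]
    by (intro conjI ballI bexI[of _ "\<tau> \<circ> \<sigma>"]) (auto simp: Pi_iff)
qed

context left_vector_space
begin

text \<open>
  The points spanned by \<open>x + k y\<close>, for independent \<open>x\<close> and \<open>y\<close>, are different for different \<open>k\<close>. In an
  embedded geometry this makes room for the scalars among the points of any line.\<close>

lemma scalars_inject_into_pg_line:
  assumes L: "L \<in> pg_lines K V"
  shows "\<exists>g. inj_on g (carrier K) \<and> g ` carrier K \<subseteq> L"
proof -
  obtain P Q where PQ: "P \<in> pg_points K V" "Q \<in> pg_points K V" "P \<noteq> Q"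
    and Leq: "L = {R \<in> pg_points K V. R \<subseteq> span (P \<union> Q)}"
    using L by (auto simp: pg_lines_def)
  obtain x y where x: "x \<in> carrier V" "x \<noteq> 0\<^sub>v" "P = span {x}"
    and y: "y \<in> carrier V" "y \<noteq> 0\<^sub>v" "Q = span {y}"
    using PQ by (auto simp: pg_points_def)
  have ind: "y \<notin> span {x}" using span_singleton_absorb[of y x] x y PQ by auto
  have nz: "x +\<^sub>v k \<cdot> y \<noteq> 0\<^sub>v" if "k \<in> carrier K" for k
    using comb_nonzero[OF x(1,2) y(1) ind that] .
  have PQV: "P \<union> Q \<subseteq> carrier V" using x y span_carrier by simp
  have sPQ: "subsp (span (P \<union> Q))" using subsp_span[OF PQV] .
  let ?g = "\<lambda>k. span {x +\<^sub>v k \<cdot> y}"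
  have "inj_on ?g (carrier K)"
  proof (rule inj_onI)
    fix k l assume kl: "k \<in> carrier K" "l \<in> carrier K" "?g k = ?g l"
    then have "x +\<^sub>v l \<cdot> y \<in> ?g k" using span_base by blast
    then obtain a where a: "a \<in> carrier K" "x +\<^sub>v l \<cdot> y = a \<cdot> (x +\<^sub>v k \<cdot> y)"
      using x y kl by (auto simp: span_singleton)
    then have "\<one> \<cdot> x +\<^sub>v l \<cdot> y = a \<cdot> x +\<^sub>v (a \<otimes> k) \<cdot> y"
      using x y kl by (simp add: smult_r_distr smult_assoc)
    then have "\<one> = a" "l = a \<otimes> k"
      using pair_coeffs[OF x(1,2) y(1) ind, of \<one> l a "a \<otimes> k"] a kl by auto
    then show "k = l" using kl by auto
  qed
  moreover have "?g k \<in> L" if k: "k \<in> carrier K" for k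
  proof -
    have "x \<in> span (P \<union> Q)" "y \<in> span (P \<union> Q)" using x y span_base[of x "{x}"] span_base[of y "{y}"] 
      by (auto intro!: span_base)
    then have "x +\<^sub>v k \<cdot> y \<in> span (P \<union> Q)" using subspD(3,4)[OF sPQ] k by blast
    then have "?g k \<subseteq> span (P \<union> Q)" using span_least sPQ by simp
    then show ?thesis using nz[OF k] x y k unfolding Leq pg_points_def by blast
  qed
  ultimately show ?thesis by blast
qed

text \<open>
  A vector is encoded by the coefficients of one of its representations as a finite linear combination.
  It can be decoded because the support of a coefficient function is determined up to terms with coefficient zero,
  which do not contribute to the sum.\<close>

lemma vectors_inject_into_coefficients:
  fixes w :: "'p \<Rightarrow> 'v"
  assumes w: "w \<in> P \<rightarrow> carrier V" and sp: "span (w ` P) = carrier V"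
  shows "\<exists>g :: 'v \<Rightarrow> 'p \<Rightarrow> 'k. inj_on g (carrier V) \<and> (\<forall>v\<in>carrier V. range (g v) \<subseteq> carrier K)"
proof -
  define R where "R v x \<longleftrightarrow> (\<exists>F\<subseteq>P. finite F \<and> range x \<subseteq> carrier K \<and> (\<forall>p. p \<notin> F \<longrightarrow> x p = \<zero>) \<and>
    v = (\<Oplus>\<^bsub>V\<^esub>p\<in>F. x p \<cdot> w p))" for v and x :: "'p \<Rightarrow> 'k"
  have wV: "p \<in> P \<Longrightarrow> w p \<in> carrier V" for p using w by blast
  have fin: "\<exists>x. range x \<subseteq> carrier K \<and> (\<forall>p. p \<notin> F \<longrightarrow> x p = \<zero>) \<and> v = (\<Oplus>\<^bsub>V\<^esub>p\<in>F. x p \<cdot> w p)"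
    if "finite F" "F \<subseteq> P" "v \<in> span (w ` F)" for F v
    using that
  proof (induction F arbitrary: v)
    case empty
    then show ?case by (intro exI[of _ "\<lambda>_. \<zero>"]) (auto simp: span_empty)
  next
    case (insert q F)
    have qV: "w q \<in> carrier V" and FV: "w ` F \<subseteq> carrier V" using insert wV by auto
    have "v \<in> span (insert (w q) (w ` F))" using insert by simp
    then obtain k u where ku: "k \<in> carrier K" "u \<in> span (w ` F)" "v = k \<cdot> w q +\<^sub>v u"
      by (rule span_insertE[OF _ qV FV])
    obtain x where x: "range x \<subseteq> carrier K" "\<forall>p. p \<notin> F \<longrightarrow> x p = \<zero>" "u = (\<Oplus>\<^bsub>V\<^esub>p\<in>F. x p \<cdot> w p)"
      using insert.IH[OF _ ku(2)] insert.prems by blast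
    let ?x = "x(q := k)"
    have xK: "x p \<in> carrier K" for p using x(1) by blast
    have "(\<Oplus>\<^bsub>V\<^esub>p\<in>insert q F. ?x p \<cdot> w p) = ?x q \<cdot> w q +\<^sub>v (\<Oplus>\<^bsub>V\<^esub>p\<in>F. ?x p \<cdot> w p)"
      using insert.hyps insert.prems xK ku(1) wV by (intro V.finsum_insert) auto
    also have "(\<Oplus>\<^bsub>V\<^esub>p\<in>F. ?x p \<cdot> w p) = (\<Oplus>\<^bsub>V\<^esub>p\<in>F. x p \<cdot> w p)"
      using insert.hyps insert.prems xK wV by (intro V.finsum_cong') auto
    finally have "v = (\<Oplus>\<^bsub>V\<^esub>p\<in>insert q F. ?x p \<cdot> w p)" using ku(3) x(3) by simp
    moreover have "range ?x \<subseteq> carrier K" using xK ku(1) by auto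
    ultimately show ?case using x(2) by (intro exI[of _ ?x]) auto
  qed
  have ex: "\<exists>x. R v x" if v: "v \<in> carrier V" for v
  proof -
    have "w ` P \<subseteq> carrier V" using w by auto
    then obtain G where G: "G \<subseteq> w ` P" "finite G" "v \<in> span G"
      using span_finitary[of v "w ` P"] v sp by auto
    then obtain F where F: "F \<subseteq> P" "finite F" "G = w ` F" by (meson finite_subset_image)
    show ?thesis using fin[of F v] F G unfolding R_def by blast
  qed
  have uniq: "v = v'" if "R v x" "R v' x" for v v' x
  proof -
    obtain F F' where F: "F \<subseteq> P" "finite F" "\<forall>p. p \<notin> F \<longrightarrow> x p = \<zero>" "v = (\<Oplus>\<^bsub>V\<^esub>p\<in>F. x p \<cdot> w p)"
      and F': "F' \<subseteq> P" "finite F'" "\<forall>p. p \<notin> F' \<longrightarrow> x p = \<zero>" "v' = (\<Oplus>\<^bsub>V\<^esub>p\<in>F'. x p \<cdot> w p)"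
      and xK: "range x \<subseteq> carrier K"
      using \<open>R v x\<close> \<open>R v' x\<close> unfolding R_def by blast
    show ?thesis unfolding F(4) F'(4)
      by (rule V.add.finprod_mono_neutral_cong) (use F F' xK wV in \<open>auto simp: subset_iff\<close>)
  qed
  define g where "g v = (SOME x. R v x)" for v
  have g: "R v (g v)" if "v \<in> carrier V" for v unfolding g_def using ex[OF that] by (rule someI_ex)
  have "inj_on g (carrier V)" using g uniq by (metis inj_onI)
  moreover have "range (g v) \<subseteq> carrier K" if "v \<in> carrier V" for v using g[OF that] by (auto simp: R_def)
  ultimately show ?thesis by blast
qed

end

text \<open>
  Injections as above exist for every embedding of a geometry with a line, so that a universal embedding
  has morphisms to the embeddings over all types.\<close>

theorem universal_morphism:
  assumes univ: "absolutely_universal \<Gamma> K V \<epsilon>" and emb: "embedding \<Gamma> K' V' \<epsilon>'"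
    and l: "l \<in> lines \<Gamma>" and lin: "\<forall>l\<in>lines \<Gamma>. l \<subseteq> points (\<Gamma> :: 'p geometry)"
  shows "morphism \<Gamma> K V \<epsilon> K' V' \<epsilon>'"
proof -
  have V': "left_vector_space K' V'" using emb by (simp add: embedding_def)
  interpret B: left_vector_space K' V' by fact
  obtain h0 where h0: "inj_on h0 (carrier K')" "h0 ` carrier K' \<subseteq> \<epsilon>' ` l"
    using B.scalars_inject_into_pg_line[of "\<epsilon>' ` l"] emb l by (auto simp: embedding_def)
  define h :: "_ \<Rightarrow> 'p" where "h = inv_into l \<epsilon>' \<circ> h0"
  have h: "inj_on h (carrier K')"
    unfolding h_def using h0 by (intro comp_inj_on) (auto intro: inj_on_subset[OF inj_on_inv_into])
  have "\<exists>v. v \<in> carrier V' \<and> v \<noteq> \<zero>\<^bsub>V'\<^esub> \<and> \<epsilon>' p = B.span {v}" if "p \<in> points \<Gamma>" for p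
    using emb that by (auto simp: embedding_def pg_points_def)
  then obtain w where w: "\<And>p. p \<in> points \<Gamma> \<Longrightarrow> w p \<in> carrier V' \<and> \<epsilon>' p = B.span {w p}" by metis
  have wV: "w ` points \<Gamma> \<subseteq> carrier V'" using w by blast
  have sp: "B.span (w ` points \<Gamma>) = carrier V'"
  proof
    show "B.span (w ` points \<Gamma>) \<subseteq> carrier V'" using B.span_carrier wV by blast
    have "\<epsilon>' p \<subseteq> B.span (w ` points \<Gamma>)" if "p \<in> points \<Gamma>" for p
      using w[OF that] B.span_mono[of "{w p}" "w ` points \<Gamma>"] that by simp
    then have "\<Union> (\<epsilon>' ` points \<Gamma>) \<subseteq> B.span (w ` points \<Gamma>)" by blast
    then have "B.span (\<Union> (\<epsilon>' ` points \<Gamma>)) \<subseteq> B.span (w ` points \<Gamma>)" using B.span_span_least wV by blast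
    then show "carrier V' \<subseteq> B.span (w ` points \<Gamma>)" using emb by (simp add: embedding_def)
  qed
  have wP: "w \<in> points \<Gamma> \<rightarrow> carrier V'" using w by auto
  from B.vectors_inject_into_coefficients[OF wP sp] obtain g :: "_ \<Rightarrow> 'p \<Rightarrow> _"
    where g: "inj_on g (carrier V')" "\<forall>v\<in>carrier V'. range (g v) \<subseteq> carrier K'" by blast
  define j where "j v = h \<circ> g v" for v
  have j: "inj_on j (carrier V')"
  proof (rule inj_onI)
    fix v u assume vu: "v \<in> carrier V'" "u \<in> carrier V'" "j v = j u"
    have "g v p = g u p" for p
    proof -
      have "h (g v p) = h (g u p)" using vu(3) by (metis j_def comp_apply)
      moreover have "g v p \<in> carrier K'" "g u p \<in> carrier K'" using g(2) vu by blast+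
      ultimately show ?thesis using h by (meson inj_onD)
    qed
    then have "g v = g u" by (rule ext)
    then show "v = u" using g(1) vu by (meson inj_onD)
  qed
  let ?K = "copy_ring h K'" and ?V = "copy_module h j K' V'"
  have "embedding \<Gamma> ?K ?V (\<lambda>p. j ` \<epsilon>' p)"
    using embedding_transport[OF emb copy_left_vector_space copy_semilinear copy_bij lin] V' h j by blast
  then have "morphism \<Gamma> K V \<epsilon> ?K ?V (\<lambda>p. j ` \<epsilon>' p)" using univ by (auto simp: absolutely_universal_def)
  then obtain f where f: "semilinear K V ?K ?V f" "\<And>x. x \<in> points \<Gamma> \<Longrightarrow> f ` \<epsilon> x = j ` \<epsilon>' x"
    by (auto simp: morphism_def)
  let ?i = "inv_into (carrier V') j"
  have "semilinear K V K' V' (?i \<circ> f)"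
    using semilinear_comp[OF f(1) semilinear_inv_into[OF V' copy_semilinear copy_bij]] V' h j by blast
  moreover have "(?i \<circ> f) ` \<epsilon> x = \<epsilon>' x" if x: "x \<in> points \<Gamma>" for x
  proof -
    have "\<epsilon>' x \<subseteq> carrier V'" using w[OF x] B.span_carrier by simp
    then have "?i ` j ` \<epsilon>' x = \<epsilon>' x" using inv_into_image_cancel[OF j] by blast
    then show ?thesis using f(2)[OF x] by (metis image_comp)
  qed
  ultimately show ?thesis unfolding morphism_def by blast
qed

section \<open>The cone of an embedded polar space\<close>

lemma collinear_sym: "collinear \<Gamma> p q \<Longrightarrow> collinear \<Gamma> q p"
  by (auto simp: collinear_def)

lemma collinear_refl: "collinear \<Gamma> p p"
  by (simp add: collinear_def)

lemma line_collinear: "l \<in> lines \<Gamma> \<Longrightarrow> p \<in> l \<Longrightarrow> q \<in> l \<Longrightarrow> collinear \<Gamma> p q"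
  by (auto simp: collinear_def)

definition quadrangle :: "'p geometry \<Rightarrow> 'p \<Rightarrow> 'p \<Rightarrow> 'p \<Rightarrow> 'p \<Rightarrow> bool" where
  "quadrangle \<Gamma> a b c d \<longleftrightarrow> {a, b, c, d} \<subseteq> points \<Gamma> \<and> collinear \<Gamma> a b \<and> collinear \<Gamma> b c \<and>
     collinear \<Gamma> c d \<and> collinear \<Gamma> d a \<and> \<not> collinear \<Gamma> a c \<and> \<not> collinear \<Gamma> b d"

locale embedded_polar_space = left_vector_space K V
  for \<Gamma> :: "'p geometry" and K :: "'k ring" (structure) and V :: "('k, 'v) module" (structure) +
  fixes \<epsilon> :: "'p \<Rightarrow> 'v set"
  assumes polar: "polar_space \<Gamma>"
    and nondeg: "nondegenerate \<Gamma>"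
    and emb: "embedding \<Gamma> K V \<epsilon>"
begin

definition cone :: "'p set \<Rightarrow> 'v set" where
  "cone S = {v \<in> carrier V. v = 0\<^sub>v \<or> (\<exists>p\<in>S. \<epsilon> p = span {v})}"

definition cone_perp :: "'v \<Rightarrow> 'v \<Rightarrow> bool" where
  "cone_perp v w \<longleftrightarrow> v \<in> cone (points \<Gamma>) \<and> w \<in> cone (points \<Gamma>) \<and>
    (v = 0\<^sub>v \<or> w = 0\<^sub>v \<or>
      (\<exists>p\<in>points \<Gamma>. \<exists>q\<in>points \<Gamma>. \<epsilon> p = span {v} \<and> \<epsilon> q = span {w} \<and> collinear \<Gamma> p q))"

lemma lines_sub: "l \<in> lines \<Gamma> \<Longrightarrow> l \<subseteq> points \<Gamma>"
  using polar by (auto simp: polar_space_def point_line_geometry_def)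

lemma all_if_two:
  assumes "o' \<in> points \<Gamma>" "l \<in> lines \<Gamma>" "p \<in> l" "q \<in> l" "p \<noteq> q" "collinear \<Gamma> o' p" "collinear \<Gamma> o' q" "r \<in> l"
  shows "collinear \<Gamma> o' r"
  using polar assms unfolding polar_space_def by blast

lemma exists_on_line:
  assumes "o' \<in> points \<Gamma>" "l \<in> lines \<Gamma>" "p \<in> l"
  shows "\<exists>q\<in>l. collinear \<Gamma> o' q"
  using polar assms unfolding polar_space_def by blast

lemma eps_vector: "p \<in> points \<Gamma> \<Longrightarrow> \<exists>v\<in>carrier V. v \<noteq> 0\<^sub>v \<and> \<epsilon> p = span {v}"
  using emb by (auto simp: embedding_def pg_points_def)

lemma eps_inj: "p \<in> points \<Gamma> \<Longrightarrow> q \<in> points \<Gamma> \<Longrightarrow> \<epsilon> p = \<epsilon> q \<Longrightarrow> p = q"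
  using emb by (auto simp: embedding_def inj_on_def)

lemma eps_nonzero:
  assumes "p \<in> points \<Gamma>" "\<epsilon> p = span {v}" "v \<in> carrier V"
  shows "v \<noteq> 0\<^sub>v"
proof
  assume "v = 0\<^sub>v"
  moreover obtain u where "u \<in> carrier V" "u \<noteq> 0\<^sub>v" "\<epsilon> p = span {u}" using eps_vector assms by blast
  ultimately show False using assms span_base[of u "{u}"] by (auto simp: span_singleton)
qed

text \<open>
  The definition of a line of \<open>PG(V)\<close> mentions two of its points. Here the same line is described by the two
  points \<open>p\<close> and \<open>q\<close> that are relevant in the geometry.\<close>

lemma eps_line:
  assumes l: "l \<in> lines \<Gamma>" "p \<in> l" "q \<in> l" "p \<noteq> q"
    and v: "v \<in> carrier V" "\<epsilon> p = span {v}" and w: "w \<in> carrier V" "\<epsilon> q = span {w}"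
  shows "w \<notin> span {v}" "\<epsilon> ` l = {span {x} |x. x \<in> span {v, w} \<and> x \<noteq> 0\<^sub>v}"
proof -
  have pq: "p \<in> points \<Gamma>" "q \<in> points \<Gamma>" using lines_sub l by blast+
  have v0: "v \<noteq> 0\<^sub>v" and w0: "w \<noteq> 0\<^sub>v" using eps_nonzero pq v w by blast+
  show ind: "w \<notin> span {v}" using span_singleton_absorb[of w v] v w w0 eps_inj pq l by auto
  have "\<epsilon> ` l \<in> pg_lines K V" using emb l by (simp add: embedding_def)
  then obtain P Q where PQ: "P \<in> pg_points K V" "Q \<in> pg_points K V" "P \<noteq> Q"
    and leq: "\<epsilon> ` l = {R \<in> pg_points K V. R \<subseteq> span (P \<union> Q)}"
    by (auto simp: pg_lines_def)
  obtain x y where x: "x \<in> carrier V" "P = span {x}" and y: "y \<in> carrier V" "Q = span {y}"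
    using PQ by (auto simp: pg_points_def)
  have xy: "{x, y} \<subseteq> carrier V" using x y by simp
  have PQs: "span (P \<union> Q) = span {x, y}"
  proof
    have "P \<union> Q \<subseteq> span {x, y}" using x y span_mono[of "{x}" "{x, y}"] span_mono[of "{y}" "{x, y}"] by auto
    then show "span (P \<union> Q) \<subseteq> span {x, y}" using span_span_least xy by blast
    have "{x, y} \<subseteq> span (P \<union> Q)"
      using span_base[of x "{x}"] span_base[of y "{y}"] span_superset[of "P \<union> Q"] x(2) y(2) by blast
    moreover have "P \<union> Q \<subseteq> carrier V" using x y span_carrier by simp
    ultimately show "span {x, y} \<subseteq> span (P \<union> Q)" using span_span_least by blast
  qed
  have "\<epsilon> p \<in> \<epsilon> ` l" "\<epsilon> q \<in> \<epsilon> ` l" using l by auto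
  then have "v \<in> span {x, y}" "w \<in> span {x, y}"
    using leq v w PQs span_base[of v "{v}"] span_base[of w "{w}"] by auto
  then have vw: "span {v, w} = span {x, y}" using span_pair_eq x y v0 ind by blast
  show "\<epsilon> ` l = {span {x} |x. x \<in> span {v, w} \<and> x \<noteq> 0\<^sub>v}"
  proof
    show "\<epsilon> ` l \<subseteq> {span {x} |x. x \<in> span {v, w} \<and> x \<noteq> 0\<^sub>v}"
    proof
      fix R assume "R \<in> \<epsilon> ` l"
      then have R: "R \<in> pg_points K V" "R \<subseteq> span {v, w}" using leq PQs vw by auto
      then obtain u where "u \<in> carrier V" "u \<noteq> 0\<^sub>v" "R = span {u}" by (auto simp: pg_points_def)
      then show "R \<in> {span {x} |x. x \<in> span {v, w} \<and> x \<noteq> 0\<^sub>v}" using R span_base[of u "{u}"] by blast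
    qed
    show "{span {x} |x. x \<in> span {v, w} \<and> x \<noteq> 0\<^sub>v} \<subseteq> \<epsilon> ` l"
    proof safe
      fix u assume u: "u \<in> span {v, w}" "u \<noteq> 0\<^sub>v"
      have uV: "u \<in> carrier V" using u span_carrier[of "{v, w}"] v w by auto
      have "span {u} \<subseteq> span {v, w}" using span_span_least[of "{u}" "{v, w}"] u v w by simp
      moreover have "span {u} \<in> pg_points K V" using u uV by (auto simp: pg_points_def)
      ultimately show "span {u} \<in> \<epsilon> ` l" using leq PQs vw by simp
    qed
  qed
qed

lemma eps_join:
  assumes p: "p \<in> points \<Gamma>" "q \<in> points \<Gamma>" "collinear \<Gamma> p q"
    and v: "v \<in> carrier V" "\<epsilon> p = span {v}" and w: "w \<in> carrier V" "\<epsilon> q = span {w}"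
    and x: "x \<in> span {v, w}" "x \<noteq> 0\<^sub>v"
  obtains r where "r \<in> points \<Gamma>" "\<epsilon> r = span {x}"
    "\<And>o'. o' \<in> points \<Gamma> \<Longrightarrow> collinear \<Gamma> o' p \<Longrightarrow> collinear \<Gamma> o' q \<Longrightarrow> collinear \<Gamma> o' r"
    "\<And>S. geom_subspace \<Gamma> S \<Longrightarrow> p \<in> S \<Longrightarrow> q \<in> S \<Longrightarrow> r \<in> S"
proof (cases "p = q")
  case True
  have "{v, w} \<subseteq> span {v}" using True v w span_base[of w "{w}"] span_base[of v "{v}"] by auto
  then have "x \<in> span {v}" using span_span_least[of "{v, w}" "{v}"] v x by auto
  then have "\<epsilon> p = span {x}" using span_singleton_absorb x v by auto
  then show ?thesis using that[of p] p by blast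
next
  case False
  then obtain l where l: "l \<in> lines \<Gamma>" "p \<in> l" "q \<in> l" using p by (auto simp: collinear_def)
  have "span {x} \<in> \<epsilon> ` l" using eps_line(2)[OF l False v w] x by blast
  then obtain r where r: "r \<in> l" "\<epsilon> r = span {x}" by auto
  have "r \<in> points \<Gamma>" using r l lines_sub by blast
  moreover have "r \<in> S" if "geom_subspace \<Gamma> S" "p \<in> S" "q \<in> S" for S
    using that l r False unfolding geom_subspace_def by blast
  ultimately show ?thesis using that[of r] r l False all_if_two by blast
qed

lemma cone_nonzeroD:
  assumes "v \<in> cone S" "v \<noteq> 0\<^sub>v"
  obtains p where "p \<in> S" "\<epsilon> p = span {v}"
  using assms by (auto simp: cone_def)

lemma coneI: "v \<in> carrier V \<Longrightarrow> p \<in> S \<Longrightarrow> \<epsilon> p = span {v} \<Longrightarrow> v \<in> cone S"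
  by (auto simp: cone_def)

lemma zero_cone: "0\<^sub>v \<in> cone S"
  by (simp add: cone_def)

lemma cone_carrier: "cone S \<subseteq> carrier V"
  by (auto simp: cone_def)

definition vec :: "'p \<Rightarrow> 'v" where
  "vec p = (SOME v. v \<in> carrier V \<and> v \<noteq> 0\<^sub>v \<and> \<epsilon> p = span {v})"

lemma vec:
  assumes "p \<in> points \<Gamma>"
  shows vec_carrier: "vec p \<in> carrier V" and vec_nonzero: "vec p \<noteq> 0\<^sub>v" and eps_vec: "\<epsilon> p = span {vec p}"
    and vec_cone: "vec p \<in> cone (points \<Gamma>)"
proof -
  have "\<exists>v. v \<in> carrier V \<and> v \<noteq> 0\<^sub>v \<and> \<epsilon> p = span {v}" using eps_vector[OF assms] by blast
  then have "vec p \<in> carrier V \<and> vec p \<noteq> 0\<^sub>v \<and> \<epsilon> p = span {vec p}" unfolding vec_def by (rule someI_ex)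
  then show "vec p \<in> carrier V" "vec p \<noteq> 0\<^sub>v" "\<epsilon> p = span {vec p}" by auto
  then show "vec p \<in> cone (points \<Gamma>)" using coneI assms by blast
qed

lemma vec_line:
  assumes l: "l \<in> lines \<Gamma>" "p \<in> l" "q \<in> l" "p \<noteq> q"
  shows vec_line_independent: "vec q \<notin> span {vec p}"
    and vec_in_line_span: "z \<in> l \<Longrightarrow> vec z \<in> span {vec p, vec q}"
    and line_point_of_vector: "u \<in> span {vec p, vec q} \<Longrightarrow> u \<noteq> 0\<^sub>v \<Longrightarrow>
      \<exists>z\<in>l. \<exists>k\<in>carrier K. k \<noteq> \<zero> \<and> u = k \<cdot> vec z"
proof -
  have P: "z \<in> points \<Gamma>" if "z \<in> l" for z using that l lines_sub by blast
  note x = vec[OF P[OF l(2)]] and y = vec[OF P[OF l(3)]]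
  note el = eps_line[OF l x(1,3) y(1,3)]
  have sxy: "{vec p, vec q} \<subseteq> carrier V" using x y by simp
  show "vec q \<notin> span {vec p}" by (rule el(1))
  show "vec z \<in> span {vec p, vec q}" if z: "z \<in> l"
  proof -
    have "\<epsilon> z \<in> \<epsilon> ` l" using z by blast
    then have "span {vec z} \<in> {span {x} |x. x \<in> span {vec p, vec q} \<and> x \<noteq> 0\<^sub>v}"
      unfolding el(2) eps_vec[OF P[OF z]] .
    then obtain u where u: "u \<in> span {vec p, vec q}" "span {vec z} = span {u}" by blast
    have "span {u} \<subseteq> span {vec p, vec q}" using span_span_least[of "{u}"] u sxy by simp
    then show ?thesis using u span_base[of "vec z" "{vec z}"] by blast
  qed
  show "\<exists>z\<in>l. \<exists>k\<in>carrier K. k \<noteq> \<zero> \<and> u = k \<cdot> vec z" if u: "u \<in> span {vec p, vec q}" "u \<noteq> 0\<^sub>v"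
  proof -
    have "span {u} \<in> \<epsilon> ` l" unfolding el(2) using u by blast
    then obtain z where z: "z \<in> l" "\<epsilon> z = span {u}" by auto
    have "u \<in> carrier V" using u(1) span_carrier[OF sxy] by blast
    then show ?thesis using span_singleton_eqD[of "vec z" u] z vec[OF P[OF z(1)]] u(2) by auto
  qed
qed

lemma cone_perp_iff:
  assumes "p \<in> points \<Gamma>" "q \<in> points \<Gamma>" "\<epsilon> p = span {v}" "\<epsilon> q = span {w}" "v \<in> carrier V" "w \<in> carrier V"
  shows "cone_perp v w \<longleftrightarrow> collinear \<Gamma> p q"
proof -
  have "v \<noteq> 0\<^sub>v" "w \<noteq> 0\<^sub>v" using eps_nonzero assms by blast+
  moreover have "p' = p" if "p' \<in> points \<Gamma>" "\<epsilon> p' = span {v}" for p' using that assms eps_inj by simp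
  moreover have "q' = q" if "q' \<in> points \<Gamma>" "\<epsilon> q' = span {w}" for q' using that assms eps_inj by simp
  moreover have "v \<in> cone (points \<Gamma>)" "w \<in> cone (points \<Gamma>)" using assms coneI by blast+
  ultimately show ?thesis using assms(1-4) unfolding cone_perp_def by metis
qed

lemma smult_cone: "a \<in> carrier K \<Longrightarrow> v \<in> cone S \<Longrightarrow> a \<cdot> v \<in> cone S"
  by (cases "a = \<zero>") (auto simp: cone_def span_singleton_smult)

lemma span_cone: "span (cone (points \<Gamma>)) = carrier V"
proof
  show "span (cone (points \<Gamma>)) \<subseteq> carrier V" using span_carrier cone_carrier by blast
  have "\<Union> (\<epsilon> ` points \<Gamma>) \<subseteq> span (cone (points \<Gamma>))"
  proof safe
    fix p u assume p: "p \<in> points \<Gamma>" "u \<in> \<epsilon> p"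
    then obtain v where v: "v \<in> carrier V" "\<epsilon> p = span {v}" using eps_vector by blast
    then have "{v} \<subseteq> cone (points \<Gamma>)" using p coneI by blast
    then show "u \<in> span (cone (points \<Gamma>))" using span_mono p v by blast
  qed
  then show "carrier V \<subseteq> span (cone (points \<Gamma>))"
    using span_span_least[of "\<Union> (\<epsilon> ` points \<Gamma>)" "cone (points \<Gamma>)"] cone_carrier emb
    by (simp add: embedding_def)
qed

lemma cone_perp_axioms:
  shows cone_perp_sym: "cone_perp v w \<Longrightarrow> cone_perp w v"
    and cone_perp_smult: "cone_perp u v \<Longrightarrow> a \<in> carrier K \<Longrightarrow> cone_perp u (a \<cdot> v)"
    and cone_perp_add: "cone_perp u v \<Longrightarrow> cone_perp u w \<Longrightarrow> cone_perp v w \<Longrightarrow> cone_perp u (v +\<^sub>v w)"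
    and cone_one_or_all: "u \<in> cone (points \<Gamma>) \<Longrightarrow> cone_perp v w \<Longrightarrow> \<not> cone_perp u w \<Longrightarrow>
      \<exists>k\<in>carrier K. cone_perp u (v +\<^sub>v k \<cdot> w)"
proof -
  let ?C = "cone (points \<Gamma>)"
  show sym: "cone_perp w v" if "cone_perp v w" for v w
  proof -
    have "\<exists>p\<in>points \<Gamma>. \<exists>q\<in>points \<Gamma>. \<epsilon> p = span {w} \<and> \<epsilon> q = span {v} \<and> collinear \<Gamma> p q"
      if "p \<in> points \<Gamma>" "q \<in> points \<Gamma>" "\<epsilon> p = span {v}" "\<epsilon> q = span {w}" "collinear \<Gamma> p q" for p q
      using that collinear_sym[OF that(5)] by blast
    then show ?thesis using that unfolding cone_perp_def by metis
  qed
  show smult: "cone_perp u (a \<cdot> v)" if "cone_perp u v" "a \<in> carrier K" for u v a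
  proof (cases "a = \<zero>")
    case True
    then show ?thesis using that cone_carrier[of "points \<Gamma>"] zero_cone by (auto simp: cone_perp_def)
  next
    case False
    have "v \<in> carrier V" using that cone_carrier by (auto simp: cone_perp_def)
    then have "span {a \<cdot> v} = span {v}" using span_singleton_smult that False by blast
    then show ?thesis using that smult_cone unfolding cone_perp_def by auto
  qed
  have zero: "cone_perp u 0\<^sub>v" if "u \<in> ?C" for u using that zero_cone by (simp add: cone_perp_def)
  have pts: "\<exists>p\<in>points \<Gamma>. \<exists>q\<in>points \<Gamma>. \<epsilon> p = span {v} \<and> \<epsilon> q = span {w} \<and> collinear \<Gamma> p q"
    if "cone_perp v w" "v \<noteq> 0\<^sub>v" "w \<noteq> 0\<^sub>v" for v w
    using that unfolding cone_perp_def by blast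
  have CV: "v \<in> carrier V" "w \<in> carrier V" if "cone_perp v w" for v w
    using that cone_carrier by (auto simp: cone_perp_def)
  have comb: "cone_perp u x"
    if uv: "cone_perp u v" and uw: "cone_perp u w" and vw: "cone_perp v w" and x: "x \<in> span {v, w}" for u v w x
  proof -
    have V: "u \<in> carrier V" "v \<in> carrier V" "w \<in> carrier V" using CV uv uw by blast+
    have uC: "u \<in> ?C" using uv by (simp add: cone_perp_def)
    show ?thesis
    proof (cases "v = 0\<^sub>v \<or> w = 0\<^sub>v \<or> x = 0\<^sub>v")
      case True
      then show ?thesis
      proof (elim disjE)
        assume "v = 0\<^sub>v"
        then obtain k where "k \<in> carrier K" "x = k \<cdot> w" using x V by (auto simp: span_pair)
        then show ?thesis using smult uw by simp
      next
        assume "w = 0\<^sub>v"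
        then obtain k where "k \<in> carrier K" "x = k \<cdot> v" using x V by (auto simp: span_pair)
        then show ?thesis using smult uv by simp
      next
        assume "x = 0\<^sub>v" then show ?thesis using zero uC by simp
      qed
    next
      case False
      then obtain p q where pq: "p \<in> points \<Gamma>" "q \<in> points \<Gamma>" "\<epsilon> p = span {v}" "\<epsilon> q = span {w}" "collinear \<Gamma> p q"
        using pts vw by blast
      obtain r where r: "r \<in> points \<Gamma>" "\<epsilon> r = span {x}"
        "\<And>o'. o' \<in> points \<Gamma> \<Longrightarrow> collinear \<Gamma> o' p \<Longrightarrow> collinear \<Gamma> o' q \<Longrightarrow> collinear \<Gamma> o' r"
      proof (rule eps_join[OF pq(1,2,5) V(2) pq(3) V(3) pq(4) x])
        show "x \<noteq> 0\<^sub>v" using False by blast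
      qed (rule that)
      have xV: "x \<in> carrier V" using x span_carrier[of "{v, w}"] V by auto
      have xC: "x \<in> ?C" using coneI r xV by blast
      show ?thesis
      proof (cases "u = 0\<^sub>v")
        case True then show ?thesis using zero[OF xC] sym by blast
      next
        case u0: False
        obtain o' where o': "o' \<in> points \<Gamma>" "\<epsilon> o' = span {u}" using uC u0 cone_nonzeroD by blast
        have "collinear \<Gamma> o' p" "collinear \<Gamma> o' q"
          using uv uw cone_perp_iff[OF o'(1) pq(1) o'(2) pq(3)] cone_perp_iff[OF o'(1) pq(2) o'(2) pq(4)] V by auto
        then have "collinear \<Gamma> o' r" using r o' by blast
        then show ?thesis using cone_perp_iff[OF o'(1) r(1) o'(2) r(2)] V xV by blast
      qed
    qed
  qed
  show "cone_perp u (v +\<^sub>v w)" if "cone_perp u v" "cone_perp u w" "cone_perp v w" for u v w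
  proof -
    have V: "v \<in> carrier V" "w \<in> carrier V" using CV that by blast+
    then have "v +\<^sub>v w = \<one> \<cdot> v +\<^sub>v \<one> \<cdot> w" by simp
    then have "v +\<^sub>v w \<in> span {v, w}" unfolding span_pair[OF V] by blast
    then show ?thesis using comb that by blast
  qed
  show "\<exists>k\<in>carrier K. cone_perp u (v +\<^sub>v k \<cdot> w)" if u: "u \<in> ?C" and vw: "cone_perp v w" and uw: "\<not> cone_perp u w" for u v w
  proof -
    have V: "u \<in> carrier V" "v \<in> carrier V" "w \<in> carrier V" using CV vw u cone_carrier by blast+
    have w0: "w \<noteq> 0\<^sub>v" using zero u uw by blast
    have wC: "w \<in> ?C" using vw by (simp add: cone_perp_def)
    have u0: "u \<noteq> 0\<^sub>v" using zero[OF wC] sym uw by blast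
    show ?thesis
    proof (cases "v \<in> span {w}")
      case True
      then obtain k where k: "k \<in> carrier K" "v = k \<cdot> w" using V by (auto simp: span_singleton)
      have "v +\<^sub>v (\<ominus> k) \<cdot> w = 0\<^sub>v" using k V by (simp add: smult_l_distr[symmetric] K.r_neg)
      then have "cone_perp u (v +\<^sub>v (\<ominus> k) \<cdot> w)" using zero u by simp
      then show ?thesis using k by (intro bexI[of _ "\<ominus> k"]) auto
    next
      case False
      have v0: "v \<noteq> 0\<^sub>v" using False subspD(2)[OF subsp_span[of "{w}"]] V by auto
      obtain p q where pq: "p \<in> points \<Gamma>" "q \<in> points \<Gamma>" "\<epsilon> p = span {v}" "\<epsilon> q = span {w}" "collinear \<Gamma> p q"
        using pts vw v0 w0 by blast
      have "p \<noteq> q" using pq False span_base[of v "{v}"] by auto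
      then obtain l where l: "l \<in> lines \<Gamma>" "p \<in> l" "q \<in> l" using pq by (auto simp: collinear_def)
      obtain o' where o': "o' \<in> points \<Gamma>" "\<epsilon> o' = span {u}" using u u0 cone_nonzeroD by blast
      obtain r where r: "r \<in> l" "collinear \<Gamma> o' r" using exists_on_line o' l by blast
      have "\<epsilon> r \<in> \<epsilon> ` l" using r by blast
      then have "\<epsilon> r \<in> {span {x} |x. x \<in> span {v, w} \<and> x \<noteq> 0\<^sub>v}"
        using eps_line(2)[OF l \<open>p \<noteq> q\<close> V(2) pq(3) V(3) pq(4)] by (simp only:)
      then obtain x where x: "x \<in> span {v, w}" "x \<noteq> 0\<^sub>v" "\<epsilon> r = span {x}" by blast
      then obtain a b where ab: "a \<in> carrier K" "b \<in> carrier K" "x = a \<cdot> v +\<^sub>v b \<cdot> w"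
        using span_pair V by auto
      have rP: "r \<in> points \<Gamma>" using r l lines_sub by blast
      have xV: "x \<in> carrier V" using ab V by simp
      have ux: "cone_perp u x" using cone_perp_iff[OF o'(1) rP o'(2) x(3) V(1) xV] r by blast
      have "a \<noteq> \<zero>"
      proof
        assume "a = \<zero>"
        then have "x = b \<cdot> w" "b \<noteq> \<zero>" using ab x V by auto
        then have "\<epsilon> r = \<epsilon> q" using x pq span_singleton_smult ab V by simp
        then have "r = q" using eps_inj rP pq(2) by blast
        then show False using r uw cone_perp_iff[OF o'(1) pq(2) o'(2) pq(4) V(1,3)] by blast
      qed
      then have "inv a \<cdot> x = v +\<^sub>v (inv a \<otimes> b) \<cdot> w"
        using ab V by (simp add: smult_r_distr smult_inv smult_assoc)
      moreover have "cone_perp u (inv a \<cdot> x)" using smult ux ab \<open>a \<noteq> \<zero>\<close> by simp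
      ultimately show ?thesis using ab \<open>a \<noteq> \<zero>\<close> by (intro bexI[of _ "inv a \<otimes> b"]) auto
    qed
  qed
qed

lemma cone_perp_self: "v \<in> cone (points \<Gamma>) \<Longrightarrow> cone_perp v v"
  unfolding cone_perp_def using collinear_refl cone_nonzeroD by metis

lemma cone_nondegenerate:
  assumes v: "v \<in> cone (points \<Gamma>)" "v \<noteq> 0\<^sub>v"
  shows "\<exists>w\<in>cone (points \<Gamma>). \<not> cone_perp w v"
proof -
  obtain p where p: "p \<in> points \<Gamma>" "\<epsilon> p = span {v}" using v cone_nonzeroD by blast
  obtain q where q: "q \<in> points \<Gamma>" "\<not> collinear \<Gamma> q p"
    using nondeg p by (auto simp: nondegenerate_def Rad_def perp_def)
  obtain w where w: "w \<in> carrier V" "\<epsilon> q = span {w}" using eps_vector q by blast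
  have "v \<in> carrier V" using v cone_carrier by blast
  then have "\<not> cone_perp w v" using cone_perp_iff[OF q(1) p(1) w(2) p(2) w(1)] q by blast
  then show ?thesis using coneI w q by blast
qed

lemma cone_perp_D: "cone_perp v w \<Longrightarrow> v \<in> cone (points \<Gamma>)"
  by (simp add: cone_perp_def)

sublocale polar_cone K V "cone (points \<Gamma>)" cone_perp
proof
  show "cone (points \<Gamma>) \<subseteq> carrier V" by (rule cone_carrier)
  show "0\<^sub>v \<in> cone (points \<Gamma>)" by (rule zero_cone)
  show "v \<in> cone (points \<Gamma>)" if "cone_perp v w" for v w using that by (rule cone_perp_D)
  show "cone_perp v v" if "v \<in> cone (points \<Gamma>)" for v using that by (rule cone_perp_self)
  show "cone_perp w v" if "cone_perp v w" for v w using that by (rule cone_perp_sym)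
  show "cone_perp u (a \<cdot> v)" if "cone_perp u v" "a \<in> carrier K" for u v a
    using that by (rule cone_perp_smult)
  show "cone_perp u (v +\<^sub>v w)" if "cone_perp u v" "cone_perp u w" "cone_perp v w" for u v w
    using that by (rule cone_perp_add)
  show "\<exists>k\<in>carrier K. cone_perp u (v +\<^sub>v k \<cdot> w)"
    if "u \<in> cone (points \<Gamma>)" "cone_perp v w" "\<not> cone_perp u w" for u v w
    using that by (rule cone_one_or_all)
  show "span (cone (points \<Gamma>)) = carrier V" by (rule span_cone)
  show "\<exists>w\<in>cone (points \<Gamma>). \<not> cone_perp w v" if "v \<in> cone (points \<Gamma>)" "v \<noteq> 0\<^sub>v" for v
    using that by (rule cone_nondegenerate)
qed

lemma csub_cone:
  assumes S: "geom_subspace \<Gamma> S"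
  shows "csub (cone S)"
proof -
  have SP: "S \<subseteq> points \<Gamma>" using S by (simp add: geom_subspace_def)
  show ?thesis
    unfolding csub_def
  proof (intro conjI ballI impI)
    show "cone S \<subseteq> cone (points \<Gamma>)" unfolding cone_def using SP by blast
    fix v w assume v: "v \<in> cone S" and w: "w \<in> cone S" and vw: "cone_perp v w"
    have V: "v \<in> carrier V" "w \<in> carrier V" using v w cone_carrier by auto
    show "v +\<^sub>v w \<in> cone S"
    proof (cases "v = 0\<^sub>v \<or> w = 0\<^sub>v \<or> v +\<^sub>v w = 0\<^sub>v")
      case True then show ?thesis using v w V zero_cone by auto
    next
      case False
      obtain p where p: "p \<in> S" "\<epsilon> p = span {v}" using v False cone_nonzeroD by blast
      obtain q where q: "q \<in> S" "\<epsilon> q = span {w}" using w False cone_nonzeroD by blast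
      have pq: "p \<in> points \<Gamma>" "q \<in> points \<Gamma>" using p q SP by auto
      have col: "collinear \<Gamma> p q" using cone_perp_iff[OF pq p(2) q(2) V] vw by blast
      have "v +\<^sub>v w = \<one> \<cdot> v +\<^sub>v \<one> \<cdot> w" using V by simp
      then have x: "v +\<^sub>v w \<in> span {v, w}" unfolding span_pair[OF V] by blast
      obtain r where "\<epsilon> r = span {v +\<^sub>v w}" "r \<in> S"
      proof (rule eps_join[OF pq col V(1) p(2) V(2) q(2) x])
        show "v +\<^sub>v w \<noteq> 0\<^sub>v" using False by blast
        fix r assume "\<epsilon> r = span {v +\<^sub>v w}"
          and "\<And>S. geom_subspace \<Gamma> S \<Longrightarrow> p \<in> S \<Longrightarrow> q \<in> S \<Longrightarrow> r \<in> S"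
        then show thesis using that[of r] S p(1) q(1) by simp
      qed
      then show ?thesis using coneI V by blast
    qed
  qed (use zero_cone smult_cone in auto)
qed

lemma quad_of_quadrangle:
  assumes q: "quadrangle \<Gamma> a b c d" and S: "{a, b, c, d} \<subseteq> S" "S \<subseteq> points \<Gamma>"
  shows "\<exists>a b c d. quad a b c d \<and> {a, b, c, d} \<subseteq> cone S"
proof -
  have P: "a \<in> points \<Gamma>" "b \<in> points \<Gamma>" "c \<in> points \<Gamma>" "d \<in> points \<Gamma>" using S by auto
  obtain a' b' c' d' where v: "a' \<in> carrier V" "\<epsilon> a = span {a'}" "b' \<in> carrier V" "\<epsilon> b = span {b'}"
    "c' \<in> carrier V" "\<epsilon> c = span {c'}" "d' \<in> carrier V" "\<epsilon> d = span {d'}"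
    using eps_vector P by metis
  have "quad a' b' c' d'"
    unfolding quad_def
    using q v P cone_perp_iff[of a b a' b'] cone_perp_iff[of b c b' c'] cone_perp_iff[of c d c' d']
      cone_perp_iff[of d a d' a'] cone_perp_iff[of a c a' c'] cone_perp_iff[of b d b' d']
    by (auto simp: quadrangle_def intro: coneI)
  then show ?thesis using v S coneI by blast
qed

lemma cone_iff_point:
  assumes "S \<subseteq> points \<Gamma>" "p \<in> points \<Gamma>" "\<epsilon> p = span {v}" "v \<in> carrier V"
  shows "v \<in> cone S \<longleftrightarrow> p \<in> S"
  using assms eps_nonzero[of p v] eps_inj coneI by (metis cone_nonzeroD subsetD)

end

section \<open>Embeddings from families of vectors\<close>

context left_vector_space
begin

lemma left_vector_space_subspace:
  assumes U: "subsp U"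
  shows "left_vector_space K (V\<lparr>carrier := U\<rparr>)"
    and lin_span_subspace: "A \<subseteq> U \<Longrightarrow> lin_span K (V\<lparr>carrier := U\<rparr>) A = span A"
proof -
  let ?U = "V\<lparr>carrier := U\<rparr>"
  note u = subspD[OF U]
  have UV: "x \<in> U \<Longrightarrow> x \<in> carrier V" for x using u(1) by blast
  have "abelian_group ?U"
  proof (rule abelian_groupI)
    fix x assume x: "x \<in> carrier ?U"
    then have "(\<ominus> \<one>) \<cdot> x \<in> U" using u(4) by simp
    moreover have "(\<ominus> \<one>) \<cdot> x +\<^sub>v x = 0\<^sub>v" using x UV minus_smult[of x] V.l_neg[of x] by simp
    ultimately show "\<exists>y\<in>carrier ?U. y \<oplus>\<^bsub>?U\<^esub> x = \<zero>\<^bsub>?U\<^esub>" by auto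
  qed (use u UV in \<open>auto simp: V.a_ac\<close>)
  then show lv: "left_vector_space K ?U"
    by (intro left_vector_space.intro left_vector_space_axioms.intro)
       (use u UV skew_field_axioms in \<open>auto simp: smult_l_distr smult_r_distr smult_assoc\<close>)
  interpret B: left_vector_space K ?U by (rule lv)
  have iff: "B.subsp W \<longleftrightarrow> subsp W \<and> W \<subseteq> U" for W
    unfolding B.subsp_iff subsp_iff using u(1) by auto
  show "lin_span K ?U A = span A" if A: "A \<subseteq> U"
  proof
    have "span A \<subseteq> U" using span_least A U by blast
    then show "B.span A \<subseteq> span A" using B.span_least[of A "span A"] iff subsp_span span_superset A u(1) by blast
    have "B.subsp (B.span A)" using B.subsp_span A by simp
    then show "span A \<subseteq> B.span A" using span_least[of A "B.span A"] iff B.span_superset by blast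
  qed
qed

text \<open>
  The space is cut down to the span of the given vectors, which makes the spanning condition automatic. It
  remains to check that the points are distinct and that lines go onto full lines.\<close>

lemma embedding_from_vectors:
  assumes w: "\<And>p. p \<in> points \<Gamma> \<Longrightarrow> w p \<in> carrier V \<and> w p \<noteq> 0\<^sub>v"
    and inj: "\<And>p q. p \<in> points \<Gamma> \<Longrightarrow> q \<in> points \<Gamma> \<Longrightarrow> w q \<in> span {w p} \<Longrightarrow> p = q"
    and lin: "\<And>l. l \<in> lines \<Gamma> \<Longrightarrow> l \<subseteq> points \<Gamma>"
    and line: "\<And>l. l \<in> lines \<Gamma> \<Longrightarrow> \<exists>p\<in>l. \<exists>q\<in>l. p \<noteq> q \<and> (\<forall>z\<in>l. w z \<in> span {w p, w q}) \<and>
      (\<forall>v\<in>span {w p, w q}. v \<noteq> 0\<^sub>v \<longrightarrow> (\<exists>z\<in>l. v \<in> span {w z}))"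
  shows "embedding \<Gamma> K (V\<lparr>carrier := span (w ` points \<Gamma>)\<rparr>) (\<lambda>p. span {w p})"
proof -
  let ?U = "span (w ` points \<Gamma>)"
  let ?M = "V\<lparr>carrier := ?U\<rparr>"
  have wV: "w ` points \<Gamma> \<subseteq> carrier V" using w by blast
  have U: "subsp ?U" using subsp_span wV by blast
  have wU: "w p \<in> ?U" if "p \<in> points \<Gamma>" for p using span_base that by blast
  have UV: "?U \<subseteq> carrier V" using subspD(1)[OF U] .
  note M = left_vector_space_subspace[OF U] and sp = lin_span_subspace[OF U]
  have sp1: "lin_span K ?M {v} = span {v}" if "v \<in> ?U" for v using sp that by simp
  have pts: "pg_points K ?M = {span {v} |v. v \<in> ?U \<and> v \<noteq> 0\<^sub>v}"
    unfolding pg_points_def using sp1 by auto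
  have ptsD: "span {w p} \<in> pg_points K ?M" if "p \<in> points \<Gamma>" for p
    using wU w that unfolding pts by blast
  show ?thesis
    unfolding embedding_def
  proof (intro conjI ballI)
    show "left_vector_space K ?M" by (rule M)
    show "inj_on (\<lambda>p. span {w p}) (points \<Gamma>)"
    proof (rule inj_onI)
      fix p q assume "p \<in> points \<Gamma>" "q \<in> points \<Gamma>" "span {w p} = span {w q}"
      then show "p = q" using inj[of p q] span_base[of "w q" "{w q}"] by auto
    qed
    show "(\<lambda>p. span {w p}) ` points \<Gamma> \<subseteq> pg_points K ?M" using ptsD by blast
    have sub: "\<Union> ((\<lambda>p. span {w p}) ` points \<Gamma>) \<subseteq> ?U"
      using span_least[OF _ U] wU by (intro UN_least) auto
    have "w ` points \<Gamma> \<subseteq> \<Union> ((\<lambda>p. span {w p}) ` points \<Gamma>)" using span_base by fastforce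
    then have "?U \<subseteq> span (\<Union> ((\<lambda>p. span {w p}) ` points \<Gamma>))" by (rule span_mono)
    moreover have "span (\<Union> ((\<lambda>p. span {w p}) ` points \<Gamma>)) \<subseteq> ?U" using span_least sub U by blast
    ultimately show "lin_span K ?M (\<Union> ((\<lambda>p. span {w p}) ` points \<Gamma>)) = carrier ?M" using sp[OF sub] by simp
  next
    fix l assume l: "l \<in> lines \<Gamma>"
    then obtain p q where pq: "p \<in> l" "q \<in> l" "p \<noteq> q" and a: "\<And>z. z \<in> l \<Longrightarrow> w z \<in> span {w p, w q}"
      and b: "\<And>v. v \<in> span {w p, w q} \<Longrightarrow> v \<noteq> 0\<^sub>v \<Longrightarrow> \<exists>z\<in>l. v \<in> span {w z}" using line by metis
    have lP: "l \<subseteq> points \<Gamma>" using lin l by blast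
    have pqP: "p \<in> points \<Gamma>" "q \<in> points \<Gamma>" using pq lP by auto
    have pqV: "{w p, w q} \<subseteq> carrier V" using w pqP by blast
    let ?P = "span {w p}" and ?Q = "span {w q}"
    have PQU: "?P \<union> ?Q \<subseteq> ?U" using span_least[OF _ U] wU pqP by simp
    have PQ: "lin_span K ?M (?P \<union> ?Q) = span {w p, w q}"
    proof -
      have "?P \<union> ?Q \<subseteq> span {w p, w q}" using span_mono[of "{w p}" "{w p, w q}"] span_mono[of "{w q}" "{w p, w q}"] by auto
      then have "span (?P \<union> ?Q) \<subseteq> span {w p, w q}" using span_span_least pqV by blast
      moreover have "{w p, w q} \<subseteq> ?P \<union> ?Q" using span_base[of "w p" "{w p}"] span_base[of "w q" "{w q}"] by auto
      ultimately show ?thesis using sp[OF PQU] span_mono[of "{w p, w q}" "?P \<union> ?Q"] by blast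
    qed
    have "(\<lambda>p. span {w p}) ` l = {r \<in> pg_points K ?M. r \<subseteq> lin_span K ?M (?P \<union> ?Q)}"
    proof (intro equalityI subsetI)
      fix r assume "r \<in> (\<lambda>p. span {w p}) ` l"
      then obtain z where z: "z \<in> l" "r = span {w z}" by blast
      have "r \<subseteq> span {w p, w q}" using span_span_least[of "{w z}"] a z pqV by simp
      then show "r \<in> {r \<in> pg_points K ?M. r \<subseteq> lin_span K ?M (?P \<union> ?Q)}" using PQ ptsD z lP by auto
    next
      fix r assume "r \<in> {r \<in> pg_points K ?M. r \<subseteq> lin_span K ?M (?P \<union> ?Q)}"
      then obtain v where v: "r = span {v}" "v \<in> ?U" "v \<noteq> 0\<^sub>v" "span {v} \<subseteq> span {w p, w q}" using pts PQ by auto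
      then obtain z where z: "z \<in> l" "v \<in> span {w z}" using b span_base[of v "{v}"] by blast
      have "span {v} = span {w z}" using span_singleton_absorb z v w lP by blast
      then show "r \<in> (\<lambda>p. span {w p}) ` l" using z v by blast
    qed
    moreover have "?P \<noteq> ?Q" using inj[OF pqP] pq span_base[of "w q" "{w q}"] by auto
    ultimately show "(\<lambda>p. span {w p}) ` l \<in> pg_lines K ?M"
      unfolding pg_lines_def using ptsD pqP by blast
  qed
qed

end

section \<open>The dual embedding and its sesquilinear form\<close>

definition opposite :: "'k ring \<Rightarrow> 'k ring" where
  "opposite K = K\<lparr>mult := \<lambda>a b. b \<otimes>\<^bsub>K\<^esub> a\<rparr>"

lemma opposite_simps [simp]:
  "carrier (opposite K) = carrier K" "one (opposite K) = one K" "zero (opposite K) = zero K"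
  "add (opposite K) = add K" "a \<otimes>\<^bsub>opposite K\<^esub> b = b \<otimes>\<^bsub>K\<^esub> a"
  by (simp_all add: opposite_def)

context left_vector_space
begin

lemma skew_field_opposite: "skew_field (opposite K)"
proof (rule skew_fieldI)
  have ab: "abelian_group (opposite K)"
  proof (rule abelian_groupI)
    fix x assume "x \<in> carrier (opposite K)"
    then show "\<exists>y\<in>carrier (opposite K). y \<oplus>\<^bsub>opposite K\<^esub> x = \<zero>\<^bsub>opposite K\<^esub>"
      by (intro bexI[of _ "\<ominus> x"]) (auto simp: K.l_neg)
  qed (auto simp: K.a_ac)
  have mon: "monoid (opposite K)" by (rule monoidI) (auto simp: K.m_assoc)
  show "ring (opposite K)" by (rule ringI[OF ab mon]) (auto simp: K.l_distr K.r_distr)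
  show "\<one>\<^bsub>opposite K\<^esub> \<noteq> \<zero>\<^bsub>opposite K\<^esub>" using one_neq_zero by simp
  fix a assume "a \<in> carrier (opposite K)" "a \<noteq> \<zero>\<^bsub>opposite K\<^esub>"
  then show "\<exists>b\<in>carrier (opposite K). b \<otimes>\<^bsub>opposite K\<^esub> a = \<one>\<^bsub>opposite K\<^esub> \<and>
    a \<otimes>\<^bsub>opposite K\<^esub> b = \<one>\<^bsub>opposite K\<^esub>"
    by (intro bexI[of _ "inv a"]) auto
qed

text \<open>
  Scalars multiply the values of a functional from the right, since they act on \<open>V\<close> from the left. So
  functionals form a left vector space over the opposite division ring.\<close>

definition dual :: "('k, 'v \<Rightarrow> 'k) module" where
  "dual = \<lparr>carrier = {\<psi>. functional \<psi>}, mult = undefined, one = undefined,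
     zero = \<lambda>v\<in>carrier V. \<zero>, add = \<lambda>\<phi> \<psi>. \<lambda>v\<in>carrier V. \<phi> v \<oplus> \<psi> v,
     smult = \<lambda>k \<phi>. \<lambda>v\<in>carrier V. \<phi> v \<otimes> k\<rparr>"

lemma dual_simps [simp]:
  "carrier dual = {\<psi>. functional \<psi>}" "\<zero>\<^bsub>dual\<^esub> = (\<lambda>v\<in>carrier V. \<zero>)"
  "\<phi> \<oplus>\<^bsub>dual\<^esub> \<psi> = (\<lambda>v\<in>carrier V. \<phi> v \<oplus> \<psi> v)" "k \<odot>\<^bsub>dual\<^esub> \<phi> = (\<lambda>v\<in>carrier V. \<phi> v \<otimes> k)"
  by (simp_all add: dual_def)

lemma functional_eqI:
  "functional \<phi> \<Longrightarrow> functional \<psi> \<Longrightarrow> (\<And>v. v \<in> carrier V \<Longrightarrow> \<phi> v = \<psi> v) \<Longrightarrow> \<phi> = \<psi>"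
  by (rule extensionalityI[OF functionalD(4) functionalD(4)])

lemma functional_add: "functional \<phi> \<Longrightarrow> functional \<psi> \<Longrightarrow> functional (\<lambda>v\<in>carrier V. \<phi> v \<oplus> \<psi> v)"
  unfolding functional_def[of "restrict _ _"]
  using functionalD(1-3)[of \<phi>] functionalD(1-3)[of \<psi>] by (auto simp: K.r_distr K.a_ac)

lemma functional_smult: "functional \<phi> \<Longrightarrow> k \<in> carrier K \<Longrightarrow> functional (\<lambda>v\<in>carrier V. \<phi> v \<otimes> k)"
  unfolding functional_def[of "restrict _ _"]
  using functionalD(1-3)[of \<phi>] by (auto simp: K.l_distr K.m_assoc)

lemma functional_zero_map: "functional (\<lambda>v\<in>carrier V. \<zero>)"
  unfolding functional_def by auto

lemma left_vector_space_dual: "left_vector_space (opposite K) dual"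
proof -
  have "abelian_group dual"
  proof (rule abelian_groupI)
    fix \<psi> assume "\<psi> \<in> carrier dual"
    then have f: "functional \<psi>" by simp
    have "(\<lambda>v\<in>carrier V. \<psi> v \<otimes> (\<ominus> \<one>)) \<oplus>\<^bsub>dual\<^esub> \<psi> = \<zero>\<^bsub>dual\<^esub>"
      using functionalD(1)[OF f] by (auto simp: K.r_minus K.l_neg intro!: restrict_ext)
    then show "\<exists>y\<in>carrier dual. y \<oplus>\<^bsub>dual\<^esub> \<psi> = \<zero>\<^bsub>dual\<^esub>"
      using functional_smult[OF f, of "\<ominus> \<one>"] by (intro bexI) auto
  next
    fix \<phi> assume "\<phi> \<in> carrier dual"
    then have f: "functional \<phi>" by simp
    show "\<zero>\<^bsub>dual\<^esub> \<oplus>\<^bsub>dual\<^esub> \<phi> = \<phi>"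
      using functional_eqI[OF functional_add[OF functional_zero_map f] f] functionalD(1)[OF f] by simp
  next
    fix x y z assume "x \<in> carrier dual" "y \<in> carrier dual" "z \<in> carrier dual"
    then have f: "functional x" "functional y" "functional z" by auto
    note m = functionalD(1)[OF f(1)] functionalD(1)[OF f(2)] functionalD(1)[OF f(3)]
    show "(x \<oplus>\<^bsub>dual\<^esub> y) \<oplus>\<^bsub>dual\<^esub> z = x \<oplus>\<^bsub>dual\<^esub> (y \<oplus>\<^bsub>dual\<^esub> z)"
      by (auto simp: m K.a_assoc intro!: restrict_ext)
  next
    fix x y assume "x \<in> carrier dual" "y \<in> carrier dual"
    then have f: "functional x" "functional y" by auto
    note m = functionalD(1)[OF f(1)] functionalD(1)[OF f(2)]
    show "x \<oplus>\<^bsub>dual\<^esub> y = y \<oplus>\<^bsub>dual\<^esub> x" by (auto simp: m K.a_comm intro!: restrict_ext)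
    show "x \<oplus>\<^bsub>dual\<^esub> y \<in> carrier dual" using functional_add f by simp
  qed (simp add: functional_zero_map)
  then show ?thesis
  proof (intro left_vector_space.intro left_vector_space_axioms.intro skew_field_opposite)
    fix \<phi> assume "\<phi> \<in> carrier dual"
    then have f: "functional \<phi>" by simp
    show "\<one>\<^bsub>opposite K\<^esub> \<odot>\<^bsub>dual\<^esub> \<phi> = \<phi>"
      using functional_eqI[OF functional_smult[OF f K.one_closed] f] functionalD(1)[OF f] by simp
  next
    fix a b x assume "a \<in> carrier (opposite K)" "b \<in> carrier (opposite K)" "x \<in> carrier dual"
    then have a: "a \<in> carrier K" "b \<in> carrier K" and f: "functional x" by auto
    note m = functionalD(1)[OF f]
    show "(a \<oplus>\<^bsub>opposite K\<^esub> b) \<odot>\<^bsub>dual\<^esub> x = a \<odot>\<^bsub>dual\<^esub> x \<oplus>\<^bsub>dual\<^esub> b \<odot>\<^bsub>dual\<^esub> x"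
      "(a \<otimes>\<^bsub>opposite K\<^esub> b) \<odot>\<^bsub>dual\<^esub> x = a \<odot>\<^bsub>dual\<^esub> (b \<odot>\<^bsub>dual\<^esub> x)"
      using a by (auto simp: m K.r_distr K.m_assoc intro!: restrict_ext)
  next
    fix a x y assume "a \<in> carrier (opposite K)" "x \<in> carrier dual" "y \<in> carrier dual"
    then have a: "a \<in> carrier K" and f: "functional x" "functional y" by auto
    note m = functionalD(1)[OF f(1)] functionalD(1)[OF f(2)]
    show "a \<odot>\<^bsub>dual\<^esub> (x \<oplus>\<^bsub>dual\<^esub> y) = a \<odot>\<^bsub>dual\<^esub> x \<oplus>\<^bsub>dual\<^esub> a \<odot>\<^bsub>dual\<^esub> y"
      using a by (auto simp: m K.l_distr intro!: restrict_ext)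
  next
    fix a x assume "a \<in> carrier (opposite K)" "x \<in> carrier dual"
    then show "a \<odot>\<^bsub>dual\<^esub> x \<in> carrier dual" using functional_smult by simp
  qed
qed

end

locale embedded_polar_space_with_quadrangle = embedded_polar_space +
  assumes quadrangle_exists: "\<exists>a b c d. quadrangle \<Gamma> a b c d"
begin

sublocale polar_cone_with_quadrangle K V "cone (points \<Gamma>)" cone_perp
proof
  obtain a b c d where q: "quadrangle \<Gamma> a b c d" using quadrangle_exists by blast
  then have "{a, b, c, d} \<subseteq> points \<Gamma>" by (simp add: quadrangle_def)
  from quad_of_quadrangle[OF q this subset_refl] show "\<exists>a b c d. quad a b c d" by auto
qed

lemma two_points_on_line: "l \<in> lines \<Gamma> \<Longrightarrow> \<exists>p\<in>l. \<exists>q\<in>l. p \<noteq> q"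
proof -
  assume l: "l \<in> lines \<Gamma>"
  then have "\<epsilon> ` l \<in> pg_lines K V" using emb by (simp add: embedding_def)
  then obtain P Q where PQ: "P \<in> pg_points K V" "Q \<in> pg_points K V" "P \<noteq> Q"
    and leq: "\<epsilon> ` l = {R \<in> pg_points K V. R \<subseteq> span (P \<union> Q)}"
    by (auto simp: pg_lines_def)
  have "P \<in> \<epsilon> ` l" "Q \<in> \<epsilon> ` l" using leq PQ span_superset[of "P \<union> Q"] by auto
  then obtain p q where pq: "p \<in> l" "P = \<epsilon> p" "q \<in> l" "Q = \<epsilon> q" by blast
  then have "p \<noteq> q" using PQ(3) by auto
  then show ?thesis using pq by blast
qed

text \<open>
  The map is injective by \<open>separate\<close>, and lines go onto full lines by \<open>tangent_in_pencil\<close> and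
  \<open>pencil_is_tangent\<close>.\<close>

lemma dual_embedding:
  "embedding \<Gamma> (opposite K) (dual\<lparr>carrier := lin_span (opposite K) dual ((\<lambda>p. tangent (vec p)) ` points \<Gamma>)\<rparr>)
    (\<lambda>p. lin_span (opposite K) dual {tangent (vec p)})"
proof -
  interpret D: left_vector_space "opposite K" dual by (rule left_vector_space_dual)
  let ?w = "\<lambda>p. tangent (vec p)"
  have f: "functional (?w p)" if "p \<in> points \<Gamma>" for p
    using functional_tangent vec that by blast
  note fD = functionalD[OF f]
  have perp: "?w p v = \<zero> \<longleftrightarrow> cone_perp v (vec p)" if "p \<in> points \<Gamma>" "v \<in> cone (points \<Gamma>)" for p v
    using tangent_eq_zero_iff_perp vec that by blast
  have Dsingle: "\<psi> \<in> D.span {?w p} \<longleftrightarrow> (\<exists>k\<in>carrier K. \<psi> = (\<lambda>v\<in>carrier V. ?w p v \<otimes> k))"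
    if "p \<in> points \<Gamma>" for p \<psi>
    using D.span_singleton[of "?w p"] f[OF that] by auto
  have Dpair: "\<psi> \<in> D.span {?w p, ?w q} \<longleftrightarrow>
      (\<exists>m\<in>carrier K. \<exists>n\<in>carrier K. \<psi> = (\<lambda>v\<in>carrier V. ?w p v \<otimes> m \<oplus> ?w q v \<otimes> n))"
    if "p \<in> points \<Gamma>" "q \<in> points \<Gamma>" for p q \<psi>
  proof -
    have "m \<odot>\<^bsub>dual\<^esub> ?w p \<oplus>\<^bsub>dual\<^esub> n \<odot>\<^bsub>dual\<^esub> ?w q = (\<lambda>v\<in>carrier V. ?w p v \<otimes> m \<oplus> ?w q v \<otimes> n)" for m n
      by (auto intro!: restrict_ext)
    then show ?thesis using D.span_pair[of "?w p" "?w q"] f[OF that(1)] f[OF that(2)] by auto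
  qed
  show ?thesis
  proof (rule D.embedding_from_vectors)
    fix p assume p: "p \<in> points \<Gamma>"
    obtain c where c: "c \<in> cone (points \<Gamma>)" "\<not> cone_perp c (vec p)"
      using nondegenerate_C vec p by blast
    then have "?w p c \<noteq> \<zero>" using perp p by blast
    then have "?w p \<noteq> \<zero>\<^bsub>dual\<^esub>" using c by auto
    then show "?w p \<in> carrier dual \<and> ?w p \<noteq> \<zero>\<^bsub>dual\<^esub>" using f[OF p] by simp
  next
    fix p q assume pq: "p \<in> points \<Gamma>" "q \<in> points \<Gamma>" "?w q \<in> D.span {?w p}"
    then obtain k where k: "k \<in> carrier K" "?w q = (\<lambda>v\<in>carrier V. ?w p v \<otimes> k)" using Dsingle by blast
    have "cone_perp v (vec q)" if v: "cone_perp v (vec p)" for v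
    proof -
      have vC: "v \<in> cone (points \<Gamma>)" using v perp_D by blast
      then have "?w q v = \<zero>" using k perp[OF pq(1) vC] v by simp
      then show ?thesis using perp[OF pq(2) vC] by blast
    qed
    then have "vec q \<in> span {vec p}" using separate[OF vec_cone[OF pq(1)] vec_cone[OF pq(2)]] by blast
    then have "span {vec q} = span {vec p}" using span_singleton_absorb vec pq by blast
    then show "p = q" using eps_inj pq eps_vec by simp
  next
    fix l assume "l \<in> lines \<Gamma>" then show "l \<subseteq> points \<Gamma>" by (rule lines_sub)
  next
    fix l assume l: "l \<in> lines \<Gamma>"
    obtain p q where pq: "p \<in> l" "q \<in> l" "p \<noteq> q" using two_points_on_line[OF l] by blast
    have P: "p \<in> points \<Gamma>" "q \<in> points \<Gamma>" using pq l lines_sub by blast+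
    let ?x = "vec p" and ?y = "vec q"
    note x = vec[OF P(1)] and y = vec[OF P(2)]
    note ind = vec_line_independent[OF l pq]
    have xy: "cone_perp ?x ?y"
      using cone_perp_iff[OF P x(3) y(3) x(1) y(1)] line_collinear[OF l pq(1,2)] by blast
    have A: "?w z \<in> D.span {?w p, ?w q}" if z: "z \<in> l" for z
    proof -
      have zP: "z \<in> points \<Gamma>" using z l lines_sub by blast
      obtain a b where ab: "a \<in> carrier K" "b \<in> carrier K" "vec z = a \<cdot> ?x +\<^sub>v b \<cdot> ?y"
        using vec_in_line_span[OF l pq z] span_pair x y by auto
      obtain m n where mn: "m \<in> carrier K" "n \<in> carrier K"
        "\<forall>v\<in>carrier V. ?w z v = ?w p v \<otimes> m \<oplus> ?w q v \<otimes> n"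
        using tangent_in_pencil[OF x(4,2) y(4) ind xy ab vec_nonzero[OF zP]] by blast
      have "?w z = (\<lambda>v\<in>carrier V. ?w p v \<otimes> m \<oplus> ?w q v \<otimes> n)"
        using mn by (intro functional_eqI f zP functional_comb P) auto
      then show ?thesis using Dpair[OF P] mn by blast
    qed
    have B: "\<exists>z\<in>l. \<psi> \<in> D.span {?w z}" if psi: "\<psi> \<in> D.span {?w p, ?w q}" "\<psi> \<noteq> \<zero>\<^bsub>dual\<^esub>" for \<psi>
    proof -
      obtain m n where mn: "m \<in> carrier K" "n \<in> carrier K"
        "\<psi> = (\<lambda>v\<in>carrier V. ?w p v \<otimes> m \<oplus> ?w q v \<otimes> n)"
        using psi(1) Dpair[OF P] by blast
      have "m \<noteq> \<zero> \<or> n \<noteq> \<zero>"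
      proof (rule ccontr)
        assume "\<not> ?thesis"
        then have "\<psi> = \<zero>\<^bsub>dual\<^esub>" using mn(3) fD(1)[OF P(1)] fD(1)[OF P(2)] by (auto intro!: restrict_ext)
        then show False using psi(2) by blast
      qed
      then obtain z0 k where z0: "z0 \<in> span {?x, ?y}" "z0 \<noteq> 0\<^sub>v" and k: "k \<in> carrier K"
        "\<forall>v\<in>carrier V. ?w p v \<otimes> m \<oplus> ?w q v \<otimes> n = tangent z0 v \<otimes> k"
        using pencil_is_tangent[OF x(4,2) y(4) ind xy mn(1,2)] by blast
      obtain z c where z: "z \<in> l" and c: "c \<in> carrier K" "c \<noteq> \<zero>" "z0 = c \<cdot> vec z"
        using line_point_of_vector[OF l pq z0] by blast
      have zP: "z \<in> points \<Gamma>" using z l lines_sub by blast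
      obtain r where r: "r \<in> carrier K" "\<forall>v\<in>carrier V. tangent z0 v = ?w z v \<otimes> r"
        using pencil_multiple[OF vec_cone[OF zP] vec_nonzero[OF zP] c(1,2)] c(3) by blast
      have "\<psi> = (\<lambda>v\<in>carrier V. ?w z v \<otimes> (r \<otimes> k))"
        unfolding mn(3) using k r fD(1)[OF zP] by (auto simp: K.m_assoc intro!: restrict_ext)
      then show ?thesis using Dsingle[OF zP] z r k by blast
    qed
    show "\<exists>p\<in>l. \<exists>q\<in>l. p \<noteq> q \<and> (\<forall>z\<in>l. ?w z \<in> D.span {?w p, ?w q}) \<and>
      (\<forall>v\<in>D.span {?w p, ?w q}. v \<noteq> \<zero>\<^bsub>dual\<^esub> \<longrightarrow> (\<exists>z\<in>l. v \<in> D.span {?w z}))"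
      using pq A B by blast
  qed
qed

end

text \<open>
  The form represents orthogonality on \<open>C\<close>. Its symmetry on all of \<open>V\<close> is derived from that of
  orthogonality below.\<close>

locale sesquilinear_cone = polar_cone_with_quadrangle +
  fixes \<beta> and \<sigma>
  assumes form_closed: "v \<in> carrier V \<Longrightarrow> w \<in> carrier V \<Longrightarrow> \<beta> v w \<in> carrier K"
    and form_add_l: "u \<in> carrier V \<Longrightarrow> v \<in> carrier V \<Longrightarrow> w \<in> carrier V \<Longrightarrow> \<beta> (u +\<^sub>v v) w = \<beta> u w \<oplus> \<beta> v w"
    and form_smult_l: "a \<in> carrier K \<Longrightarrow> v \<in> carrier V \<Longrightarrow> w \<in> carrier V \<Longrightarrow> \<beta> (a \<cdot> v) w = a \<otimes> \<beta> v w"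
    and form_add_r: "u \<in> carrier V \<Longrightarrow> v \<in> carrier V \<Longrightarrow> w \<in> carrier V \<Longrightarrow> \<beta> u (v +\<^sub>v w) = \<beta> u v \<oplus> \<beta> u w"
    and form_smult_r: "a \<in> carrier K \<Longrightarrow> v \<in> carrier V \<Longrightarrow> w \<in> carrier V \<Longrightarrow> \<beta> v (a \<cdot> w) = \<beta> v w \<otimes> \<sigma> a"
    and form_perp: "v \<in> C \<Longrightarrow> w \<in> C \<Longrightarrow> \<beta> v w = \<zero> \<longleftrightarrow> v \<bottom> w"
    and sigma_bij: "bij_betw \<sigma> (carrier K) (carrier K)"
    and sigma_add: "a \<in> carrier K \<Longrightarrow> b \<in> carrier K \<Longrightarrow> \<sigma> (a \<oplus> b) = \<sigma> a \<oplus> \<sigma> b"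
    and sigma_mult: "a \<in> carrier K \<Longrightarrow> b \<in> carrier K \<Longrightarrow> \<sigma> (a \<otimes> b) = \<sigma> b \<otimes> \<sigma> a"
    and sigma_one: "\<sigma> \<one> = \<one>"

context embedded_polar_space_with_quadrangle
begin

text \<open>
  A semilinear map from \<open>V\<close> to its dual over the opposite division ring is the same as a sesquilinear form. The
  morphism from the universal to the dual embedding takes \<open>w \<in> C\<close> to a non-zero multiple of its tangent
  functional, so that the form vanishes on \<open>v\<close> and \<open>w\<close> if and only if \<open>v \<bottom> w\<close>.\<close>

theorem universal_form:
  assumes univ: "absolutely_universal \<Gamma> K V \<epsilon>"
  shows "\<exists>\<beta> \<sigma>. sesquilinear_cone K V (cone (points \<Gamma>)) cone_perp \<beta> \<sigma>"
proof -
  interpret D: left_vector_space "opposite K" dual by (rule left_vector_space_dual)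
  let ?w = "\<lambda>p. tangent (vec p)"
  let ?M = "dual\<lparr>carrier := D.span (?w ` points \<Gamma>)\<rparr>"
  obtain a b c d where q: "quadrangle \<Gamma> a b c d" using quadrangle_exists by blast
  then obtain l where l: "l \<in> lines \<Gamma>"
    by (auto simp: quadrangle_def collinear_def)
  have "morphism \<Gamma> K V \<epsilon> (opposite K) ?M (\<lambda>p. D.span {?w p})"
    using universal_morphism[OF univ dual_embedding l] lines_sub by blast
  then obtain f where f: "semilinear K V (opposite K) ?M f"
    and fe: "\<And>p. p \<in> points \<Gamma> \<Longrightarrow> f ` \<epsilon> p = D.span {?w p}"
    by (auto simp: morphism_def)
  obtain \<sigma> where s: "\<sigma> \<in> ring_iso K (opposite K)"
    and fs: "\<And>a x. a \<in> carrier K \<Longrightarrow> x \<in> carrier V \<Longrightarrow> f (a \<cdot> x) = \<sigma> a \<odot>\<^bsub>dual\<^esub> f x"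
    using f by (auto simp: semilinear_def)
  have wV: "?w ` points \<Gamma> \<subseteq> carrier dual" using functional_tangent vec by auto
  have fV: "functional (f w)" if "w \<in> carrier V" for w
  proof -
    have "f w \<in> D.span (?w ` points \<Gamma>)" using semilinearD(1)[OF f] that by auto
    then show ?thesis using D.span_carrier[OF wV] by auto
  qed
  have fa: "f (v +\<^sub>v w) = f v \<oplus>\<^bsub>dual\<^esub> f w" if "v \<in> carrier V" "w \<in> carrier V" for v w
    using semilinearD(2)[OF f that] by simp
  have perp: "f w v = \<zero> \<longleftrightarrow> cone_perp v w" if v: "v \<in> cone (points \<Gamma>)" and w: "w \<in> cone (points \<Gamma>)" for v w
  proof (cases "w = 0\<^sub>v")
    case True
    have "f (\<zero> \<cdot> 0\<^sub>v) v = (\<sigma> \<zero> \<odot>\<^bsub>dual\<^esub> f 0\<^sub>v) v"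
      using fun_cong[OF fs[OF K.zero_closed V.zero_closed], of v] by simp
    then have "f 0\<^sub>v v = f 0\<^sub>v v \<otimes> \<sigma> \<zero>" using v by (simp del: dual_simps add: dual_simps(4))
    moreover have "\<sigma> \<zero> = \<zero>"
    proof -
      have "\<sigma> \<zero> \<oplus> \<sigma> \<zero> = \<sigma> \<zero>" using ring_iso_memE(3)[OF s, of \<zero> \<zero>] by simp
      then show ?thesis using ring_iso_memE(1)[OF s, of \<zero>] by (metis K.zero_closed K.add.r_cancel_one opposite_simps(1))
    qed
    ultimately have "f 0\<^sub>v v = \<zero>" using functionalD(1)[OF fV[OF V.zero_closed]] v by simp
    then show ?thesis using True v by simp
  next
    case False
    have wc: "w \<in> carrier V" using w by blast
    obtain p where p: "p \<in> points \<Gamma>" "\<epsilon> p = span {w}" using cone_nonzeroD[OF w False] by blast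
    note pv = vec[OF p(1)]
    have im: "f ` span {w} = D.span {?w p}" using fe p by metis
    have ft: "functional (?w p)" using functional_tangent pv by blast
    have "f w \<in> D.span {?w p}" using im span_base[of w "{w}"] by blast
    then obtain k where k: "k \<in> carrier K" "f w = (\<lambda>v\<in>carrier V. ?w p v \<otimes> k)"
      using D.span_singleton[of "?w p"] ft by auto
    have "?w p \<in> f ` span {w}" using im D.span_base[of "?w p" "{?w p}"] by simp
    then obtain c where c: "c \<in> carrier K" "?w p = f (c \<cdot> w)" using span_singleton[OF wc] by auto
    have k0: "k \<noteq> \<zero>"
    proof
      assume k0: "k = \<zero>"
      obtain u where u: "u \<in> cone (points \<Gamma>)" "\<not> cone_perp u (vec p)" using nondegenerate_C pv by blast
      have "?w p u = f w u \<otimes> \<sigma> c" using fs[OF c(1) wc] c(2) u by simp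
      also have "f w u = \<zero>" using k k0 u functionalD(1)[OF ft] by simp
      finally have "?w p u = \<zero>" using ring_iso_memE(1)[OF s c(1)] by simp
      then show False using tangent_eq_zero_iff_perp[OF pv(4,2) u(1)] u(2) by blast
    qed
    have "f w v = \<zero> \<longleftrightarrow> ?w p v = \<zero>"
      using k k0 v functionalD(1)[OF ft] K_integral by auto
    also have "\<dots> \<longleftrightarrow> cone_perp v (vec p)" using tangent_eq_zero_iff_perp[OF pv(4,2) v] .
    also have "\<dots> \<longleftrightarrow> cone_perp v w"
    proof -
      obtain e where e: "e \<in> carrier K" "e \<noteq> \<zero>" "w = e \<cdot> vec p"
        using span_singleton_eqD[of "vec p" w] p pv wc False by auto
      then show ?thesis using perp_smult[of v "vec p" e] perp_smult_cancel[of v e "vec p"] pv by blast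
    qed
    finally show ?thesis .
  qed
  have "sesquilinear_cone K V (cone (points \<Gamma>)) cone_perp (\<lambda>v w. f w v) \<sigma>"
  proof
    fix v w assume "v \<in> carrier V" "w \<in> carrier V"
    then show "f w v \<in> carrier K" using functionalD(1)[OF fV] by blast
  next
    fix u v w assume "u \<in> carrier V" "v \<in> carrier V" "w \<in> carrier V"
    then show "f w (u +\<^sub>v v) = f w u \<oplus> f w v" "f (v +\<^sub>v w) u = f v u \<oplus> f w u"
      using functionalD(2)[OF fV] fa by auto
  next
    fix a v w assume "a \<in> carrier K" "v \<in> carrier V" "w \<in> carrier V"
    then show "f w (a \<cdot> v) = a \<otimes> f w v" "f (a \<cdot> w) v = f w v \<otimes> \<sigma> a"
      using functionalD(3)[OF fV] fs by auto
  next
    show "bij_betw \<sigma> (carrier K) (carrier K)" using ring_iso_memE(5)[OF s] by simp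
    show "\<sigma> \<one> = \<one>" using ring_iso_memE(4)[OF s] by simp
  next
    fix a b assume "a \<in> carrier K" "b \<in> carrier K"
    then show "\<sigma> (a \<oplus> b) = \<sigma> a \<oplus> \<sigma> b" "\<sigma> (a \<otimes> b) = \<sigma> b \<otimes> \<sigma> a"
      using ring_iso_memE(2,3)[OF s] by auto
  qed (rule perp)
  then show ?thesis by blast
qed

end

section \<open>Hermitian symmetry\<close>

context sesquilinear_cone
begin

lemma sigma_closed [simp]: "a \<in> carrier K \<Longrightarrow> \<sigma> a \<in> carrier K"
  using sigma_bij by (auto simp: bij_betw_def)

lemma sigma_zero [simp]: "\<sigma> \<zero> = \<zero>"
  using sigma_add[of \<zero> \<zero>] by (metis K.zero_closed K.r_zero sigma_closed K.add.r_cancel_one)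

declare form_closed [simp]

lemma form_zero [simp]:
  "v \<in> carrier V \<Longrightarrow> \<beta> 0\<^sub>v v = \<zero>" "v \<in> carrier V \<Longrightarrow> \<beta> v 0\<^sub>v = \<zero>"
  using form_smult_l[of \<zero> "0\<^sub>v" v] form_smult_r[of \<zero> v "0\<^sub>v"] by simp_all

lemma sigma_minus_one [simp]: "\<sigma> (\<ominus> \<one>) = \<ominus> \<one>"
  using sigma_add[of "\<ominus> \<one>" \<one>] K.minus_equality[of "\<sigma> (\<ominus> \<one>)" \<one>]
  by (simp add: K.l_neg sigma_one)

lemma form_zero_if_perp: "v \<bottom> w \<Longrightarrow> \<beta> v w = \<zero>"
  using form_perp perp_D by blast

lemma unit_pair_exists: "\<exists>a\<in>C. \<exists>c\<in>C. \<beta> a c = \<one>"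
proof -
  obtain a b c d where "quad a b c d" using quad_exists by blast
  then have ac: "a \<in> C" "c \<in> C" "\<not> a \<bottom> c" by (auto simp: quad_def)
  then have t: "\<beta> a c \<in> carrier K" "\<beta> a c \<noteq> \<zero>" using form_perp by auto
  then have "\<beta> (inv (\<beta> a c) \<cdot> a) c = \<one>" using ac form_smult_l by simp
  then show ?thesis using ac t smult_C by (metis inv_K(1))
qed

text \<open>
  Normalise \<open>\<beta> a0 c0 = 1\<close>, and let \<open>e = \<beta> c0 a0\<close>. The involution is \<open>t \<mapsto> e \<sigma>(t)\<close>. In the proof, \<open>P v w\<close>
  states the symmetry for the pair \<open>v, w\<close>, and \<open>Q w\<close> states it for \<open>w\<close> and all \<open>v\<close>. For \<open>w \<in> C\<close>, both sides of \<open>P v w\<close>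
  depend on \<open>v\<close> in the same semilinear way and vanish for \<open>v \<bottom> w\<close>, so that a single \<open>v \<in> C\<close> not orthogonal to \<open>w\<close> decides
  \<open>Q w\<close>. This gives \<open>Q c0\<close>. Then \<open>Q\<close> spreads along lines to all of \<open>C\<close>, and by additivity to all of \<open>V\<close>. The
  algebraic properties of the involution follow by evaluating the symmetry on multiples of \<open>a0\<close> and \<open>c0\<close>.\<close>

lemma adjoint_exists:
  "\<exists>st. (\<forall>t\<in>carrier K. st t \<in> carrier K \<and> st (st t) = t) \<and>
    (\<forall>s\<in>carrier K. \<forall>t\<in>carrier K. st (s \<oplus> t) = st s \<oplus> st t) \<and>
    (\<forall>l\<in>carrier K. \<forall>t\<in>carrier K. \<forall>m\<in>carrier K. st (l \<otimes> t \<otimes> \<sigma> m) = m \<otimes> st t \<otimes> \<sigma> l) \<and>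
    (\<forall>v\<in>carrier V. \<forall>w\<in>carrier V. \<beta> w v = st (\<beta> v w))"
proof -
  obtain a0 c0 where ac: "a0 \<in> C" "c0 \<in> C" "\<beta> a0 c0 = \<one>" using unit_pair_exists by blast
  have nac: "\<not> a0 \<bottom> c0" using form_perp ac one_neq_zero by metis
  define e where "e = \<beta> c0 a0"
  have e: "e \<in> carrier K" unfolding e_def using ac by simp
  define P where "P v w \<longleftrightarrow> \<beta> w v = e \<otimes> \<sigma> (\<beta> v w)" for v w
  define Q where "Q w \<longleftrightarrow> (\<forall>v\<in>carrier V. P v w)" for w
  have P_perp: "P v w" if "v \<bottom> w" for v w
  proof -
    have "\<beta> v w = \<zero>" "\<beta> w v = \<zero>" using form_perp perp_D[OF that] perp_sym[OF that] that by auto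
    then show ?thesis using e by (simp add: P_def)
  qed
  have P_add_r: "P v (w +\<^sub>v w')" if "P v w" "P v w'" "v \<in> carrier V" "w \<in> carrier V" "w' \<in> carrier V" for v w w'
    using that e by (simp add: P_def form_add_l form_add_r sigma_add K.r_distr)
  have Q_step0: "Q w" if w: "w \<in> C" and c: "c \<in> C" "\<not> c \<bottom> w" "P c w" for w c
  proof -
    let ?U = "{v \<in> carrier V. P v w}"
    have U: "subsp ?U"
    proof (rule subspI)
      show "0\<^sub>v \<in> ?U" using w e by (simp add: P_def)
    next
      fix x y assume "x \<in> ?U" "y \<in> ?U"
      then show "x +\<^sub>v y \<in> ?U" using w e by (simp add: P_def form_add_l form_add_r sigma_add K.r_distr)
    next
      fix k x assume "k \<in> carrier K" "x \<in> ?U"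
      then show "k \<cdot> x \<in> ?U" using w e by (simp add: P_def form_smult_l form_smult_r sigma_mult K.m_assoc)
    qed auto
    have "tangent_space w \<subseteq> ?U" unfolding tangent_space_def using U P_perp by (intro span_least) auto
    then have "v \<in> ?U" if "v \<in> carrier V" for v
      using tangent_space_hyperplane[OF w c(1,2) that] subspD(3,4)[OF U] c by blast
    then show ?thesis by (simp add: Q_def)
  qed
  have Q0: "Q c0"
    using Q_step0[OF ac(2,1) nac] ac e by (simp add: P_def e_def[symmetric] sigma_one)
  \<comment> \<open>From \<open>w\<close> to a point \<open>w'\<close> collinear with it: first to \<open>w + w'\<close>, tested at some \<open>v\<close> orthogonal to \<open>w'\<close> only.\<close>
  have Q_step: "Q w'" if w: "w \<noteq> 0\<^sub>v" "Q w" and ww: "w \<bottom> w'" "w' \<notin> span {w}" for w w'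
  proof -
    have C: "w \<in> C" "w' \<in> C" using perp_D[OF ww(1)] by auto
    have "w \<notin> span {w'}"
      using span_singleton_absorb[of w w'] w ww(2) C span_base[of w' "{w'}"] by auto
    then obtain v where v: "v \<bottom> w'" "\<not> v \<bottom> w" using separate[OF C(2,1)] by blast
    have vC: "v \<in> C" using perp_D v by blast
    let ?x = "w +\<^sub>v w'"
    have xC: "?x \<in> C" using add_C ww by blast
    have Pvx: "P v ?x" using P_add_r P_perp[OF v(1)] w(2) vC C by (auto simp: Q_def)
    have "\<not> v \<bottom> ?x" using perp_cancel[of v w \<one> w'] v ww C by auto
    then have Qx: "Q ?x" using Q_step0[OF xC vC] Pvx by blast
    show "Q w'"
      unfolding Q_def
    proof
      fix v assume v: "v \<in> carrier V"
      have x: "\<beta> ?x v = e \<otimes> \<sigma> (\<beta> v ?x)" and wv: "\<beta> w v = e \<otimes> \<sigma> (\<beta> v w)"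
        using Qx w(2) v by (auto simp: Q_def P_def)
      have "\<beta> w v \<oplus> \<beta> w' v = \<beta> w v \<oplus> e \<otimes> \<sigma> (\<beta> v w')"
        using x v C e by (simp add: form_add_l form_add_r sigma_add K.r_distr wv[symmetric])
      then have "\<ominus> \<beta> w v \<oplus> (\<beta> w v \<oplus> \<beta> w' v) = \<ominus> \<beta> w v \<oplus> (\<beta> w v \<oplus> e \<otimes> \<sigma> (\<beta> v w'))"
        by simp
      then show "P v w'" using v C e by (simp add: P_def K.r_neg1)
    qed
  qed
  have not_span: "y \<notin> span {x}" if y: "y \<noteq> 0\<^sub>v" "x \<in> C" "u \<bottom> y" "\<not> u \<bottom> x" for x y u
  proof
    assume "y \<in> span {x}"
    then obtain k where k: "k \<in> carrier K" "y = k \<cdot> x" using y(2) by (auto simp: span_singleton)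
    then have "k \<noteq> \<zero>" using y by auto
    then show False using perp_smult_cancel[of u k x] y k by auto
  qed
  have QC: "Q w" if w: "w \<in> C" for w
  proof (cases "w = 0\<^sub>v")
    case True then show ?thesis using e by (simp add: Q_def P_def)
  next
    case w0: False
    have c00: "c0 \<noteq> 0\<^sub>v" using nac ac by auto
    show ?thesis
    proof (cases "w \<bottom> c0")
      case True
      show ?thesis
      proof (cases "w \<in> span {c0}")
        case False
        then show ?thesis using Q_step[OF c00 Q0] True perp_sym by blast
      next
        case wc: True
        obtain m n where m: "m \<bottom> a0" "m \<bottom> c0" "n \<bottom> a0" "n \<bottom> c0" "\<not> m \<bottom> n"
          using hyperbolic_perp_pair[OF ac(2,1) nac] by metis
        have mC: "m \<in> C" "n \<in> C" using perp_D m by blast+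
        have m0: "m \<noteq> 0\<^sub>v" using m mC by auto
        have "m \<notin> span {c0}" using not_span[OF m0 ac(2), of a0] m nac perp_sym by blast
        then have Qm: "Q m" using Q_step[OF c00 Q0] m perp_sym by blast
        have sw: "span {w} = span {c0}" using span_singleton_absorb wc w0 ac by blast
        have na: "\<not> a0 \<bottom> w"
        proof
          assume a: "a0 \<bottom> w"
          have "c0 \<noteq> 0\<^sub>v \<and> c0 \<in> span {w}" using sw c00 span_base[of c0 "{c0}"] by simp
          then obtain k where "k \<in> carrier K" "c0 = k \<cdot> w" using w by (auto simp: span_singleton)
          then show False using perp_smult[OF a] nac by blast
        qed
        have "w \<notin> span {m}"
        proof
          assume "w \<in> span {m}"
          then obtain k where "k \<in> carrier K" "w = k \<cdot> m" using mC by (auto simp: span_singleton)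
          then show False using na perp_smult[of a0 m k] m perp_sym by blast
        qed
        moreover have "m \<bottom> w"
        proof -
          obtain k where "k \<in> carrier K" "w = k \<cdot> c0" using wc ac by (auto simp: span_singleton)
          then show ?thesis using perp_smult m by blast
        qed
        ultimately show ?thesis using Q_step[OF m0 Qm] by blast
      qed
    next
      case False
      then have nc: "\<not> c0 \<bottom> w" using perp_sym by blast
      obtain m n where m: "m \<bottom> w" "m \<bottom> c0" "n \<bottom> w" "n \<bottom> c0" "\<not> m \<bottom> n"
        using hyperbolic_perp_pair[OF w ac(2) nc] by metis
      have mC: "m \<in> C" "n \<in> C" using perp_D m by blast+
      have m0: "m \<noteq> 0\<^sub>v" using m mC by auto
      have "m \<notin> span {c0}" using not_span[OF m0 ac(2), of w] m False perp_sym by blast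
      then have Qm: "Q m" using Q_step[OF c00 Q0] m perp_sym by blast
      have "w \<notin> span {m}"
      proof
        assume "w \<in> span {m}"
        then obtain k where "k \<in> carrier K" "w = k \<cdot> m" using mC by (auto simp: span_singleton)
        then show False using nc perp_smult[of c0 m k] m perp_sym by blast
      qed
      then show ?thesis using Q_step[OF m0 Qm] m by blast
    qed
  qed
  have QV: "Q w" if "w \<in> carrier V" for w
  proof -
    let ?U = "{w \<in> carrier V. \<forall>k\<in>carrier K. Q (k \<cdot> w)}"
    have "subsp ?U"
    proof (rule subspI)
      show "0\<^sub>v \<in> ?U" using QC zero_C by auto
    next
      fix x y assume xy: "x \<in> ?U" "y \<in> ?U"
      have "Q (k \<cdot> (x +\<^sub>v y))" if k: "k \<in> carrier K" for k
        using xy k P_add_r by (simp add: smult_r_distr Q_def)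
      then show "x +\<^sub>v y \<in> ?U" using xy by auto
    next
      fix k x assume "k \<in> carrier K" "x \<in> ?U"
      then show "k \<cdot> x \<in> ?U" by (auto simp: smult_assoc[symmetric])
    qed auto
    moreover have "C \<subseteq> ?U" using QC smult_C by auto
    ultimately have "carrier V \<subseteq> ?U" using span_least C_span by blast
    then have "w \<in> ?U" using that by blast
    then have "Q (\<one> \<cdot> w)" by blast
    then show ?thesis using that by simp
  qed
  have sym: "\<beta> w v = e \<otimes> \<sigma> (\<beta> v w)" if "v \<in> carrier V" "w \<in> carrier V" for v w
    using QV[OF that(2)] that(1) unfolding Q_def P_def by blast
  have twist: "e \<otimes> \<sigma> (\<sigma> k) = k \<otimes> e" if k: "k \<in> carrier K" for k
  proof -
    have "\<beta> (k \<cdot> c0) a0 = e \<otimes> \<sigma> (\<beta> a0 (k \<cdot> c0))"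
      using sym[of a0 "k \<cdot> c0"] ac k by blast
    then show ?thesis using ac k by (simp add: form_smult_l form_smult_r e_def)
  qed
  have ee: "e \<otimes> \<sigma> e = \<one>" using sym[of c0 a0] ac by (simp add: e_def)
  let ?st = "\<lambda>t. e \<otimes> \<sigma> t"
  have inv: "?st (?st t) = t" if t: "t \<in> carrier K" for t
  proof -
    have "?st (?st t) = (e \<otimes> \<sigma> (\<sigma> t)) \<otimes> \<sigma> e" using t e by (simp add: sigma_mult K.m_assoc)
    also have "\<dots> = t \<otimes> (e \<otimes> \<sigma> e)" using t e twist by (simp add: K.m_assoc)
    finally show ?thesis using ee t by simp
  qed
  have mult: "?st (l \<otimes> t \<otimes> \<sigma> m) = m \<otimes> ?st t \<otimes> \<sigma> l"
    if "l \<in> carrier K" "t \<in> carrier K" "m \<in> carrier K" for l t m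
  proof -
    have "?st (l \<otimes> t \<otimes> \<sigma> m) = (e \<otimes> \<sigma> (\<sigma> m)) \<otimes> (\<sigma> t \<otimes> \<sigma> l)"
      using that e by (simp add: sigma_mult K.m_assoc)
    then show ?thesis using that e twist by (simp add: K.m_assoc)
  qed
  show ?thesis
  proof (rule exI[of _ ?st], intro conjI ballI)
    show "?st t \<in> carrier K" if "t \<in> carrier K" for t using e that by simp
    show "?st (s \<oplus> t) = ?st s \<oplus> ?st t" if "s \<in> carrier K" "t \<in> carrier K" for s t
      using e that by (simp add: sigma_add K.r_distr)
  qed (fact inv mult sym)+
qed

end

text \<open>For a \<open>(\<sigma>, \<epsilon>)\<close>-hermitian form, \<open>st t\<close> is \<open>\<epsilon> \<sigma>(t)\<close>. It is written \<open>t\<^sup>*\<close> in comments.\<close>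

locale hermitian_cone = sesquilinear_cone +
  fixes st
  assumes st_closed [simp]: "t \<in> carrier K \<Longrightarrow> st t \<in> carrier K"
    and st_st [simp]: "t \<in> carrier K \<Longrightarrow> st (st t) = t"
    and st_add: "s \<in> carrier K \<Longrightarrow> t \<in> carrier K \<Longrightarrow> st (s \<oplus> t) = st s \<oplus> st t"
    and st_mult: "l \<in> carrier K \<Longrightarrow> t \<in> carrier K \<Longrightarrow> m \<in> carrier K \<Longrightarrow>
      st (l \<otimes> t \<otimes> \<sigma> m) = m \<otimes> st t \<otimes> \<sigma> l"
    and form_sym: "v \<in> carrier V \<Longrightarrow> w \<in> carrier V \<Longrightarrow> \<beta> w v = st (\<beta> v w)"
begin

section \<open>The hull of the embedding\<close>

definition traces where
  "traces = {t \<ominus> st t |t. t \<in> carrier K}"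

definition teq where
  "teq s t \<longleftrightarrow> s \<in> carrier K \<and> t \<in> carrier K \<and> s \<ominus> t \<in> traces"

lemma st_zero [simp]: "st \<zero> = \<zero>"
  using st_add[of \<zero> \<zero>] by (metis K.zero_closed K.r_zero st_closed K.add.r_cancel_one)

lemma st_minus: "t \<in> carrier K \<Longrightarrow> st (\<ominus> t) = \<ominus> st t"
  using st_add[of "\<ominus> t" t] K.minus_equality[of "st (\<ominus> t)" "st t"] by (simp add: K.l_neg)

lemma st_twice: "a \<in> carrier K \<Longrightarrow> t \<in> carrier K \<Longrightarrow> st (a \<otimes> t \<otimes> \<sigma> a) = a \<otimes> st t \<otimes> \<sigma> a"
  using st_mult by simp

lemma traces_I: "t \<in> carrier K \<Longrightarrow> t \<ominus> st t \<in> traces"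
  by (auto simp: traces_def)

lemma traces_zero: "\<zero> \<in> traces"
  unfolding traces_def by (rule CollectI, rule exI[of _ \<zero>]) (simp add: K.minus_eq)

lemma traces_add: "x \<in> traces \<Longrightarrow> y \<in> traces \<Longrightarrow> x \<oplus> y \<in> traces"
proof -
  assume "x \<in> traces" "y \<in> traces"
  then obtain s t where "s \<in> carrier K" "t \<in> carrier K" "x = s \<ominus> st s" "y = t \<ominus> st t"
    by (auto simp: traces_def)
  moreover from this have "x \<oplus> y = (s \<oplus> t) \<ominus> st (s \<oplus> t)"
    by (simp add: st_add K.minus_eq K.minus_add K.a_ac)
  ultimately show ?thesis using traces_I[of "s \<oplus> t"] by simp
qed

lemma traces_minus: "x \<in> traces \<Longrightarrow> \<ominus> x \<in> traces"
proof -
  assume "x \<in> traces"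
  then obtain t where t: "t \<in> carrier K" "x = t \<ominus> st t" by (auto simp: traces_def)
  then have "\<ominus> x = \<ominus> t \<ominus> st (\<ominus> t)" by (simp add: st_minus K.minus_eq K.minus_add)
  then show ?thesis using traces_I[of "\<ominus> t"] t by simp
qed

lemma traces_twist: "x \<in> traces \<Longrightarrow> a \<in> carrier K \<Longrightarrow> a \<otimes> x \<otimes> \<sigma> a \<in> traces"
proof -
  assume "x \<in> traces" and a: "a \<in> carrier K"
  then obtain t where t: "t \<in> carrier K" "x = t \<ominus> st t" by (auto simp: traces_def)
  then have "a \<otimes> x \<otimes> \<sigma> a = (a \<otimes> t \<otimes> \<sigma> a) \<ominus> st (a \<otimes> t \<otimes> \<sigma> a)"
    using a by (simp add: st_twice K.minus_eq K.r_distr K.l_distr K.r_minus K.l_minus)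
  then show ?thesis using traces_I[of "a \<otimes> t \<otimes> \<sigma> a"] t a by simp
qed

lemma teq_refl: "t \<in> carrier K \<Longrightarrow> teq t t"
  by (simp add: teq_def traces_zero K.minus_eq K.r_neg)

lemma teq_sym: "teq s t \<Longrightarrow> teq t s"
  using traces_minus[of "s \<ominus> t"] by (auto simp: teq_def K.minus_eq K.minus_add K.a_comm)

lemma teq_trans: "teq s t \<Longrightarrow> teq t u \<Longrightarrow> teq s u"
proof -
  assume a: "teq s t" "teq t u"
  then have K: "s \<in> carrier K" "t \<in> carrier K" "u \<in> carrier K" by (auto simp: teq_def)
  have "(s \<ominus> t) \<oplus> (t \<ominus> u) = s \<oplus> ((\<ominus> t \<oplus> t) \<ominus> u)" using K by (simp add: K.minus_eq K.a_assoc)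
  also have "\<dots> = s \<ominus> u" using K by (simp add: K.l_neg K.minus_eq)
  finally show ?thesis using a traces_add[of "s \<ominus> t" "t \<ominus> u"] by (simp add: teq_def)
qed

lemma teq_add: "teq s t \<Longrightarrow> teq s' t' \<Longrightarrow> teq (s \<oplus> s') (t \<oplus> t')"
  using traces_add[of "s \<ominus> t" "s' \<ominus> t'"] by (auto simp: teq_def K.minus_eq K.minus_add K.a_ac)

lemma teq_twist: "teq s t \<Longrightarrow> a \<in> carrier K \<Longrightarrow> teq (a \<otimes> s \<otimes> \<sigma> a) (a \<otimes> t \<otimes> \<sigma> a)"
  using traces_twist[of "s \<ominus> t" a]
  by (auto simp: teq_def K.minus_eq K.r_distr K.l_distr K.r_minus K.l_minus)

lemma teq_st: "t \<in> carrier K \<Longrightarrow> teq t (st t)"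
  by (auto simp: teq_def traces_def)

text \<open>
  The quotient of the scalars by the traces is represented by chosen representatives, so that its elements are
  again scalars.\<close>

definition rep where
  "rep t = (SOME u. teq u t)"

lemma rep_teq: "t \<in> carrier K \<Longrightarrow> teq (rep t) t"
  unfolding rep_def using teq_refl by (rule someI)

lemma rep_closed [simp]: "t \<in> carrier K \<Longrightarrow> rep t \<in> carrier K"
  using rep_teq by (auto simp: teq_def)

lemma rep_eq: "s \<in> carrier K \<Longrightarrow> t \<in> carrier K \<Longrightarrow> rep s = rep t \<longleftrightarrow> teq s t"
proof
  assume "s \<in> carrier K" "t \<in> carrier K" "rep s = rep t"
  then show "teq s t" using rep_teq teq_sym teq_trans by metis
next
  assume "teq s t"
  then have "teq u s \<longleftrightarrow> teq u t" for u using teq_sym teq_trans by blast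
  then show "rep s = rep t" by (simp add: rep_def)
qed

text \<open>
  The second component is the value of a pseudo-quadratic form with polarisation \<open>\<beta>\<close>: it is additive up to
  \<open>\<beta>\<close>, and \<open>s\<close> becomes \<open>a s \<sigma>(a)\<close> when the vector is multiplied by \<open>a\<close>. The condition \<open>\<beta> v v = s + s\<^sup>*\<close> is what makes
  multiplication by a sum of scalars distributive.\<close>

definition hull_space where
  "hull_space = \<lparr>carrier = {(v, rep s) |v s. v \<in> carrier V \<and> s \<in> carrier K \<and> \<beta> v v = s \<oplus> st s},
     mult = undefined, one = undefined, zero = (0\<^sub>v, rep \<zero>),
     add = \<lambda>x y. (fst x +\<^sub>v fst y, rep (snd x \<oplus> snd y \<oplus> \<beta> (fst x) (fst y))),
     smult = \<lambda>a x. (a \<cdot> fst x, rep (a \<otimes> snd x \<otimes> \<sigma> a))\<rparr>"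

lemma hull_carrierE:
  assumes "x \<in> carrier hull_space"
  obtains v s where "v \<in> carrier V" "s \<in> carrier K" "\<beta> v v = s \<oplus> st s" "x = (v, rep s)"
  using assms by (auto simp: hull_space_def)

lemma hull_carrierI:
  "v \<in> carrier V \<Longrightarrow> s \<in> carrier K \<Longrightarrow> \<beta> v v = s \<oplus> st s \<Longrightarrow> (v, rep s) \<in> carrier hull_space"
  by (auto simp: hull_space_def)

lemma hull_zero: "\<zero>\<^bsub>hull_space\<^esub> = (0\<^sub>v, rep \<zero>)"
  by (simp add: hull_space_def)

lemma hull_add:
  assumes "v \<in> carrier V" "w \<in> carrier V" "s \<in> carrier K" "t \<in> carrier K"
  shows "(v, rep s) \<oplus>\<^bsub>hull_space\<^esub> (w, rep t) = (v +\<^sub>v w, rep (s \<oplus> t \<oplus> \<beta> v w))"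
  using assms by (simp add: hull_space_def rep_eq teq_add teq_refl rep_teq)

lemma hull_smult:
  assumes "v \<in> carrier V" "s \<in> carrier K" "a \<in> carrier K"
  shows "a \<odot>\<^bsub>hull_space\<^esub> (v, rep s) = (a \<cdot> v, rep (a \<otimes> s \<otimes> \<sigma> a))"
  using assms by (simp add: hull_space_def rep_eq teq_twist rep_teq)

text \<open>
  Two axioms hold only modulo traces. Addition is commutative since \<open>\<beta> v w\<close> and \<open>\<beta> w v = (\<beta> v w)\<^sup>*\<close> differ
  by a trace. In \<open>(a + b) x = a x + b x\<close> the mixed terms are \<open>a s \<sigma>(b) + b s \<sigma>(a)\<close> on the left
  and \<open>\<beta> (a v) (b v) = a s \<sigma>(b) + (b s \<sigma>(a))\<^sup>*\<close> on the right.\<close>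

lemma left_vector_space_hull: "left_vector_space K hull_space"
proof -
  let ?H = hull_space
  have ab: "abelian_group ?H"
  proof (rule abelian_groupI)
    fix x y assume "x \<in> carrier ?H" "y \<in> carrier ?H"
    then obtain v s w t where x: "v \<in> carrier V" "s \<in> carrier K" "\<beta> v v = s \<oplus> st s" "x = (v, rep s)"
      and y: "w \<in> carrier V" "t \<in> carrier K" "\<beta> w w = t \<oplus> st t" "y = (w, rep t)"
      by (metis hull_carrierE)
    have "\<beta> (v +\<^sub>v w) (v +\<^sub>v w) = (s \<oplus> t \<oplus> \<beta> v w) \<oplus> st (s \<oplus> t \<oplus> \<beta> v w)"
      using x y by (simp add: form_add_l form_add_r st_add form_sym[of v w] K.a_ac)
    then show "x \<oplus>\<^bsub>?H\<^esub> y \<in> carrier ?H" using x y by (simp add: hull_add hull_carrierI)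
    have d: "s \<oplus> t \<oplus> \<beta> v w \<in> carrier K" "t \<oplus> s \<oplus> \<beta> w v \<in> carrier K" using x y by auto
    have "teq (s \<oplus> t \<oplus> \<beta> v w) (t \<oplus> s \<oplus> \<beta> w v)"
      unfolding K.a_comm[OF x(2) y(2)] form_sym[OF x(1) y(1)]
      using x y by (intro teq_add teq_refl teq_st) auto
    then show "x \<oplus>\<^bsub>?H\<^esub> y = y \<oplus>\<^bsub>?H\<^esub> x" using x y d by (simp add: hull_add rep_eq V.a_comm)
  next
    show "\<zero>\<^bsub>?H\<^esub> \<in> carrier ?H" unfolding hull_zero by (rule hull_carrierI) auto
  next
    fix x y z assume "x \<in> carrier ?H" "y \<in> carrier ?H" "z \<in> carrier ?H"
    then obtain v s w t u r where x: "v \<in> carrier V" "s \<in> carrier K" "x = (v, rep s)"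
      and y: "w \<in> carrier V" "t \<in> carrier K" "y = (w, rep t)"
      and z: "u \<in> carrier V" "r \<in> carrier K" "z = (u, rep r)"
      by (metis hull_carrierE)
    then show "(x \<oplus>\<^bsub>?H\<^esub> y) \<oplus>\<^bsub>?H\<^esub> z = x \<oplus>\<^bsub>?H\<^esub> (y \<oplus>\<^bsub>?H\<^esub> z)"
      by (simp add: hull_add form_add_l form_add_r V.a_assoc K.a_ac)
  next
    fix x assume "x \<in> carrier ?H"
    then obtain v s where x: "v \<in> carrier V" "s \<in> carrier K" "\<beta> v v = s \<oplus> st s" "x = (v, rep s)"
      by (rule hull_carrierE)
    then show "\<zero>\<^bsub>?H\<^esub> \<oplus>\<^bsub>?H\<^esub> x = x" by (simp add: hull_zero hull_add)
    let ?v = "(\<ominus> \<one>) \<cdot> v"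
    have b: "\<beta> ?v ?v = \<beta> v v" "\<beta> ?v v = \<ominus> \<beta> v v"
      using x(1) by (simp_all add: form_smult_l form_smult_r K.l_minus K.r_minus)
    have "(?v, rep (st s)) \<in> carrier ?H"
      using x b by (intro hull_carrierI) (auto simp: K.a_comm)
    moreover have "(?v, rep (st s)) \<oplus>\<^bsub>?H\<^esub> x = \<zero>\<^bsub>?H\<^esub>"
    proof -
      have "?v +\<^sub>v v = 0\<^sub>v" using x(1) minus_smult[of v] V.l_neg[of v] by simp
      moreover have "st s \<oplus> s \<oplus> \<beta> ?v v = \<zero>" using x b by (simp add: K.a_comm[of "st s" s] K.r_neg)
      ultimately show ?thesis using x by (simp add: hull_add hull_zero)
    qed
    ultimately show "\<exists>y\<in>carrier ?H. y \<oplus>\<^bsub>?H\<^esub> x = \<zero>\<^bsub>?H\<^esub>" by blast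
  qed
  show ?thesis
  proof (intro left_vector_space.intro left_vector_space_axioms.intro ab skew_field_axioms)
    fix a x assume a: "a \<in> carrier K" and "x \<in> carrier ?H"
    then obtain v s where x: "v \<in> carrier V" "s \<in> carrier K" "\<beta> v v = s \<oplus> st s" "x = (v, rep s)"
      by (metis hull_carrierE)
    have "a \<otimes> \<beta> v v \<otimes> \<sigma> a = (a \<otimes> s \<otimes> \<sigma> a) \<oplus> st (a \<otimes> s \<otimes> \<sigma> a)"
      using x(2,3) a by (simp add: st_twice K.r_distr K.l_distr)
    then have "\<beta> (a \<cdot> v) (a \<cdot> v) = (a \<otimes> s \<otimes> \<sigma> a) \<oplus> st (a \<otimes> s \<otimes> \<sigma> a)"
      using x(1) a by (simp add: form_smult_l form_smult_r K.m_assoc)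
    then show "a \<odot>\<^bsub>?H\<^esub> x \<in> carrier ?H" using x a by (simp add: hull_smult hull_carrierI)
  next
    fix a b x assume a: "a \<in> carrier K" "b \<in> carrier K" and "x \<in> carrier ?H"
    then obtain v s where x: "v \<in> carrier V" "s \<in> carrier K" "\<beta> v v = s \<oplus> st s" "x = (v, rep s)"
      by (metis hull_carrierE)
    show "(a \<otimes> b) \<odot>\<^bsub>?H\<^esub> x = a \<odot>\<^bsub>?H\<^esub> (b \<odot>\<^bsub>?H\<^esub> x)"
      using x a by (simp add: hull_smult smult_assoc sigma_mult K.m_assoc)
    have K: "a \<otimes> s \<otimes> \<sigma> b \<in> carrier K" "b \<otimes> s \<otimes> \<sigma> a \<in> carrier K" "a \<otimes> s \<otimes> \<sigma> a \<in> carrier K"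
      "b \<otimes> s \<otimes> \<sigma> b \<in> carrier K" using a x by auto
    have L: "(a \<oplus> b) \<otimes> s \<otimes> \<sigma> (a \<oplus> b) = (a \<otimes> s \<otimes> \<sigma> a \<oplus> b \<otimes> s \<otimes> \<sigma> b) \<oplus> (a \<otimes> s \<otimes> \<sigma> b \<oplus> b \<otimes> s \<otimes> \<sigma> a)"
      using a x(2) by (simp add: sigma_add K.l_distr K.r_distr K.a_ac)
    have "a \<otimes> \<beta> v v \<otimes> \<sigma> b = a \<otimes> s \<otimes> \<sigma> b \<oplus> st (b \<otimes> s \<otimes> \<sigma> a)"
      using a x(2,3) by (simp add: st_mult K.l_distr K.r_distr)
    then have R: "\<beta> (a \<cdot> v) (b \<cdot> v) = a \<otimes> s \<otimes> \<sigma> b \<oplus> st (b \<otimes> s \<otimes> \<sigma> a)"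
      using a x(1) by (simp add: form_smult_l form_smult_r K.m_assoc)
    have "teq ((a \<otimes> s \<otimes> \<sigma> a \<oplus> b \<otimes> s \<otimes> \<sigma> b) \<oplus> (a \<otimes> s \<otimes> \<sigma> b \<oplus> b \<otimes> s \<otimes> \<sigma> a))
      ((a \<otimes> s \<otimes> \<sigma> a \<oplus> b \<otimes> s \<otimes> \<sigma> b) \<oplus> (a \<otimes> s \<otimes> \<sigma> b \<oplus> st (b \<otimes> s \<otimes> \<sigma> a)))"
      using K by (intro teq_add teq_refl teq_st) auto
    then show "(a \<oplus> b) \<odot>\<^bsub>?H\<^esub> x = a \<odot>\<^bsub>?H\<^esub> x \<oplus>\<^bsub>?H\<^esub> b \<odot>\<^bsub>?H\<^esub> x"
      using x a K by (simp add: hull_smult hull_add smult_l_distr rep_eq L R)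
  next
    fix a x y assume a: "a \<in> carrier K" and "x \<in> carrier ?H" "y \<in> carrier ?H"
    then obtain v s w t where x: "v \<in> carrier V" "s \<in> carrier K" "x = (v, rep s)"
      and y: "w \<in> carrier V" "t \<in> carrier K" "y = (w, rep t)"
      by (metis hull_carrierE)
    then show "a \<odot>\<^bsub>?H\<^esub> (x \<oplus>\<^bsub>?H\<^esub> y) = a \<odot>\<^bsub>?H\<^esub> x \<oplus>\<^bsub>?H\<^esub> a \<odot>\<^bsub>?H\<^esub> y"
      using a by (simp add: hull_smult hull_add smult_r_distr form_smult_l form_smult_r K.l_distr K.r_distr K.m_assoc)
  next
    fix x assume "x \<in> carrier ?H"
    then obtain v s where x: "v \<in> carrier V" "s \<in> carrier K" "x = (v, rep s)" by (metis hull_carrierE)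
    then show "\<one> \<odot>\<^bsub>?H\<^esub> x = x" by (simp add: hull_smult sigma_one)
  qed
qed

end

context embedded_polar_space_with_quadrangle
begin

text \<open>
  For \<open>v \<in> C\<close> the pairs \<open>(v, 0)\<close>, with \<open>0\<close> standing for its representative, are closed under linear combinations of orthogonal vectors, and so they
  embed the geometry in the hull. The morphism \<open>g\<close> provided by universality takes \<open>v \<in> C\<close> to a non-zero multiple
  \<open>(l v, 0)\<close>. For the independent vectors \<open>k a\<close> and \<open>c\<close> and their sum the factor \<open>l\<close> is the same by comparison of
  first components. The second component of \<open>g (k a) + g c\<close> is \<open>\<beta> (l k a) (l c) = l k \<sigma>(l)\<close>, so this is a
  trace, and hence so is \<open>k\<close>.\<close>

theorem hyperbolic_line_traces:
  assumes univ: "absolutely_universal \<Gamma> K V \<epsilon>"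
    and herm: "hermitian_cone K V (cone (points \<Gamma>)) cone_perp \<beta> \<sigma> st"
    and a: "a \<in> cone (points \<Gamma>)" and c: "c \<in> cone (points \<Gamma>)" and k: "k \<in> carrier K"
    and kac: "k \<cdot> a +\<^sub>v c \<in> cone (points \<Gamma>)" and ac: "\<beta> a c = \<one>"
  shows "\<exists>t\<in>carrier K. k = t \<ominus> st t"
proof -
  interpret H: hermitian_cone K V "cone (points \<Gamma>)" cone_perp \<beta> \<sigma> st by (rule herm)
  interpret N: left_vector_space K H.hull_space by (rule H.left_vector_space_hull)
  let ?C = "cone (points \<Gamma>)" and ?z = "H.rep \<zero>"
  let ?w = "\<lambda>p. (vec p, ?z)"
  have self: "\<beta> v v = \<zero>" if "v \<in> ?C" for v using H.form_perp[OF that that] perp_refl[OF that] by blast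
  have inN: "(v, ?z) \<in> carrier H.hull_space" if "v \<in> ?C" for v
    using H.hull_carrierI[of v \<zero>] self that by auto
  have sm: "l \<odot>\<^bsub>H.hull_space\<^esub> (v, ?z) = (l \<cdot> v, ?z)" if "l \<in> carrier K" "v \<in> carrier V" for l v
    using H.hull_smult[of v \<zero> l] that by simp
  have add: "(v, ?z) \<oplus>\<^bsub>H.hull_space\<^esub> (w, ?z) = (v +\<^sub>v w, ?z)" if vw: "cone_perp v w" for v w
  proof -
    have "v \<in> ?C" "w \<in> ?C" "v \<in> carrier V" "w \<in> carrier V" using perp_D[OF vw] by auto
    then have "\<beta> v w = \<zero>" using H.form_perp vw by blast
    then show ?thesis using H.hull_add[of v w \<zero> \<zero>] \<open>v \<in> carrier V\<close> \<open>w \<in> carrier V\<close> by simp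
  qed
  have single: "x \<in> N.span {?w p} \<longleftrightarrow> (\<exists>l\<in>carrier K. x = (l \<cdot> vec p, ?z))" if p: "p \<in> points \<Gamma>" for p x
  proof -
    have "N.span {?w p} = {(l \<cdot> vec p, ?z) |l. l \<in> carrier K}"
      unfolding N.span_singleton[OF inN[OF vec_cone[OF p]]] using sm[OF _ vec_carrier[OF p]] by force
    then show ?thesis by blast
  qed
  have pair: "x \<in> N.span {?w p, ?w q} \<longleftrightarrow> (\<exists>y\<in>span {vec p, vec q}. x = (y, ?z))"
    if p: "p \<in> points \<Gamma>" and q: "q \<in> points \<Gamma>" and pq: "cone_perp (vec p) (vec q)" for p q x
  proof -
    have m: "l \<odot>\<^bsub>H.hull_space\<^esub> ?w p \<oplus>\<^bsub>H.hull_space\<^esub> m \<odot>\<^bsub>H.hull_space\<^esub> ?w q = (l \<cdot> vec p +\<^sub>v m \<cdot> vec q, ?z)"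
      if "l \<in> carrier K" "m \<in> carrier K" for l m
      using sm that vec_carrier p q add perp_smult perp_smult_l pq by simp
    have "x \<in> N.span {?w p, ?w q} \<longleftrightarrow>
      (\<exists>l m. x = (l \<cdot> vec p +\<^sub>v m \<cdot> vec q, ?z) \<and> l \<in> carrier K \<and> m \<in> carrier K)"
      unfolding N.span_pair[OF inN[OF vec_cone[OF p]] inN[OF vec_cone[OF q]]] mem_Collect_eq
      using m by metis
    then show ?thesis unfolding span_pair[OF vec_carrier[OF p] vec_carrier[OF q]] by auto
  qed
  have emb': "embedding \<Gamma> K (H.hull_space\<lparr>carrier := N.span (?w ` points \<Gamma>)\<rparr>) (\<lambda>p. N.span {?w p})"
  proof (rule N.embedding_from_vectors)
    fix p assume p: "p \<in> points \<Gamma>"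
    show "?w p \<in> carrier H.hull_space \<and> ?w p \<noteq> \<zero>\<^bsub>H.hull_space\<^esub>"
      using inN[OF vec_cone[OF p]] vec_nonzero[OF p] by (simp add: H.hull_zero)
  next
    fix p q assume pq: "p \<in> points \<Gamma>" "q \<in> points \<Gamma>" "?w q \<in> N.span {?w p}"
    then obtain l where "l \<in> carrier K" "vec q = l \<cdot> vec p" using single by auto
    then have "vec q \<in> span {vec p}" using span_singleton vec_carrier pq by auto
    then have "span {vec q} = span {vec p}" using span_singleton_absorb vec pq by blast
    then show "p = q" using eps_inj pq eps_vec by simp
  next
    fix l assume "l \<in> lines \<Gamma>" then show "l \<subseteq> points \<Gamma>" by (rule lines_sub)
  next
    fix l assume l: "l \<in> lines \<Gamma>"
    obtain p q where pq: "p \<in> l" "q \<in> l" "p \<noteq> q" using two_points_on_line[OF l] by blast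
    have P: "p \<in> points \<Gamma>" "q \<in> points \<Gamma>" using pq l lines_sub by blast+
    note x = vec[OF P(1)] and y = vec[OF P(2)]
    have xy: "cone_perp (vec p) (vec q)"
      using cone_perp_iff[OF P x(3) y(3) x(1) y(1)] line_collinear[OF l pq(1,2)] by blast
    have "?w z \<in> N.span {?w p, ?w q}" if "z \<in> l" for z
      using pair[OF P xy] vec_in_line_span[OF l pq that] by blast
    moreover have "\<exists>z\<in>l. v \<in> N.span {?w z}"
      if v: "v \<in> N.span {?w p, ?w q}" "v \<noteq> \<zero>\<^bsub>H.hull_space\<^esub>" for v
    proof -
      obtain u where u: "u \<in> span {vec p, vec q}" "v = (u, ?z)" using v(1) pair[OF P xy] by blast
      then have "u \<noteq> 0\<^sub>v" using v(2) by (auto simp: H.hull_zero)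
      then obtain z m where z: "z \<in> l" "m \<in> carrier K" "u = m \<cdot> vec z"
        using line_point_of_vector[OF l pq u(1)] by blast
      then have "z \<in> points \<Gamma>" using l lines_sub by blast
      then show ?thesis using single z u(2) by blast
    qed
    ultimately show "\<exists>p\<in>l. \<exists>q\<in>l. p \<noteq> q \<and> (\<forall>z\<in>l. ?w z \<in> N.span {?w p, ?w q}) \<and>
      (\<forall>v\<in>N.span {?w p, ?w q}. v \<noteq> \<zero>\<^bsub>H.hull_space\<^esub> \<longrightarrow> (\<exists>z\<in>l. v \<in> N.span {?w z}))"
      using pq by blast
  qed
  obtain a' b' c' d' where "quadrangle \<Gamma> a' b' c' d'" using quadrangle_exists by blast
  then obtain l where l: "l \<in> lines \<Gamma>" by (auto simp: quadrangle_def collinear_def)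
  have "morphism \<Gamma> K V \<epsilon> K (H.hull_space\<lparr>carrier := N.span (?w ` points \<Gamma>)\<rparr>) (\<lambda>p. N.span {?w p})"
    using universal_morphism[OF univ emb' l] lines_sub by blast
  then obtain g where g: "semilinear K V K (H.hull_space\<lparr>carrier := N.span (?w ` points \<Gamma>)\<rparr>) g"
    and ge: "\<And>p. p \<in> points \<Gamma> \<Longrightarrow> g ` \<epsilon> p = N.span {?w p}"
    by (auto simp: morphism_def)
  obtain \<tau> where t: "\<tau> \<in> ring_iso K K"
    and gs: "\<And>a x. a \<in> carrier K \<Longrightarrow> x \<in> carrier V \<Longrightarrow> g (a \<cdot> x) = \<tau> a \<odot>\<^bsub>H.hull_space\<^esub> g x"
    using g by (auto simp: semilinear_def)
  have val: "\<exists>l\<in>carrier K. l \<noteq> \<zero> \<and> g u = (l \<cdot> u, ?z)" if u: "u \<in> ?C" "u \<noteq> 0\<^sub>v" for u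
  proof -
    have uV: "u \<in> carrier V" using u by blast
    obtain p where p: "p \<in> points \<Gamma>" "\<epsilon> p = span {u}" using cone_nonzeroD[OF u] by blast
    note pv = vec[OF p(1)]
    have im: "g ` span {u} = N.span {?w p}" using ge p by metis
    have "g u \<in> N.span {?w p}" using im span_base[of u "{u}"] by blast
    then obtain m where m: "m \<in> carrier K" "g u = (m \<cdot> vec p, ?z)" using single p by blast
    obtain d where d: "d \<in> carrier K" "vec p = d \<cdot> u"
      using span_singleton_eqD[of u "vec p"] p pv uV by auto
    have gu: "g u = ((m \<otimes> d) \<cdot> u, ?z)" using m d uV by (simp add: smult_assoc)
    have "m \<otimes> d \<noteq> \<zero>"
    proof
      assume "m \<otimes> d = \<zero>"
      then have g0: "g u = (0\<^sub>v, ?z)" using gu uV by simp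
      have "?w p \<in> g ` span {u}" using im N.span_base[of "?w p" "{?w p}"] by simp
      then obtain e where e: "e \<in> carrier K" "?w p = g (e \<cdot> u)" using span_singleton[OF uV] by auto
      have "g (e \<cdot> u) = (\<tau> e \<cdot> 0\<^sub>v, ?z)"
        using gs[OF e(1) uV] g0 sm[of "\<tau> e" "0\<^sub>v"] ring_iso_memE(1)[OF t e(1)] by simp
      then show False using e(2) pv(2) ring_iso_memE(1)[OF t e(1)] by simp
    qed
    then show ?thesis using gu m d by blast
  qed
  have aV: "a \<in> carrier V" and cV: "c \<in> carrier V" using a c by auto
  show ?thesis
  proof (cases "k = \<zero>")
    case True then show ?thesis by (intro bexI[of _ \<zero>]) (auto simp: K.minus_eq)
  next
    case False
    have nac: "\<not> cone_perp a c" using H.form_perp[OF a c] ac one_neq_zero by metis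
    have a0: "a \<noteq> 0\<^sub>v" "c \<noteq> 0\<^sub>v" using nac a c by auto
    let ?a = "k \<cdot> a"
    have ka: "?a \<in> ?C" "?a \<noteq> 0\<^sub>v" "?a \<in> carrier V" using smult_C[OF k a] smult_eq_zero k aV False a0 by auto
    have ind: "c \<notin> span {?a}"
    proof
      assume "c \<in> span {?a}"
      then obtain m where "m \<in> carrier K" "c = m \<cdot> ?a" using span_singleton ka by auto
      then show False using nac perp_smult perp_refl[OF a] k by blast
    qed
    have p0: "?a +\<^sub>v c \<noteq> 0\<^sub>v" using comb_nonzero[OF ka(3,2) cV ind K.one_closed] cV by simp
    obtain l1 where l1: "l1 \<in> carrier K" "g ?a = (l1 \<cdot> ?a, ?z)" using val[OF ka(1,2)] by blast
    obtain l2 where l2: "l2 \<in> carrier K" "g c = (l2 \<cdot> c, ?z)" using val[OF c a0(2)] by blast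
    obtain l3 where l3: "l3 \<in> carrier K" "l3 \<noteq> \<zero>" "g (?a +\<^sub>v c) = (l3 \<cdot> (?a +\<^sub>v c), ?z)"
      using val[OF kac p0] by blast
    have "g (?a +\<^sub>v c) = g ?a \<oplus>\<^bsub>H.hull_space\<^esub> g c" using semilinearD(2)[OF g ka(3) cV] by simp
    also have "\<dots> = (l1 \<cdot> ?a +\<^sub>v l2 \<cdot> c, H.rep (\<beta> (l1 \<cdot> ?a) (l2 \<cdot> c)))"
      using H.hull_add[of "l1 \<cdot> ?a" "l2 \<cdot> c" \<zero> \<zero>] l1 l2 ka cV by simp
    finally have e: "l3 \<cdot> ?a +\<^sub>v l3 \<cdot> c = l1 \<cdot> ?a +\<^sub>v l2 \<cdot> c" "?z = H.rep (\<beta> (l1 \<cdot> ?a) (l2 \<cdot> c))"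
      using l3 ka cV by (simp_all add: smult_r_distr)
    have ll: "l1 = l3" "l2 = l3" using pair_coeffs[OF ka(3,2) cV ind l3(1) l3(1) l1(1) l2(1) e(1)] by auto
    have "\<beta> (l1 \<cdot> ?a) (l2 \<cdot> c) = l3 \<otimes> k \<otimes> \<sigma> l3"
      using ll l3 aV cV k ac ka by (simp add: H.form_smult_l H.form_smult_r K.m_assoc)
    then have "H.teq (l3 \<otimes> k \<otimes> \<sigma> l3) \<zero>"
      using e(2) H.rep_eq[of "l3 \<otimes> k \<otimes> \<sigma> l3" \<zero>] l3 k by simp
    then have tr: "l3 \<otimes> k \<otimes> \<sigma> l3 \<in> H.traces" using l3 k by (simp add: H.teq_def K.minus_eq)
    have "\<sigma> l3 \<otimes> \<sigma> (inv l3) = \<one>" using l3 H.sigma_mult[of "inv l3" l3] H.sigma_one by simp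
    then have "inv l3 \<otimes> (l3 \<otimes> k \<otimes> \<sigma> l3) \<otimes> \<sigma> (inv l3) = k"
      using l3 k by (simp add: K.m_assoc K_cancel_l)
    then have "k \<in> H.traces" using H.traces_twist[OF tr, of "inv l3"] l3 by simp
    then show ?thesis by (auto simp: H.traces_def)
  qed
qed

end

section \<open>Subspaces spanned by a quadrangle\<close>

locale tight_cone = hermitian_cone +
  assumes tight: "a \<in> C \<Longrightarrow> c \<in> C \<Longrightarrow> k \<in> carrier K \<Longrightarrow> k \<cdot> a +\<^sub>v c \<in> C \<Longrightarrow> \<beta> a c = \<one> \<Longrightarrow>
    \<exists>t\<in>carrier K. k = t \<ominus> st t"
begin

text \<open>
  The points \<open>a + b\<close> and \<open>c - d\<close> on opposite sides of the quadrangle are collinear because of the normalisation, and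
  so \<open>t (a + b) + (c - d)\<close> is generated. It is collinear with \<open>d - st(t) a\<close> on the side \<open>da\<close>. The sum of
  these two vectors is \<open>(t - st(t)) a + c + t b\<close>, which is orthogonal to \<open>b\<close>; subtract \<open>t b\<close>.\<close>

lemma trace_point:
  assumes S: "csub S" and q: "quad a b c d" "{a, b, c, d} \<subseteq> S"
    and ac: "\<beta> a c = \<one>" and bd: "\<beta> b d = \<one>" and t: "t \<in> carrier K"
  shows "(t \<ominus> st t) \<cdot> a +\<^sub>v c \<in> S"
proof -
  have p: "a \<bottom> b" "b \<bottom> c" "c \<bottom> d" "d \<bottom> a" and C: "a \<in> C" "b \<in> C" "c \<in> C" "d \<in> C"
    using q by (auto simp: quad_def)
  have V: "a \<in> carrier V" "b \<in> carrier V" "c \<in> carrier V" "d \<in> carrier V" using C by auto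
  have z: "\<beta> a b = \<zero>" "\<beta> b a = \<zero>" "\<beta> b c = \<zero>" "\<beta> c b = \<zero>" "\<beta> c d = \<zero>" "\<beta> d c = \<zero>" "\<beta> d a = \<zero>" "\<beta> a d = \<zero>"
    "\<beta> a a = \<zero>" "\<beta> b b = \<zero>" "\<beta> d d = \<zero>"
    using p C form_zero_if_perp perp_sym perp_refl by blast+
  define d' where "d' = (\<ominus> \<one>) \<cdot> d"
  have d': "d' \<in> carrier V" "d' +\<^sub>v d = 0\<^sub>v"
    unfolding d'_def using V minus_smult[of d] V.l_neg[of d] by simp_all
  have ab: "a +\<^sub>v b \<in> S" using csubD(4)[OF S] q p by simp
  have cd: "c +\<^sub>v d' \<in> S" unfolding d'_def using csub_comb[OF S] q p by simp
  have "\<beta> (c +\<^sub>v d') (a +\<^sub>v b) = \<beta> c a \<oplus> (\<ominus> \<one>) \<otimes> \<beta> d b"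
    unfolding d'_def using V z by (simp add: form_add_l form_add_r form_smult_l)
  also have "\<dots> = st \<one> \<oplus> (\<ominus> \<one>) \<otimes> st \<one>" using form_sym[of a c] form_sym[of b d] V ac bd by simp
  also have "\<dots> = \<zero>" by (simp add: K.l_minus K.r_neg)
  finally have "c +\<^sub>v d' \<bottom> a +\<^sub>v b" using form_perp ab cd csubD(1)[OF S] by blast
  then have X: "(c +\<^sub>v d') +\<^sub>v t \<cdot> (a +\<^sub>v b) \<in> S" (is "?X \<in> S") using csub_comb[OF S cd ab _ t] by blast
  let ?k = "\<ominus> (st t)"
  have A: "d +\<^sub>v ?k \<cdot> a \<in> S" (is "?A \<in> S") using csub_comb[OF S, of d a ?k] q p t by simp
  have sk: "st \<one> \<otimes> \<sigma> ?k = \<ominus> t"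
    using st_mult[of ?k \<one> \<one>] t by (simp add: sigma_one st_minus)
  have "\<beta> ?X ?A = t \<oplus> \<beta> c a \<otimes> \<sigma> ?k"
    unfolding d'_def using V z t bd by (simp add: form_add_l form_add_r form_smult_l form_smult_r)
  also have "\<dots> = \<zero>" using form_sym[of a c] V ac sk t by (simp add: K.r_neg)
  finally have XA: "?X \<bottom> ?A" using form_perp X A csubD(1)[OF S] by blast
  have Y: "?X +\<^sub>v ?A \<in> S" using csubD(4)[OF S X A XA] .
  let ?p = "(t \<ominus> st t) \<cdot> a +\<^sub>v c"
  have pV: "?p \<in> carrier V" using V t by simp
  have "?X +\<^sub>v ?A = (d' +\<^sub>v d) +\<^sub>v (((t \<cdot> a +\<^sub>v ?k \<cdot> a) +\<^sub>v c) +\<^sub>v t \<cdot> b)"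
    using V d'(1) t by (simp add: smult_r_distr V.a_ac)
  also have "\<dots> = ?p +\<^sub>v t \<cdot> b" using V d'(2) t by (simp add: K.minus_eq smult_l_distr)
  finally have Yp: "?p +\<^sub>v t \<cdot> b \<in> S" using Y by simp
  have "\<beta> b (?p +\<^sub>v t \<cdot> b) = \<zero>" using V z t by (simp add: form_add_r form_smult_r)
  then have bp: "b \<bottom> ?p +\<^sub>v t \<cdot> b" using form_perp[OF C(2)] Yp csubD(1)[OF S] by blast
  have "?p \<bottom> b" using C_cancel(2)[OF pV C(2) t bp] .
  then show ?thesis using csub_cancel[OF S Yp] q t by simp
qed

lemma hyperbolic_line:
  assumes S: "csub S" and q: "quad a b c d" "{a, b, c, d} \<subseteq> S"
    and ac: "\<beta> a c = \<one>" and bd: "\<beta> b d = \<one>"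
    and x: "x \<in> carrier K" "y \<in> carrier K" "x \<cdot> a +\<^sub>v y \<cdot> c \<in> C"
  shows "x \<cdot> a +\<^sub>v y \<cdot> c \<in> S"
proof -
  have C: "a \<in> C" "c \<in> C" using q by (auto simp: quad_def)
  then have V: "a \<in> carrier V" "c \<in> carrier V" by auto
  show ?thesis
  proof (cases "y = \<zero>")
    case True then show ?thesis using x V q csubD(3)[OF S] by simp
  next
    case False
    have e: "inv y \<cdot> (x \<cdot> a +\<^sub>v y \<cdot> c) = (inv y \<otimes> x) \<cdot> a +\<^sub>v c"
      using V x False by (simp add: smult_r_distr smult_assoc[symmetric] smult_inv)
    have "(inv y \<otimes> x) \<cdot> a +\<^sub>v c \<in> C" using smult_C[OF _ x(3), of "inv y"] e x False by simp
    then obtain t where "t \<in> carrier K" "inv y \<otimes> x = t \<ominus> st t"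
      using tight[OF C _ _ ac, of "inv y \<otimes> x"] x False by auto
    then have "(inv y \<otimes> x) \<cdot> a +\<^sub>v c \<in> S" using trace_point[OF S q ac bd] by simp
    then have "inv y \<cdot> (x \<cdot> a +\<^sub>v y \<cdot> c) \<in> S" using e by simp
    then show ?thesis using csub_smult_cancel[OF S _ _ _ C_in[OF x(3)]] x False by simp
  qed
qed

text \<open>
  Let \<open>p\<close> be a point in the span of the quadrangle that is not collinear with \<open>a\<close>. Projecting \<open>p\<close> from the point of the side
  \<open>da\<close> collinear with it removes the coordinate at \<open>d\<close>, and what remains is orthogonal to \<open>b\<close>. Projecting from \<open>b\<close>
  then leads to the hyperbolic line through \<open>a\<close> and \<open>c\<close>. If \<open>p\<close> is collinear with \<open>a\<close>, projecting from \<open>a\<close> leads to the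
  hyperbolic line through \<open>b\<close> and \<open>d\<close> at once.\<close>

lemma quad_span_normalized:
  assumes S: "csub S" and q: "quad a b c d" "{a, b, c, d} \<subseteq> S"
    and ac: "\<beta> a c = \<one>" and bd: "\<beta> b d = \<one>"
    and p: "p \<in> C" "p \<in> span {a, b, c, d}"
  shows "p \<in> S"
proof -
  have o: "a \<bottom> b" "b \<bottom> c" "c \<bottom> d" "d \<bottom> a" and C: "a \<in> C" "b \<in> C" "c \<in> C" "d \<in> C"
    using q by (auto simp: quad_def)
  have V: "a \<in> carrier V" "b \<in> carrier V" "c \<in> carrier V" "d \<in> carrier V" using C by auto
  have z: "\<beta> b a = \<zero>" "\<beta> b c = \<zero>" "\<beta> a a = \<zero>" "\<beta> b b = \<zero>" "\<beta> d a = \<zero>"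
    using o C form_zero_if_perp perp_sym perp_refl by blast+
  obtain x1 u1 where x1: "x1 \<in> carrier K" "u1 \<in> span {b, c, d}" "p = x1 \<cdot> a +\<^sub>v u1"
    using p(2) by (rule span_insertE) (use V in auto)
  obtain x3 u2 where x3: "x3 \<in> carrier K" "u2 \<in> span {c, d}" "u1 = x3 \<cdot> b +\<^sub>v u2"
    using x1(2) by (rule span_insertE) (use V in auto)
  obtain x2 x4 where x: "x2 \<in> carrier K" "x4 \<in> carrier K" "u2 = x2 \<cdot> c +\<^sub>v x4 \<cdot> d"
    using x3(2) V by (auto simp: span_pair)
  have pe: "p = x1 \<cdot> a +\<^sub>v (x3 \<cdot> b +\<^sub>v (x2 \<cdot> c +\<^sub>v x4 \<cdot> d))" using x1 x3 x by simp
  show ?thesis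
  proof (cases "p \<bottom> a")
    case False
    then obtain k where k: "k \<in> carrier K" "p \<bottom> d +\<^sub>v k \<cdot> a" using one_or_all[OF p(1) o(4)] by blast
    let ?A = "d +\<^sub>v k \<cdot> a" and ?m = "\<ominus> x4"
    have A: "?A \<in> S" using csub_comb[OF S] q o k by simp
    let ?r = "(x1 \<oplus> ?m \<otimes> k) \<cdot> a +\<^sub>v x2 \<cdot> c"
    have pC: "p +\<^sub>v ?m \<cdot> ?A \<in> C" using comb_C k x by simp
    have "x4 \<cdot> d +\<^sub>v ?m \<cdot> d = 0\<^sub>v" using x V by (simp add: smult_l_distr[symmetric] K.r_neg)
    moreover have "p +\<^sub>v ?m \<cdot> ?A = (x4 \<cdot> d +\<^sub>v ?m \<cdot> d) +\<^sub>v (((x1 \<cdot> a +\<^sub>v ?m \<cdot> (k \<cdot> a)) +\<^sub>v x2 \<cdot> c) +\<^sub>v x3 \<cdot> b)"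
      unfolding pe using V x1(1) x3(1) x(1,2) k(1) by (simp add: smult_r_distr V.a_ac)
    ultimately have e: "p +\<^sub>v ?m \<cdot> ?A = ?r +\<^sub>v x3 \<cdot> b"
      using V x1(1) x3(1) x(1,2) k(1) by (simp add: smult_l_distr smult_assoc)
    have rV: "?r \<in> carrier V" using V x1 x k by simp
    have "\<beta> b (?r +\<^sub>v x3 \<cdot> b) = \<zero>" using V z x1 x3(1) x k by (simp add: form_add_r form_smult_r)
    then have bp: "b \<bottom> ?r +\<^sub>v x3 \<cdot> b" using form_perp[OF C(2)] pC e by simp
    have r: "?r \<in> C" "?r \<bottom> b" using C_cancel[OF rV C(2) x3(1) bp] by auto
    have "?r \<in> S" using hyperbolic_line[OF S q ac bd _ x(1) r(1)] x1 x k by simp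
    then have "?r +\<^sub>v x3 \<cdot> b \<in> S" using csub_comb[OF S] r q x3 by simp
    then have "p +\<^sub>v ?m \<cdot> ?A \<in> S" using e by simp
    then show ?thesis using csub_cancel[OF S _ A k(2)] x by simp
  next
    case True
    have "\<beta> p a = x2 \<otimes> \<beta> c a" unfolding pe using V z x1(1) x3(1) x(1,2) by (simp add: form_add_l form_smult_l)
    then have "x2 \<otimes> st \<one> = \<zero>" using form_zero_if_perp[OF True] form_sym[of a c] V ac by simp
    moreover have "st \<one> \<noteq> \<zero>" using st_st[OF K.one_closed] st_zero one_neq_zero by metis
    ultimately have x20: "x2 = \<zero>" using K_integral[of x2 "st \<one>"] x by simp
    let ?r = "x3 \<cdot> b +\<^sub>v x4 \<cdot> d"
    have e: "p = ?r +\<^sub>v x1 \<cdot> a" unfolding pe using x20 V x1(1) x3(1) x(1,2) by (simp add: V.a_comm)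
    have rV: "?r \<in> carrier V" using V x3 x by simp
    have "a \<bottom> ?r +\<^sub>v x1 \<cdot> a" using True perp_sym e by simp
    then have r: "?r \<in> C" "?r \<bottom> a" using C_cancel[OF rV C(1) x1(1)] by auto
    have "?r \<in> S" using hyperbolic_line[OF S quad_reflect[OF q(1)] _ bd ac x3(1) x(2) r(1)] q(2) by auto
    then show ?thesis unfolding e using csub_comb[OF S] r q x1 by simp
  qed
qed

lemma quad_span:
  assumes S: "csub S" and q: "quad a b c d" "{a, b, c, d} \<subseteq> S" and p: "p \<in> C" "p \<in> span {a, b, c, d}"
  shows "p \<in> S"
proof -
  have o: "a \<bottom> b" "b \<bottom> c" "c \<bottom> d" "d \<bottom> a" "\<not> a \<bottom> c" "\<not> b \<bottom> d"
    and C: "a \<in> C" "b \<in> C" "c \<in> C" "d \<in> C"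
    using q by (auto simp: quad_def)
  have V: "a \<in> carrier V" "b \<in> carrier V" "c \<in> carrier V" "d \<in> carrier V" using C by auto
  have t: "\<beta> a c \<in> carrier K" "\<beta> a c \<noteq> \<zero>" "\<beta> b d \<in> carrier K" "\<beta> b d \<noteq> \<zero>"
    using V form_perp C o by auto
  define k l where "k = inv (\<beta> a c)" and "l = inv (\<beta> b d)"
  have kl: "k \<in> carrier K" "k \<noteq> \<zero>" "l \<in> carrier K" "l \<noteq> \<zero>" using t by (auto simp: k_def l_def)
  have norm: "\<beta> (k \<cdot> a) c = \<one>" "\<beta> (l \<cdot> b) d = \<one>"
    using V t kl by (simp_all add: form_smult_l k_def l_def)
  have "k \<cdot> a \<bottom> l \<cdot> b" "l \<cdot> b \<bottom> c" "d \<bottom> k \<cdot> a"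
    using o kl by (simp_all add: perp_smult perp_smult_l)
  moreover have "\<not> k \<cdot> a \<bottom> c" "\<not> l \<cdot> b \<bottom> d" using norm form_zero_if_perp one_neq_zero by metis+
  ultimately have q': "quad (k \<cdot> a) (l \<cdot> b) c d" using C o smult_C kl by (simp add: quad_def)
  have S': "{k \<cdot> a, l \<cdot> b, c, d} \<subseteq> S" using csubD(3)[OF S] kl q by simp
  have sub: "{k \<cdot> a, l \<cdot> b, c, d} \<subseteq> carrier V" using V kl by simp
  have s: "subsp (span {k \<cdot> a, l \<cdot> b, c, d})" using subsp_span[OF sub] .
  have "a \<in> span {k \<cdot> a, l \<cdot> b, c, d}"
    using subsp_smult_cancel[OF s kl(1,2) V(1)] by (simp add: span_base)
  moreover have "b \<in> span {k \<cdot> a, l \<cdot> b, c, d}"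
    using subsp_smult_cancel[OF s kl(3,4) V(2)] by (simp add: span_base)
  ultimately have "span {a, b, c, d} \<subseteq> span {k \<cdot> a, l \<cdot> b, c, d}"
    using span_span_least[OF _ sub] by (simp add: span_base)
  then show ?thesis using quad_span_normalized[OF S q' S' norm p(1)] p(2) by blast
qed

text \<open>
  Let \<open>p = u + s\<close>. If \<open>p \<bottom> s\<close>, then \<open>u = p - s\<close> is a point of \<open>U\<close> collinear with \<open>s\<close>, and \<open>p\<close> is on
  the line joining them. If some point \<open>t\<close> of \<open>U\<close> is collinear with \<open>p\<close> but not with \<open>s\<close>, then the line \<open>pt\<close> has a
  point collinear with \<open>s\<close>, to which the first case applies; and likewise with \<open>p\<close> and \<open>s\<close> exchanged. There remains the case
  that \<open>p\<close> and \<open>s\<close> are collinear with the same points of \<open>U\<close>. Among these there are non-collinear \<open>t\<close> and \<open>t'\<close>, because of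
  the quadrangle. Replacing \<open>s\<close> by \<open>s + t\<close> leads back to the second case, since \<open>t'\<close> is not collinear with \<open>s + t\<close>.\<close>

lemma extend_span:
  assumes S: "csub S" and U: "subsp U" and CU: "C \<inter> U \<subseteq> S"
    and q: "quad a b c d" "{a, b, c, d} \<subseteq> U"
    and s: "s \<in> S" and u: "u \<in> U" and p: "u +\<^sub>v s \<in> C"
  shows "u +\<^sub>v s \<in> S"
proof -
  note UD = subspD[OF U]
  have SC: "x \<in> S \<Longrightarrow> x \<in> C" for x using csubD(1)[OF S] by blast
  have T: "csub (C \<inter> U)" using csub_subsp[OF U] .
  have UV: "x \<in> U \<Longrightarrow> x \<in> carrier V" for x using UD(1) by blast
  have case1: "u +\<^sub>v s \<in> S" if "s \<in> S" "u \<in> U" "u +\<^sub>v s \<bottom> s" for u s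
  proof -
    have sC: "s \<in> C" using SC that by blast
    have e: "u +\<^sub>v \<one> \<cdot> s = u +\<^sub>v s" using sC by simp
    have "u \<in> C" "u \<bottom> s"
      using C_cancel[OF UV[OF that(2)] sC K.one_closed] perp_sym[OF that(3)] e by auto
    then show ?thesis using csubD(4)[OF S] CU that by blast
  qed
  have case2: "u +\<^sub>v s \<in> S"
    if A: "s \<in> S" "u \<in> U" "t \<in> C \<inter> U" "t \<bottom> u +\<^sub>v s" "\<not> t \<bottom> s" for u s t
  proof -
    let ?p = "u +\<^sub>v s"
    have pt: "?p \<bottom> t" using A perp_sym by blast
    have "\<not> s \<bottom> t" using A perp_sym by blast
    then obtain k where k: "k \<in> carrier K" "s \<bottom> ?p +\<^sub>v k \<cdot> t"
      using one_or_all[OF SC[OF A(1)] pt] by blast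
    have e: "?p +\<^sub>v k \<cdot> t = (u +\<^sub>v k \<cdot> t) +\<^sub>v s"
      using UV A(2,3) SC[OF A(1)] k by (simp add: V.a_ac)
    have "u +\<^sub>v k \<cdot> t \<in> U" using UD(3,4) A k by blast
    then have "?p +\<^sub>v k \<cdot> t \<in> S" using case1[OF A(1)] perp_sym[OF k(2)] e by simp
    then show ?thesis using csub_cancel[OF S _ _ pt k(1)] CU A by blast
  qed
  have case3: "u +\<^sub>v s \<in> S"
    if A: "s \<in> S" "u \<in> U" "t \<in> C \<inter> U" "t \<bottom> s" "\<not> t \<bottom> u +\<^sub>v s" "u +\<^sub>v s \<in> C" for u s t
  proof -
    let ?p = "u +\<^sub>v s"
    have st': "s \<bottom> t" "\<not> ?p \<bottom> t" using A perp_sym by blast+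
    then obtain k where k: "k \<in> carrier K" "?p \<bottom> s +\<^sub>v k \<cdot> t" using one_or_all[OF A(6)] by blast
    have xS: "s +\<^sub>v k \<cdot> t \<in> S" using csub_comb[OF S A(1) _ st'(1) k(1)] CU A by blast
    have V: "u \<in> carrier V" "t \<in> carrier V" "s \<in> carrier V" using UV A(2,3) SC[OF A(1)] by auto
    have "(u +\<^sub>v (\<ominus> k) \<cdot> t) +\<^sub>v (s +\<^sub>v k \<cdot> t) = ?p +\<^sub>v (k \<cdot> t +\<^sub>v (\<ominus> k) \<cdot> t)"
      using V k(1) by (simp add: V.a_ac)
    also have "\<dots> = ?p" using V k(1) by (simp add: smult_l_distr[symmetric] K.r_neg)
    finally have e: "(u +\<^sub>v (\<ominus> k) \<cdot> t) +\<^sub>v (s +\<^sub>v k \<cdot> t) = ?p" .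
    have "u +\<^sub>v (\<ominus> k) \<cdot> t \<in> U" using UD(3,4) A k by simp
    then show ?thesis using case1[OF xS] k(2) e by metis
  qed
  have abcd: "{a, b, c, d} \<subseteq> C \<inter> U" using q by (simp add: quad_def)
  obtain t t' where t: "t \<in> C \<inter> U" "t' \<in> C \<inter> U" "t \<bottom> s" "t' \<bottom> s" "\<not> t \<bottom> t'"
    using quad_noncollinear_perp_pair[OF T q(1) abcd SC[OF s]] by blast
  let ?p = "u +\<^sub>v s"
  show ?thesis
  proof (cases "t \<bottom> ?p \<and> t' \<bottom> ?p")
    case False
    then show ?thesis using case3[OF s u _ _ _ p] t by blast
  next
    case True
    let ?q = "s +\<^sub>v \<one> \<cdot> t"
    have st': "s \<bottom> t" using t perp_sym by blast
    have qS: "?q \<in> S" using csub_comb[OF S s _ st'] CU t by blast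
    have V: "u \<in> carrier V" "t \<in> carrier V" "s \<in> carrier V" using UV u t SC[OF s] by auto
    have "(u +\<^sub>v (\<ominus> \<one>) \<cdot> t) +\<^sub>v ?q = ?p +\<^sub>v (\<one> \<cdot> t +\<^sub>v (\<ominus> \<one>) \<cdot> t)"
      using V by (simp add: V.a_ac)
    also have "\<dots> = ?p" using V by (simp only: smult_l_distr[symmetric] K.one_closed K.a_inv_closed) (simp add: K.r_neg)
    finally have e: "(u +\<^sub>v (\<ominus> \<one>) \<cdot> t) +\<^sub>v ?q = ?p" .
    have uU: "u +\<^sub>v (\<ominus> \<one>) \<cdot> t \<in> U" using UD(3,4) u t by simp
    have "\<not> t' \<bottom> ?q"
      using perp_cancel2[of t' s \<one> t] t st' one_neq_zero perp_sym by blast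
    then show ?thesis using case2[OF qS uU t(2)] True e by simp
  qed
qed

theorem csub_spanned:
  assumes S: "csub S" and q: "quad a b c d" "{a, b, c, d} \<subseteq> S" and p: "p \<in> C" "p \<in> span S"
  shows "p \<in> S"
proof -
  have SV: "S \<subseteq> carrier V" using csubD(1)[OF S] by auto
  have main: "C \<inter> span (F \<union> {a, b, c, d}) \<subseteq> S" if "finite F" "F \<subseteq> S" for F
    using that
  proof (induction F)
    case empty
    then show ?case using quad_span[OF S q] by auto
  next
    case (insert s F)
    let ?B = "F \<union> {a, b, c, d}"
    have B: "?B \<subseteq> carrier V" using insert q SV by auto
    have U: "subsp (span ?B)" using subsp_span[OF B] .
    have IH: "C \<inter> span ?B \<subseteq> S" using insert by simp
    have qU: "{a, b, c, d} \<subseteq> span ?B" using span_superset[of ?B] by blast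
    show ?case
    proof
      fix x assume x: "x \<in> C \<inter> span (insert s F \<union> {a, b, c, d})"
      then have "x \<in> span (insert s ?B)" by (simp add: insert_commute)
      then obtain k u where ku: "k \<in> carrier K" "u \<in> span ?B" "x = k \<cdot> s +\<^sub>v u"
        by (rule span_insertE) (use insert SV B in auto)
      have V: "u \<in> carrier V" "k \<cdot> s \<in> carrier V" using ku subspD(1)[OF U] insert SV by auto
      have "x = u +\<^sub>v k \<cdot> s" using ku V by (simp add: V.a_comm)
      moreover have "k \<cdot> s \<in> S" using csubD(3)[OF S] insert ku by simp
      ultimately show "x \<in> S" using extend_span[OF S U IH q(1) qU _ ku(2)] x by simp
    qed
  qed
  obtain F where F: "F \<subseteq> S" "finite F" "p \<in> span F" using span_finitary[OF p(2) SV] by blast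
  then have "p \<in> span (F \<union> {a, b, c, d})" using span_mono[of F "F \<union> {a, b, c, d}"] by blast
  then show ?thesis using main F p(1) by blast
qed

end

section \<open>Generation and linear span\<close>

context embedded_polar_space
begin

definition linear_closure :: "'p set \<Rightarrow> 'p set" where
  "linear_closure A = {p \<in> points \<Gamma>. vec p \<in> span (vec ` A)}"

lemma vec_image_carrier: "A \<subseteq> points \<Gamma> \<Longrightarrow> vec ` A \<subseteq> carrier V"
  using vec_carrier by auto

sublocale lin: exchange_closure "points \<Gamma>" linear_closure
proof
  fix A assume A: "A \<subseteq> points \<Gamma>"
  show "linear_closure A \<subseteq> points \<Gamma>" by (auto simp: linear_closure_def)
  show "A \<subseteq> linear_closure A" using A by (auto simp: linear_closure_def intro: span_base)
  have "vec ` linear_closure A \<subseteq> span (vec ` A)" by (auto simp: linear_closure_def)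
  then have "span (vec ` linear_closure A) \<subseteq> span (vec ` A)"
    using span_span_least vec_image_carrier[OF A] by blast
  then show "linear_closure (linear_closure A) \<subseteq> linear_closure A" by (auto simp: linear_closure_def)
  show "\<exists>F\<subseteq>A. finite F \<and> x \<in> linear_closure F" if x: "x \<in> linear_closure A" for x
  proof -
    obtain G where G: "G \<subseteq> vec ` A" "finite G" "vec x \<in> span G"
      using span_finitary[OF _ vec_image_carrier[OF A]] x by (auto simp: linear_closure_def)
    then obtain F where "F \<subseteq> A" "finite F" "G = vec ` F" by (meson finite_subset_image)
    then show ?thesis using G x by (auto simp: linear_closure_def)
  qed
  show "x \<in> linear_closure (insert y A)"
    if "x \<in> points \<Gamma>" "y \<in> linear_closure (insert x A)" "y \<notin> linear_closure A" for x y
    using that span_exchange[OF vec_image_carrier[OF A] vec_carrier[OF that(1)], of "vec y"]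
    by (auto simp: linear_closure_def)
next
  fix A B assume "A \<subseteq> B" "B \<subseteq> points \<Gamma>"
  then show "linear_closure A \<subseteq> linear_closure B"
    using span_mono[of "vec ` A" "vec ` B"] by (auto simp: linear_closure_def)
qed

lemma geom_subspace_points: "geom_subspace \<Gamma> (points \<Gamma>)"
  using lines_sub by (auto simp: geom_subspace_def)

lemma geom_subspaceD:
  "geom_subspace \<Gamma> S \<Longrightarrow> l \<in> lines \<Gamma> \<Longrightarrow> p \<in> l \<Longrightarrow> q \<in> l \<Longrightarrow> p \<in> S \<Longrightarrow> q \<in> S \<Longrightarrow> p \<noteq> q \<Longrightarrow> l \<subseteq> S"
  unfolding geom_subspace_def by blast

lemma geom_subspaceI:
  assumes "S \<subseteq> points \<Gamma>"
    "\<And>l p q r. l \<in> lines \<Gamma> \<Longrightarrow> p \<in> l \<Longrightarrow> q \<in> l \<Longrightarrow> p \<in> S \<Longrightarrow> q \<in> S \<Longrightarrow> p \<noteq> q \<Longrightarrow> r \<in> l \<Longrightarrow> r \<in> S"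
  shows "geom_subspace \<Gamma> S"
  unfolding geom_subspace_def
proof (intro conjI ballI impI)
  fix l assume l: "l \<in> lines \<Gamma>" and "\<exists>x\<in>l \<inter> S. \<exists>y\<in>l \<inter> S. x \<noteq> y"
  then obtain p q where "p \<in> l" "p \<in> S" "q \<in> l" "q \<in> S" "p \<noteq> q" by blast
  then show "l \<subseteq> S" using assms(2) l by blast
qed (rule assms(1))

lemma geom_subspace_Inter:
  assumes "\<T> \<noteq> {}" "\<And>T. T \<in> \<T> \<Longrightarrow> geom_subspace \<Gamma> T"
  shows "geom_subspace \<Gamma> (\<Inter>\<T>)"
proof (rule geom_subspaceI)
  show "\<Inter>\<T> \<subseteq> points \<Gamma>" using assms by (auto simp: geom_subspace_def)
  fix l p q r assume l: "l \<in> lines \<Gamma>" "p \<in> l" "q \<in> l" "p \<in> \<Inter>\<T>" "q \<in> \<Inter>\<T>" "p \<noteq> q" "r \<in> l"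
  have "r \<in> T" if T: "T \<in> \<T>" for T
    using geom_subspaceD[OF assms(2)[OF T] l(1-3) _ _ l(6)] l(4,5,7) T by blast
  then show "r \<in> \<Inter>\<T>" by blast
qed

lemma geom_subspace_Int: "geom_subspace \<Gamma> S \<Longrightarrow> geom_subspace \<Gamma> T \<Longrightarrow> geom_subspace \<Gamma> (S \<inter> T)"
  using geom_subspace_Inter[of "{S, T}"] by auto

lemma geom_subspace_gen:
  assumes "A \<subseteq> points \<Gamma>"
  shows "geom_subspace \<Gamma> (gen \<Gamma> A)"
  unfolding gen_def hull_def using assms geom_subspace_points by (intro geom_subspace_Inter) auto

lemma gen_superset: "A \<subseteq> gen \<Gamma> A"
  by (simp add: gen_def hull_subset)

lemma gen_least: "A \<subseteq> S \<Longrightarrow> geom_subspace \<Gamma> S \<Longrightarrow> gen \<Gamma> A \<subseteq> S"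
  by (simp add: gen_def hull_minimal)

lemma gen_mono: "A \<subseteq> B \<Longrightarrow> gen \<Gamma> A \<subseteq> gen \<Gamma> B"
  by (simp add: gen_def hull_mono)

lemma gen_points: "A \<subseteq> points \<Gamma> \<Longrightarrow> gen \<Gamma> A \<subseteq> points \<Gamma>"
  using gen_least geom_subspace_points by blast

lemma gen_finitary:
  assumes A: "A \<subseteq> points \<Gamma>" and x: "x \<in> gen \<Gamma> A"
  shows "\<exists>F\<subseteq>A. finite F \<and> x \<in> gen \<Gamma> F"
proof -
  let ?T = "{x. \<exists>F\<subseteq>A. finite F \<and> x \<in> gen \<Gamma> F}"
  have "geom_subspace \<Gamma> ?T"
  proof (rule geom_subspaceI)
    show "?T \<subseteq> points \<Gamma>" using gen_points A by blast
    fix l p q r assume l: "l \<in> lines \<Gamma>" "p \<in> l" "q \<in> l" "p \<noteq> q" "r \<in> l" and "p \<in> ?T" "q \<in> ?T"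
    then obtain F G where F: "F \<subseteq> A" "finite F" "p \<in> gen \<Gamma> F" and G: "G \<subseteq> A" "finite G" "q \<in> gen \<Gamma> G"
      by blast
    have "p \<in> gen \<Gamma> (F \<union> G)" "q \<in> gen \<Gamma> (F \<union> G)" 
      using subsetD[OF gen_mono[of F "F \<union> G"] F(3)] subsetD[OF gen_mono[of G "F \<union> G"] G(3)] by auto
    moreover have "geom_subspace \<Gamma> (gen \<Gamma> (F \<union> G))" by (rule geom_subspace_gen) (use F G A in auto)
    ultimately have "r \<in> gen \<Gamma> (F \<union> G)" 
      using geom_subspaceD[of "gen \<Gamma> (F \<union> G)" l p q] l by auto
    moreover have "F \<union> G \<subseteq> A" "finite (F \<union> G)" using F G by auto
    ultimately show "r \<in> ?T" by blast
  qed
  moreover have "A \<subseteq> ?T"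
  proof
    fix a assume "a \<in> A"
    then have "{a} \<subseteq> A" "finite {a}" "a \<in> gen \<Gamma> {a}" using gen_superset[of "{a}"] by auto
    then show "a \<in> ?T" by blast
  qed
  ultimately show ?thesis using gen_least x by blast
qed

lemma geom_subspace_linear_closure:
  assumes A: "A \<subseteq> points \<Gamma>"
  shows "geom_subspace \<Gamma> (linear_closure A)"
proof (rule geom_subspaceI)
  show "linear_closure A \<subseteq> points \<Gamma>" using lin.cl_into[OF A] .
  fix l p q r assume l: "l \<in> lines \<Gamma>" "p \<in> l" "q \<in> l" "p \<noteq> q" "r \<in> l"
    and "p \<in> linear_closure A" "q \<in> linear_closure A"
  then have p: "p \<in> points \<Gamma>" "vec p \<in> span (vec ` A)" and q: "q \<in> points \<Gamma>" "vec q \<in> span (vec ` A)"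
    by (auto simp: linear_closure_def)
  have r: "r \<in> points \<Gamma>" using l lines_sub by blast
  have c: "vec ` A \<subseteq> carrier V" using vec_image_carrier[OF A] .
  have "vec r \<in> span (vec ` A)"
    using vec_in_line_span[OF l(1-5)] span_span_least[of "{vec p, vec q}"] p q c by blast
  then show "r \<in> linear_closure A" using r by (simp add: linear_closure_def)
qed

lemma gen_subset_linear_closure: "A \<subseteq> points \<Gamma> \<Longrightarrow> gen \<Gamma> A \<subseteq> linear_closure A"
  by (rule gen_least[OF lin.cl_extensive geom_subspace_linear_closure])

lemma geom_subspace_perp: "geom_subspace \<Gamma> (perp \<Gamma> A)" if "A \<subseteq> points \<Gamma>"
proof (rule geom_subspaceI)
  show "perp \<Gamma> A \<subseteq> points \<Gamma>" by (auto simp: perp_def)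
  fix l p q r assume l: "l \<in> lines \<Gamma>" "p \<in> l" "q \<in> l" "p \<in> perp \<Gamma> A" "q \<in> perp \<Gamma> A" "p \<noteq> q" "r \<in> l"
  then have "collinear \<Gamma> a r" if "a \<in> A" for a
    using all_if_two[of a l p q r] that \<open>A \<subseteq> points \<Gamma>\<close> by (auto simp: perp_def)
  then show "r \<in> perp \<Gamma> A" using l lines_sub by (auto simp: perp_def)
qed

text \<open>
  The vectors representing a singular subspace are pairwise orthogonal, so that they form a linear subspace
  and the geometry of a singular subspace is governed by linear algebra.\<close>

lemma gen_eq_linear_closure_singular:
  assumes M: "geom_subspace \<Gamma> M" "singular \<Gamma> M" and A: "A \<subseteq> M"
  shows "gen \<Gamma> A = linear_closure A"
proof
  have MP: "M \<subseteq> points \<Gamma>" using M by (simp add: geom_subspace_def)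
  then have AP: "A \<subseteq> points \<Gamma>" using A by blast
  then show "gen \<Gamma> A \<subseteq> linear_closure A" by (rule gen_subset_linear_closure)
  have GM: "gen \<Gamma> A \<subseteq> M" using gen_least A M by blast
  have GP: "gen \<Gamma> A \<subseteq> points \<Gamma>" using GM MP by blast
  have cs: "csub (cone (gen \<Gamma> A))" by (rule csub_cone[OF geom_subspace_gen[OF AP]])
  note c = csubD[OF cs]
  have "subsp (cone (gen \<Gamma> A))"
  proof (rule subspI)
    fix v w assume v: "v \<in> cone (gen \<Gamma> A)" and w: "w \<in> cone (gen \<Gamma> A)"
    have vw: "cone_perp v w"
    proof (cases "v = 0\<^sub>v \<or> w = 0\<^sub>v")
      case True then show ?thesis using c(1) v w by auto
    next
      case False
      obtain p where p: "p \<in> gen \<Gamma> A" "\<epsilon> p = span {v}" using cone_nonzeroD v False by blast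
      obtain q where q: "q \<in> gen \<Gamma> A" "\<epsilon> q = span {w}" using cone_nonzeroD w False by blast
      have "p \<in> M" "q \<in> M" using p q GM by auto
      then have "collinear \<Gamma> p q" using M(2) unfolding singular_def perp_def by blast
      then show ?thesis
        using cone_perp_iff[of p q v w] p q v w GP cone_carrier[of "gen \<Gamma> A"] by blast
    qed
    show "v +\<^sub>v w \<in> cone (gen \<Gamma> A)" using c(4)[OF v w vw] .
  qed (use c cone_carrier in auto)
  moreover have "vec ` A \<subseteq> cone (gen \<Gamma> A)"
    
  proof
    fix v assume "v \<in> vec ` A"
    then obtain p where p: "p \<in> A" "v = vec p" by blast
    then have "p \<in> points \<Gamma>" "p \<in> gen \<Gamma> A" using AP gen_superset by auto
    then show "v \<in> cone (gen \<Gamma> A)" using coneI[OF vec_carrier _ eps_vec] p(2) by simp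
  qed
  ultimately have "span (vec ` A) \<subseteq> cone (gen \<Gamma> A)" by (simp add: span_least)
  then show "linear_closure A \<subseteq> gen \<Gamma> A"
    using cone_iff_point[OF GP _ eps_vec vec_carrier] by (auto simp: linear_closure_def)
qed

section \<open>Quadrangles in subspaces of non-degenerate rank at least 2\<close>

lemma collinear_inducedD: "collinear (induced \<Gamma> S) p q \<Longrightarrow> collinear \<Gamma> p q"
  by (auto simp: collinear_def induced_def)

lemma geom_subspace_induced:
  assumes S: "geom_subspace \<Gamma> S"
  shows "geom_subspace (induced \<Gamma> S) T \<longleftrightarrow> T \<subseteq> S \<and> geom_subspace \<Gamma> T"
proof
  assume T: "geom_subspace (induced \<Gamma> S) T"
  then have TS: "T \<subseteq> S" by (simp add: geom_subspace_def induced_def)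
  have "l \<subseteq> T" if l: "l \<in> lines \<Gamma>" "p \<in> l" "q \<in> l" "p \<in> T" "q \<in> T" "p \<noteq> q" for l p q
  proof -
    have "l \<subseteq> S" using geom_subspaceD[OF S l(1-3)] TS l by blast
    then have "l \<in> lines (induced \<Gamma> S)" using l by (simp add: induced_def)
    then show ?thesis using T l unfolding geom_subspace_def by blast
  qed
  moreover have "T \<subseteq> points \<Gamma>" using TS S by (auto simp: geom_subspace_def)
  ultimately show "T \<subseteq> S \<and> geom_subspace \<Gamma> T" using TS unfolding geom_subspace_def by blast
next
  assume "T \<subseteq> S \<and> geom_subspace \<Gamma> T"
  then show "geom_subspace (induced \<Gamma> S) T" unfolding geom_subspace_def induced_def by auto
qed

lemma gen_induced:
  assumes S: "geom_subspace \<Gamma> S" and B: "B \<subseteq> S"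
  shows "gen (induced \<Gamma> S) B = gen \<Gamma> B"
proof
  have SP: "S \<subseteq> points \<Gamma>" using S by (simp add: geom_subspace_def)
  have "geom_subspace (induced \<Gamma> S) (gen \<Gamma> B)"
    using geom_subspace_induced[OF S] gen_least[OF B S] geom_subspace_gen[of B] B SP by auto
  then show "gen (induced \<Gamma> S) B \<subseteq> gen \<Gamma> B"
    unfolding gen_def[of "induced \<Gamma> S"] by (rule hull_minimal[OF gen_superset])
  show "gen \<Gamma> B \<subseteq> gen (induced \<Gamma> S) B"
    unfolding gen_def[of "induced \<Gamma> S"] hull_def
    by (rule Inter_greatest) (use geom_subspace_induced[OF S] gen_least in auto)
qed

text \<open>
  In a singular subspace generating is spanning, so that a basis from linear algebra is a minimal spanning set.\<close>

lemma singular_rank_le: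
  assumes S: "geom_subspace \<Gamma> S" and M: "M \<subseteq> S" "geom_subspace \<Gamma> M" "singular \<Gamma> M"
    and D: "finite D" "D \<subseteq> points \<Gamma>" "M \<subseteq> linear_closure D"
  shows "singular_rank (induced \<Gamma> S) M \<le> enat (card D)"
proof -
  obtain B where B: "B \<subseteq> M" "finite B" "card B \<le> card D" "lin.indep B" "linear_closure B = linear_closure M"
    using lin.exists_small_basis[OF D] by blast
  have genM: "gen \<Gamma> A = linear_closure A" if "A \<subseteq> M" for A
    using gen_eq_linear_closure_singular[OF M(2,3) that] .
  have "gen \<Gamma> M = M" using gen_least[OF subset_refl M(2)] gen_superset by blast
  then have clM: "linear_closure M = M" using genM[OF subset_refl] by simp
  have gi: "gen (induced \<Gamma> S) A = linear_closure A" if "A \<subseteq> M" for A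
    using gen_induced[OF S, of A] genM that M(1) by auto
  have "gen (induced \<Gamma> S) C \<noteq> M" if C: "C \<subset> B" for C
  proof
    assume e: "gen (induced \<Gamma> S) C = M"
    obtain x where x: "x \<in> B" "x \<notin> C" using C by blast
    have BP: "B \<subseteq> points \<Gamma>" using B(4) by (simp add: lin.indep_def)
    have "linear_closure C \<subseteq> linear_closure (B - {x})" using C x BP by (intro lin.cl_mono) auto
    moreover have "linear_closure C = M" using e gi[of C] C B(1) by auto
    ultimately show False using x B(1,4) unfolding lin.indep_def by blast
  qed
  then have "minimal_spanning (induced \<Gamma> S) M B"
    using B(1,5) gi[OF B(1)] clM by (simp add: minimal_spanning_def)
  then have "singular_rank (induced \<Gamma> S) M \<le> (if finite B then enat (card B) else \<infinity>)"
    unfolding singular_rank_def by (intro INF_lower) simp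
  also have "\<dots> \<le> enat (card D)" using B by simp
  finally show ?thesis .
qed

text \<open>
  No point of \<open>l\<close> is in the radical. So there are a point \<open>y\<close> of \<open>S\<close> that is collinear with a single point \<open>q\<close> of \<open>l\<close>, and a
  point \<open>z\<close> of \<open>S\<close> that is not collinear with \<open>q\<close> but with some other point \<open>p\<close> of \<open>l\<close>. With \<open>x\<close> the point of the line \<open>pz\<close>
  collinear with \<open>y\<close>, the points \<open>q, p, x, y\<close> form a quadrangle.\<close>

lemma quadrangle_from_line:
  assumes S: "geom_subspace \<Gamma> S" and l: "l \<in> lines \<Gamma>" "l \<subseteq> S" "m \<in> l" and R: "l \<inter> Rad \<Gamma> S = {}"
  shows "\<exists>a b c d. quadrangle \<Gamma> a b c d \<and> {a, b, c, d} \<subseteq> S"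
proof -
  have SP: "S \<subseteq> points \<Gamma>" using S by (simp add: geom_subspace_def)
  have far: "\<exists>y\<in>S. \<not> collinear \<Gamma> y x" if "x \<in> l" for x
  proof -
    have "x \<in> S" "x \<notin> Rad \<Gamma> S" using that l(2) R by auto
    then show ?thesis using SP unfolding Rad_def perp_def by blast
  qed
  obtain y where y: "y \<in> S" "\<not> collinear \<Gamma> y m" using far l by blast
  obtain q where q: "q \<in> l" "collinear \<Gamma> y q" using exists_on_line[of y l m] y l SP by blast
  obtain z where z: "z \<in> S" "\<not> collinear \<Gamma> z q" using far q by blast
  obtain p where p: "p \<in> l" "collinear \<Gamma> z p" using exists_on_line[of z l m] z l SP by blast
  have pq: "p \<noteq> q" using p z by blast
  have yp: "\<not> collinear \<Gamma> y p" using all_if_two[of y l p q m] y p q pq l SP by blast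
  have qp: "collinear \<Gamma> q p" using line_collinear[OF l(1) q(1) p(1)] .
  have "z \<noteq> p" using z qp collinear_sym by metis
  then obtain k where k: "k \<in> lines \<Gamma>" "z \<in> k" "p \<in> k" using p(2) by (auto simp: collinear_def)
  have pS: "p \<in> S" and qS: "q \<in> S" using p q l by auto
  have kS: "k \<subseteq> S" using geom_subspaceD[OF S k(1,2,3) z(1) pS \<open>z \<noteq> p\<close>] .
  obtain x where x: "x \<in> k" "collinear \<Gamma> y x" using exists_on_line[of y k z] y k SP by blast
  have xp: "x \<noteq> p" using x yp by blast
  have qx: "\<not> collinear \<Gamma> q x"
  proof
    assume "collinear \<Gamma> q x"
    then have "collinear \<Gamma> q z" using all_if_two[of q k x p z] k x xp qp qS SP by blast
    then show False using z collinear_sym by metis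
  qed
  have px: "collinear \<Gamma> p x" using line_collinear[OF k(1,3) x(1)] .
  have xy: "collinear \<Gamma> x y" using collinear_sym[OF x(2)] .
  have py: "\<not> collinear \<Gamma> p y" using yp collinear_sym by metis
  have "{q, p, x, y} \<subseteq> S" using qS pS x kS y by blast
  moreover from this have "quadrangle \<Gamma> q p x y"
    unfolding quadrangle_def using qp px xy q(2) qx py SP by blast
  ultimately show ?thesis by blast
qed

text \<open>
  Let \<open>r\<close> be the rank of the radical, which is generated by a set \<open>B\<close> of at most \<open>r\<close> points. By assumption there is a
  singular subspace \<open>M\<close> of rank greater than \<open>r + 1\<close>. It is contained neither in the span of \<open>B\<close> nor in that of \<open>B\<close> and
  one more point. So there are points \<open>m\<close> and \<open>n\<close> of \<open>M\<close> that are independent modulo the radical, and the line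
  joining them does not meet the radical.\<close>

lemma quadrangle_if_rank_nd:
  assumes fin: "polar_rank \<Gamma> < \<infinity>" and S: "geom_subspace \<Gamma> S" and rk: "2 \<le> rank_nd \<Gamma> S"
  shows "\<exists>a b c d. quadrangle \<Gamma> a b c d \<and> {a, b, c, d} \<subseteq> S"
proof -
  have SP: "S \<subseteq> points \<Gamma>" using S by (simp add: geom_subspace_def)
  let ?R = "Rad \<Gamma> S"
  have R: "geom_subspace \<Gamma> ?R"
    unfolding Rad_def by (rule geom_subspace_Int[OF geom_subspace_perp[OF SP] S])
  have sR: "singular \<Gamma> ?R" by (auto simp: singular_def Rad_def perp_def)
  have "singular_rank \<Gamma> ?R \<le> polar_rank \<Gamma>"
    unfolding polar_rank_def using R sR by (intro SUP_upper) simp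
  then have "singular_rank \<Gamma> ?R < \<infinity>" using fin by (rule le_less_trans)
  then obtain r where r: "singular_rank \<Gamma> ?R = enat r" by (metis enat_ord_simps(6) less_infinityE)
  then have "singular_rank \<Gamma> ?R < enat (Suc r)" by simp
  then obtain B where B: "minimal_spanning \<Gamma> ?R B" "(if finite B then enat (card B) else \<infinity>) < enat (Suc r)"
    unfolding singular_rank_def INF_less_iff by blast
  then have Bf: "finite B" "card B \<le> r" by (auto split: if_splits)
  have BR: "B \<subseteq> ?R" "gen \<Gamma> B = ?R" using B(1) by (auto simp: minimal_spanning_def)
  have BP: "B \<subseteq> points \<Gamma>" using BR SP by (auto simp: Rad_def)
  have Rcl: "?R \<subseteq> linear_closure B" using gen_subset_linear_closure[OF BP] BR by simp
  have "enat (Suc r) < polar_rank (induced \<Gamma> S)"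
  proof (cases "polar_rank (induced \<Gamma> S)")
    case (enat n)
    then have "2 \<le> enat (n - r)" using rk r by (simp add: rank_nd_def)
    then have "2 \<le> n - r" by (simp add: numeral_eq_enat)
    then show ?thesis using enat by simp
  qed simp
  then obtain M where M: "geom_subspace (induced \<Gamma> S) M" "singular (induced \<Gamma> S) M"
    and rM: "enat (Suc r) < singular_rank (induced \<Gamma> S) M"
    unfolding polar_rank_def less_SUP_iff by blast
  have MS: "M \<subseteq> S" and MG: "geom_subspace \<Gamma> M" using M(1) geom_subspace_induced[OF S] by auto
  have Ms: "singular \<Gamma> M"
    using M(2) MS SP collinear_inducedD unfolding singular_def perp_def by blast
  note bound = singular_rank_le[OF S MS MG Ms]
  have "\<not> M \<subseteq> linear_closure B"
  proof
    assume "M \<subseteq> linear_closure B"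
    then have "singular_rank (induced \<Gamma> S) M \<le> enat (card B)" using bound Bf BP by blast
    also have "\<dots> \<le> enat (Suc r)" using Bf by simp
    finally show False using rM by simp
  qed
  then obtain m where m: "m \<in> M" "m \<notin> linear_closure B" by blast
  have mP: "m \<in> points \<Gamma>" using m MS SP by blast
  have mBP: "insert m B \<subseteq> points \<Gamma>" using BP mP by simp
  have "\<not> M \<subseteq> linear_closure (insert m B)"
  proof
    assume "M \<subseteq> linear_closure (insert m B)"
    then have "singular_rank (induced \<Gamma> S) M \<le> enat (card (insert m B))" using bound Bf mBP by blast
    also have "\<dots> \<le> enat (Suc r)" using Bf card_insert_le_m1[of "Suc r" B m] by (simp add: card_insert_if)
    finally show False using rM by simp
  qed
  then obtain n where n: "n \<in> M" "n \<notin> linear_closure (insert m B)" by blast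
  have mcl: "m \<in> linear_closure (insert m B)" using lin.cl_extensive[OF mBP] by blast
  then have mn: "m \<noteq> n" using n by blast
  have "collinear \<Gamma> m n" using Ms m n by (auto simp: singular_def perp_def)
  then obtain l where l: "l \<in> lines \<Gamma>" "m \<in> l" "n \<in> l" using mn by (auto simp: collinear_def)
  have lS: "l \<subseteq> S" using geom_subspaceD[OF MG l m(1) n(1) mn] MS by blast
  have "l \<inter> ?R = {}"
  proof (rule ccontr)
    assume "l \<inter> ?R \<noteq> {}"
    then obtain x where x: "x \<in> l" "x \<in> ?R" by blast
    have xB: "x \<in> linear_closure B" using x Rcl by blast
    then have "x \<noteq> m" using m by blast
    moreover have "x \<in> linear_closure (insert m B)" using lin.cl_mono[OF _ mBP, of B] xB by blast
    ultimately have "l \<subseteq> linear_closure (insert m B)"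
      using geom_subspaceD[OF geom_subspace_linear_closure[OF mBP] l(1) x(1) l(2)] mcl by blast
    then show False using n l by blast
  qed
  then show ?thesis using quadrangle_from_line[OF S l(1) lS l(2)] by blast
qed

end

section \<open>Subspaces arise from the universal embedding\<close>

context embedded_polar_space_with_quadrangle
begin

text \<open>
  The form and the bound on hyperbolic lines, both consequences of universality, make the cone tight, so that
  a subspace containing a quadrangle contains all points in its linear span.\<close>

theorem subspace_arises:
  assumes univ: "absolutely_universal \<Gamma> K V \<epsilon>" and S: "geom_subspace \<Gamma> S"
    and q: "quadrangle \<Gamma> a b c d" "{a, b, c, d} \<subseteq> S"
  shows "linear_closure S = S"
proof
  have SP: "S \<subseteq> points \<Gamma>" using S by (simp add: geom_subspace_def)
  then show "S \<subseteq> linear_closure S" by (rule lin.cl_extensive)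
  obtain \<beta> \<sigma> where "sesquilinear_cone K V (cone (points \<Gamma>)) cone_perp \<beta> \<sigma>"
    using universal_form[OF univ] by blast
  then interpret Q: sesquilinear_cone K V "cone (points \<Gamma>)" cone_perp \<beta> \<sigma> .
  obtain st where st:
    "\<forall>t\<in>carrier K. st t \<in> carrier K \<and> st (st t) = t"
    "\<forall>s\<in>carrier K. \<forall>t\<in>carrier K. st (s \<oplus> t) = st s \<oplus> st t"
    "\<forall>l\<in>carrier K. \<forall>t\<in>carrier K. \<forall>m\<in>carrier K. st (l \<otimes> t \<otimes> \<sigma> m) = m \<otimes> st t \<otimes> \<sigma> l"
    "\<forall>v\<in>carrier V. \<forall>w\<in>carrier V. \<beta> w v = st (\<beta> v w)"
    using Q.adjoint_exists by blast
  have herm: "hermitian_cone K V (cone (points \<Gamma>)) cone_perp \<beta> \<sigma> st"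
    by (intro hermitian_cone.intro hermitian_cone_axioms.intro Q.sesquilinear_cone_axioms)
       (use st in blast)+
  interpret T: tight_cone K V "cone (points \<Gamma>)" cone_perp \<beta> \<sigma> st
    by (intro tight_cone.intro tight_cone_axioms.intro herm)
       (rule hyperbolic_line_traces[OF univ herm])
  obtain a' b' c' d' where q': "quad a' b' c' d'" "{a', b', c', d'} \<subseteq> cone S"
    using quad_of_quadrangle[OF q SP] by blast
  have sub: "vec ` S \<subseteq> cone S" 
  proof
    fix v assume "v \<in> vec ` S"
    then obtain p where p: "p \<in> S" "v = vec p" by blast
    then show "v \<in> cone S" using coneI[OF vec_carrier _ eps_vec] SP by auto
  qed
  show "linear_closure S \<subseteq> S"
  proof
    fix p assume "p \<in> linear_closure S"
    then have p: "p \<in> points \<Gamma>" "vec p \<in> span (vec ` S)" by (auto simp: linear_closure_def)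
    have "vec p \<in> span (cone S)" using p span_mono[OF sub] by blast
    then have "vec p \<in> cone S" using T.csub_spanned[OF csub_cone[OF S] q' vec_cone[OF p(1)]] by blast
    then show "p \<in> S" using cone_iff_point[OF SP p(1) eps_vec[OF p(1)] vec_carrier[OF p(1)]] by blast
  qed
qed

end

section \<open>Minimal generating sets\<close>

theorem corollary6:
  fixes \<Gamma> :: "'p geometry"
    and K :: "'k ring" and V :: "('k, 'v) module" and \<epsilon> :: "'p \<Rightarrow> 'v set"
    and X :: "'p set"
  assumes "polar_space \<Gamma>"
    and "nondegenerate \<Gamma>"
    and "polar_rank \<Gamma> < \<infinity>"
    and "2 \<le> polar_rank \<Gamma>"
    and "embedding \<Gamma> K V \<epsilon>"
    and "absolutely_universal \<Gamma> K V \<epsilon>"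
    and "X \<subseteq> points \<Gamma>"
    and "2 \<le> rank_nd \<Gamma> (gen \<Gamma> X)"
  shows "\<exists>Y\<subseteq>X. gen \<Gamma> Y = gen \<Gamma> X \<and> (\<forall>Z. Z \<subset> Y \<longrightarrow> gen \<Gamma> Z \<noteq> gen \<Gamma> X)"
proof -
  have lv: "left_vector_space K V" using assms(5) by (simp add: embedding_def)
  interpret E: embedded_polar_space \<Gamma> K V \<epsilon>
    by (intro embedded_polar_space.intro embedded_polar_space_axioms.intro lv assms(1,2,5))
  have X: "X \<subseteq> points \<Gamma>" by fact
  obtain a b c d where q: "quadrangle \<Gamma> a b c d" and qX: "{a, b, c, d} \<subseteq> gen \<Gamma> X"
    using E.quadrangle_if_rank_nd[OF assms(3) E.geom_subspace_gen[OF X] assms(8)] by blast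
  interpret T: embedded_polar_space_with_quadrangle \<Gamma> K V \<epsilon>
    by (intro embedded_polar_space_with_quadrangle.intro embedded_polar_space_with_quadrangle_axioms.intro
        E.embedded_polar_space_axioms) (use q in blast)
  have "\<exists>F\<subseteq>X. finite F \<and> G \<subseteq> gen \<Gamma> F" if "finite G" "G \<subseteq> gen \<Gamma> X" for G
    using that
  proof (induction G)
    case (insert g G)
    then obtain F where F: "F \<subseteq> X" "finite F" "G \<subseteq> gen \<Gamma> F" by auto
    obtain F' where F': "F' \<subseteq> X" "finite F'" "g \<in> gen \<Gamma> F'"
      using E.gen_finitary[OF X, of g] insert.prems by auto
    have "insert g G \<subseteq> gen \<Gamma> (F \<union> F')"
      using F(3) F'(3) E.gen_mono[of F "F \<union> F'"] E.gen_mono[of F' "F \<union> F'"] by blast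
    then show ?case using F F' by (intro exI[of _ "F \<union> F'"]) auto
  qed auto
  from this[of "{a, b, c, d}"] obtain F where F: "F \<subseteq> X" "finite F" "{a, b, c, d} \<subseteq> gen \<Gamma> F"
    using qX by auto
  have FP: "F \<subseteq> points \<Gamma>" using F X by blast
  have gen_cl: "gen \<Gamma> A = E.linear_closure A" if A: "F \<subseteq> A" "A \<subseteq> points \<Gamma>" for A
  proof
    show "gen \<Gamma> A \<subseteq> E.linear_closure A" using E.gen_subset_linear_closure[OF A(2)] .
    have "{a, b, c, d} \<subseteq> gen \<Gamma> A" using F(3) E.gen_mono[OF A(1)] by blast
    then have "E.linear_closure (gen \<Gamma> A) = gen \<Gamma> A"
      using T.subspace_arises[OF assms(6) E.geom_subspace_gen[OF A(2)] q] by blast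
    then show "E.linear_closure A \<subseteq> gen \<Gamma> A"
      using E.lin.cl_mono[OF E.gen_superset E.gen_points[OF A(2)]] by blast
  qed
  \<comment> \<open>Independence modulo all of \<open>F\<close> makes the points of \<open>Y\<close> indispensable whatever subset of \<open>F\<close> is kept.\<close>
  obtain Y where Y: "Y \<subseteq> X" "E.linear_closure (F \<union> Y) = E.linear_closure (F \<union> X)"
    and ind: "\<And>y. y \<in> Y \<Longrightarrow> y \<notin> E.linear_closure (F \<union> (Y - {y}))"
    using E.lin.exists_relative_basis[OF FP X] by blast
  have FX: "F \<union> X = X" using F by blast
  have genY: "gen \<Gamma> (F \<union> Y) = gen \<Gamma> X"
    using gen_cl[of "F \<union> Y"] gen_cl[of X] Y FX F(1) X FP by auto
  let ?good = "\<lambda>W. W \<subseteq> F \<and> gen \<Gamma> (W \<union> Y) = gen \<Gamma> X"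
  obtain W where W: "?good W" and min: "\<And>W'. ?good W' \<Longrightarrow> card W \<le> card W'"
    using ex_has_least_nat[of ?good F card] genY by blast
  have Wf: "finite W" using W F(2) finite_subset by blast
  show ?thesis
  proof (intro exI[of _ "W \<union> Y"] conjI allI impI)
    show "W \<union> Y \<subseteq> X" using W F Y by blast
    show "gen \<Gamma> (W \<union> Y) = gen \<Gamma> X" using W by blast
    fix Z assume Z: "Z \<subset> W \<union> Y"
    then obtain x where x: "x \<in> W \<union> Y" "x \<notin> Z" by blast
    show "gen \<Gamma> Z \<noteq> gen \<Gamma> X"
    proof
      assume e: "gen \<Gamma> Z = gen \<Gamma> X"
      show False
      proof (cases "x \<in> Y")
        case True
        have "Z \<subseteq> F \<union> (Y - {x})" using Z x W by blast
        then have "gen \<Gamma> X \<subseteq> gen \<Gamma> (F \<union> (Y - {x}))" using e E.gen_mono by metis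
        moreover have "x \<in> gen \<Gamma> X" using True Y E.gen_superset by blast
        moreover have "gen \<Gamma> (F \<union> (Y - {x})) = E.linear_closure (F \<union> (Y - {x}))"
          using gen_cl[of "F \<union> (Y - {x})"] FP Y X by blast
        ultimately show False using ind[OF True] by blast
      next
        case False
        then have xW: "x \<in> W" using x by blast
        have "Z \<subseteq> (W - {x}) \<union> Y" using Z x by blast
        then have "gen \<Gamma> X \<subseteq> gen \<Gamma> ((W - {x}) \<union> Y)" using e E.gen_mono by metis
        moreover have "gen \<Gamma> ((W - {x}) \<union> Y) \<subseteq> gen \<Gamma> (W \<union> Y)" by (rule E.gen_mono) blast
        ultimately have "?good (W - {x})" using W by blast
        then have "card W \<le> card (W - {x})" by (rule min)
        then show False using xW Wf card_Diff1_less[of W x] by simp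
      qed
    qed
  qed
qed

end
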